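(* Let $r\ge0$, let $\omega:[-r,0]\to[0,\infty)$ be continuous, let $\sigma:[0,1]\to[-r,1]$ be continuously differentiable with constant derivative $\sigma'\equiv1$ or $\sigma'\equiv-1$, let $f:[0,1]\times[0,\infty)\times[0,\infty)\to[0,\infty)$, and let $\rho>0$. Assume: (H1) for all $u,v\in\mathcal C([0,1],[0,\infty))$ the function $t\mapsto f(t,u(t),v(t))$ is measurable; (H2) there is $M_\rho\in L^1([0,1])$ with $f(t,u,v)\le M_\rho(t)$ for a.a. $t\in[0,1]$ and all $0\le u,v\le\rho+\|\omega\|_{[-r,0]}$; (H3) there is $\delta_\rho\in L^1([1/4,3/4])$ with $f(t,u,v)\ge\delta_\rho(t)$ for a.a. $t\in[1/4,3/4]$ and all $0\le u,v\le\rho+\|\omega\|_{[-r,0]}$, and $\bar\delta:=\sup_{t\in[1/4,3/4]}\int_{1/4}^{3/4}k(t,s)\delta_\rho(s)\,ds>0$; (D) there exist two countable families of curves $\gamma_n:I_n=[a_n,b_n]\to[0,\infty)$, $n\in\mathbb N$, and $\Gamma_j:\mathcal I_j=[c_j,d_j]\to[0,\infty)$, $j\in\mathbb N$, such that for a.a. $t\in[0,1]$ the function $f(t,\cdot,\cdot)$ is continuous on $\big([0,\infty)\setminus\bigcup_{n:\,t\in I_n}\{\gamma_n(t)\}\big)\times\big([0,\infty)\setminus\bigcup_{j:\,t\in\mathcal I_j}\{\Gamma_j(t)\}\big)$, and there is $\bar\lambda>\rho/\bar\delta$ such that for each $\lambda\in(0,\bar\lambda]$: each $\gamma_n$ is a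 $\lambda$-admissible discontinuity curve, and each $\Gamma_j$ satisfies (a) $\Gamma_j(t)\neq\omega(\sigma(t))$ for a.a. $t\in\mathcal I_j\cap\sigma^{-1}([-r,0])$; (b) there exist $\varepsilon_j>0$ and $\psi_j\in L^1(\mathcal I_j)$ with $\psi_j(t)>0$ for a.a. $t\in\mathcal I_j\cap\sigma^{-1}([0,1])$ such that either $-\Gamma_j''(t)+\psi_j(t)<\lambda f(\sigma(t),y,z)$ for a.a. $t\in\mathcal I_j\cap\sigma^{-1}([0,1])$, all $y\in[\Gamma_j(t)-\varepsilon_j,\Gamma_j(t)+\varepsilon_j]$ and all $z\ge0$; or $-\Gamma_j''(t)-\psi_j(t)>\lambda f(\sigma(t),y,z)$ for a.a. $t\in\mathcal I_j\cap\sigma^{-1}([0,1])$, all such $y$ and all $z\ge0$. Then there exist $\lambda_\rho\in(0,\bar\lambda)$ and $u_\rho\in\partial K_{y,\rho}$ satisfying $u_\rho(t)=y(t)+\lambda_\rho\int_0^1k(t,s)f(s,u_\rho(s),u_\rho(\sigma(s)))\,ds$ for all $t\in[-r,1]$, i.e. they solve $u''(t)+\lambda_\rho f(t,u(t),u(\sigma(t)))=0$ on $[0,1]$, $u=\omega$ on $[-r,0]$, $u(1)=0$.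
   Context: Notation: $\|u\|_{[a,b]}=\sup_{t\in[a,b]}|u(t)|$. Let $G(t,s)=t(1-s)$ if $0\le t\le s\le1$ and $G(t,s)=(1-t)s$ if $0\le s<t\le1$; define $k:[-r,1]\times[0,1]\to\mathbb R$ by $k(t,s)=G(t,s)$ if $t\ge0$ and $k(t,s)=0$ if $t<0$. Define $y(t)=\omega(t)$ for $t\in[-r,0]$ and $y(t)=(1-t)\omega(0)$ for $t\in(0,1]$. Let $K=\{u\in\mathcal C([-r,1],[0,\infty)): u=0 \text{ on } [-r,0],\ \min_{t\in[1/4,3/4]}u(t)\ge\tfrac14\|u\|_{[0,1]}\}$, $K_y=y+K$, $K_{y,\rho}=\{y+u:u\in K,\ \|u\|_{[0,1]}<\rho\}$, and $\partial K_{y,\rho}$ its boundary relative to $K_y$, i.e. $\{y+u:u\in K,\ \|u\|_{[0,1]}=\rho\}$. A solution of the boundary value problem means a function $u\in\mathcal C([-r,1])$ satisfying the stated integral equation. A $\lambda$-admissible discontinuity curve is a function $\gamma\in W^{2,1}([a,b])$, $[a,b]\subset[0,1]$, $\gamma\ge0$, for which there exist $\varepsilon>0$ and $\psi\in L^1(a,b)$ with $\psi>0$ a.e. such that either $-\gamma''(t)+\psi(t)<\lambda f(t,y,z)$ for a.a. $t\in[a,b]$, all $y\in[\gamma(t)-\varepsilon,\gamma(t)+\varepsilon]$ and all $z\ge0$; or $-\gamma''(t)-\psi(t)>\lambda f(t,y,z)$ for a.a. $t\in[a,b]$, all such $y$ and all $z\ge0$. *)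

theory Defs
  imports "HOL-Analysis.Analysis"
begin

definition supnorm :: "real \<Rightarrow> real \<Rightarrow> (real \<Rightarrow> real) \<Rightarrow> real" where
  "supnorm a b u = (SUP t\<in>{a..b}. \<bar>u t\<bar>)"

definition Green :: "real \<Rightarrow> real \<Rightarrow> real" where
  "Green t s = (if t \<le> s then t * (1 - s) else (1 - t) * s)"

definition kern :: "real \<Rightarrow> real \<Rightarrow> real" where
  "kern t s = (if 0 \<le> t then Green t s else 0)"

definition yfun :: "(real \<Rightarrow> real) \<Rightarrow> real \<Rightarrow> real" where
  "yfun \<omega> t = (if t \<le> 0 then \<omega> t else (1 - t) * \<omega> 0)"

text \<open>The cone K of functions on [-r,1] (values outside [-r,1] are irrelevant).\<close>
definition Kcone :: "real \<Rightarrow> (real \<Rightarrow> real) set" where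
  "Kcone r = {u. continuous_on {-r..1} u \<and> (\<forall>t\<in>{-r..1}. 0 \<le> u t)
      \<and> (\<forall>t\<in>{-r..0}. u t = 0)
      \<and> (INF t\<in>{1/4..3/4}. u t) \<ge> 1/4 * supnorm 0 1 u}"

definition bdryK :: "real \<Rightarrow> (real \<Rightarrow> real) \<Rightarrow> real \<Rightarrow> (real \<Rightarrow> real) set" where
  "bdryK r \<omega> \<rho> = {w. \<exists>u\<in>Kcone r. supnorm 0 1 u = \<rho> \<and> (\<forall>t\<in>{-r..1}. w t = yfun \<omega> t + u t)}"

text \<open>W^{2,1}([a,b]) with explicit first derivative g1 and (a.e.) second derivative g2:
  g2 is integrable, g1 is its indefinite integral, g is the indefinite integral of g1.\<close>
definition W21_with :: "(real \<Rightarrow> real) \<Rightarrow> (real \<Rightarrow> real) \<Rightarrow> (real \<Rightarrow> real) \<Rightarrow> real \<Rightarrow> real \<Rightarrow> bool" where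
  "W21_with g g1 g2 a b \<longleftrightarrow> a \<le> b \<and> integrable (lebesgue_on {a..b}) g2 \<and>
     (\<forall>t\<in>{a..b}. g1 t = g1 a + integral\<^sup>L (lebesgue_on {a..t}) g2
                 \<and> g t = g a + integral\<^sup>L (lebesgue_on {a..t}) g1)"

definition adm_curve :: "real \<Rightarrow> (real \<Rightarrow> real \<Rightarrow> real \<Rightarrow> real) \<Rightarrow> (real \<Rightarrow> real) \<Rightarrow> real \<Rightarrow> real \<Rightarrow> bool" where
  "adm_curve lam f \<gamma> a b \<longleftrightarrow> 0 \<le> a \<and> a \<le> b \<and> b \<le> 1 \<and> (\<forall>t\<in>{a..b}. 0 \<le> \<gamma> t) \<and>
     (\<exists>g1 g2. W21_with \<gamma> g1 g2 a b \<and>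
       (\<exists>\<epsilon>>0. \<exists>\<psi>. integrable (lebesgue_on {a..b}) \<psi> \<and>
          (AE t in lebesgue. t \<in> {a..b} \<longrightarrow> 0 < \<psi> t) \<and>
          ((AE t in lebesgue. t \<in> {a..b} \<longrightarrow>
              (\<forall>y\<in>{\<gamma> t - \<epsilon>..\<gamma> t + \<epsilon>}. 0 \<le> y \<longrightarrow> (\<forall>z\<ge>0. - g2 t + \<psi> t < lam * f t y z)))
           \<or> (AE t in lebesgue. t \<in> {a..b} \<longrightarrow>
              (\<forall>y\<in>{\<gamma> t - \<epsilon>..\<gamma> t + \<epsilon>}. 0 \<le> y \<longrightarrow> (\<forall>z\<ge>0. - g2 t - \<psi> t > lam * f t y z))))))"

definition adm_curve_sigma :: "real \<Rightarrow> real \<Rightarrow> (real \<Rightarrow> real) \<Rightarrow> (real \<Rightarrow> real)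
    \<Rightarrow> (real \<Rightarrow> real \<Rightarrow> real \<Rightarrow> real) \<Rightarrow> (real \<Rightarrow> real) \<Rightarrow> real \<Rightarrow> real \<Rightarrow> bool" where
  "adm_curve_sigma lam r \<omega> \<sigma> f \<Gamma> c d \<longleftrightarrow> c \<le> d \<and> (\<forall>t\<in>{c..d}. 0 \<le> \<Gamma> t) \<and>
     (AE t in lebesgue. t \<in> {c..d} \<and> t \<in> {0..1} \<and> \<sigma> t \<in> {-r..0} \<longrightarrow> \<Gamma> t \<noteq> \<omega> (\<sigma> t)) \<and>
     (\<exists>g1 g2. W21_with \<Gamma> g1 g2 c d \<and>
       (\<exists>\<epsilon>>0. \<exists>\<psi>. integrable (lebesgue_on {c..d}) \<psi> \<and>
          (AE t in lebesgue. t \<in> {c..d} \<and> t \<in> {0..1} \<and> \<sigma> t \<in> {0..1} \<longrightarrow> 0 < \<psi> t) \<and>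
          ((AE t in lebesgue. t \<in> {c..d} \<and> t \<in> {0..1} \<and> \<sigma> t \<in> {0..1} \<longrightarrow>
              (\<forall>y\<in>{\<Gamma> t - \<epsilon>..\<Gamma> t + \<epsilon>}. 0 \<le> y \<longrightarrow> (\<forall>z\<ge>0. - g2 t + \<psi> t < lam * f (\<sigma> t) y z)))
           \<or> (AE t in lebesgue. t \<in> {c..d} \<and> t \<in> {0..1} \<and> \<sigma> t \<in> {0..1} \<longrightarrow>
              (\<forall>y\<in>{\<Gamma> t - \<epsilon>..\<Gamma> t + \<epsilon>}. 0 \<le> y \<longrightarrow> (\<forall>z\<ge>0. - g2 t - \<psi> t > lam * f (\<sigma> t) y z))))))"

definition deltabar :: "(real \<Rightarrow> real) \<Rightarrow> real" where
  "deltabar \<delta> = (SUP t\<in>{1/4..3/4}. integral\<^sup>L (lebesgue_on {1/4..3/4}) (\<lambda>s. kern t s * \<delta> s))"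

end

theory Submission
  imports Defs "HOL-Complex_Analysis.Great_Picard"
begin

text \<open>
  The integral operator is discontinuous at functions that run along a discontinuity curve, so
  Schauder's theorem does not apply to it. Instead, one takes a finite net of continuous functions
  \<open>x\<^sub>i\<close> that avoid all curves almost everywhere (all but countably many levels of a perturbation by a
  constant do), and finds by Brouwer's theorem weights \<open>c\<^sub>i\<close> such that the forcing
  \<open>h(s) = \<Sum>\<^sub>i c\<^sub>i f(s, x\<^sub>i(s), x\<^sub>i(\<sigma>(s)))\<close> has a potential \<open>w = \<lambda> \<integral> k(\<cdot>, s) h(s) ds\<close>, with \<open>\<lambda>\<close>
  chosen so that \<open>\<parallel>w\<parallel> = \<rho>\<close>, and \<open>c\<^sub>i > 0\<close> only if \<open>x\<^sub>i\<close> is uniformly close to \<open>y + w\<close>.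
  As the net gets finer, a subsequence of these \<open>(\<lambda>, w)\<close> converges. The limit \<open>u = y + w\<close> meets each
  admissible curve only finitely often, because near a crossing the difference of \<open>u\<close> and the curve
  is strictly concave or strictly convex. Hence \<open>(u(t), u(\<sigma>(t)))\<close> is a point of continuity for
  almost every \<open>t\<close>, the forcings converge pointwise to \<open>f(t, u(t), u(\<sigma>(t)))\<close>, and dominated
  convergence gives the equation.
\<close>

text \<open>The factor \<lambda> is \<rho> divided by the norm of \<open>Kop h\<close>, and (H2) and
  (H3) keep that norm between \<open>deltabar \<delta>\<close> and the integral of \<open>M\<close>.
  So \<lambda> stays in a compact interval of positive numbers whose right end is below
  \<open>lbar\<close>. Its limit is not known beforehand, hence admissibility for every \<lambda> up
  to \<open>lbar\<close>; the solution is tested with it only at the limit.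

  The obstacle is a circle: the forcings converge only where the limit u avoids the curves, while
  avoidance concerns the second derivative of u, that is, the forcings. Two facts break it. The
  admissibility inequality is affine in the value of f, so it passes to convex combinations and
  holds for each approximate forcing before any convergence is known. And integrated against a tent
  function, a forcing becomes a second difference of w, which converges with w.

  Where \<sigma>(t) \<ge> 0, a curve for u(\<sigma>(t)) becomes a curve for u(s) in the variable s =
  \<sigma>(t); since \<sigma> is an isometry, the second derivative gets no factor.\<close>

section \<open>Brouwer's theorem on the cube and the selection of weights\<close>

text \<open>Kuhn's combinatorial lemma on the grid of mesh 1/p gives a cell in which, for every i, F
  x i - x i is nonnegative at one vertex and nonpositive at another; the Lipschitz bound makes it
  small at the corner. The dimension n will be the size of a net found during the proof, so points
  are functions on \<open>nat\<close> of which the first n values count.\<close>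

lemma brouwer_cube_approx:
  fixes F :: "(nat \<Rightarrow> real) \<Rightarrow> nat \<Rightarrow> real"
  assumes cube: "\<And>x i. (\<forall>j<n. 0 \<le> x j \<and> x j \<le> 1) \<Longrightarrow> i < n \<Longrightarrow> 0 \<le> F x i \<and> F x i \<le> 1"
    and lip: "\<And>x y i. (\<forall>j<n. 0 \<le> x j \<and> x j \<le> 1) \<Longrightarrow> (\<forall>j<n. 0 \<le> y j \<and> y j \<le> 1) \<Longrightarrow> i < n
      \<Longrightarrow> \<bar>F x i - F y i\<bar> \<le> L * (\<Sum>j<n. \<bar>x j - y j\<bar>)"
    and "0 \<le> L" and "0 < e"
  obtains x where "\<forall>j<n. 0 \<le> x j \<and> x j \<le> 1" "\<forall>i<n. \<bar>F x i - x i\<bar> \<le> e"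
proof -
  \<comment> \<open>1/p is the side of a cell and L * n / p bounds the variation of F across
    it.\<close>
  obtain p :: nat where p: "(1 + L * n) / e < p"
    using reals_Archimedean2 by blast
  have p0: "0 < p"
  proof -
    have "0 \<le> (1 + L * n) / e" using assms by simp
    with p have "0 < real p" by linarith
    then show ?thesis by simp
  qed
  have small: "(1 + L * n) / p \<le> e"
    using p p0 \<open>0 < e\<close> by (simp add: field_simps)
  define S where "S v j = real (v j) / real p" for v :: "nat \<Rightarrow> nat" and j :: nat
  \<comment> \<open>Label 0 says that F does not decrease coordinate i. The values at
    \<open>v i = 0\<close> and \<open>v i = p\<close> are forced, because Kuhn's lemma prescribes
    the labels on opposite faces.\<close>
  define label where "label v i = (if v i = 0 \<or> (v i < p \<and> S v i \<le> F (S v) i) then 0 else 1::nat)" for v i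
  have S_cube: "\<forall>j<n. 0 \<le> S v j \<and> S v j \<le> 1" if "\<forall>j<n. v j \<le> p" for v
    using that p0 by (auto simp: S_def)
  obtain q where q: "\<forall>i<n. q i < p"
    and qrs: "\<forall>i<n. \<exists>r s. (\<forall>j<n. q j \<le> r j \<and> r j \<le> q j + 1) \<and> (\<forall>j<n. q j \<le> s j \<and> s j \<le> q j + 1) \<and> label r i \<noteq> label s i"
    by (rule kuhn_lemma[of p n label]) (use p0 in \<open>auto simp: label_def\<close>)
  have qc: "\<forall>j<n. q j \<le> p" using q by auto
  have near: "\<bar>F (S q) i - F (S v) i\<bar> \<le> L * n / p"
    if v: "\<forall>j<n. q j \<le> v j \<and> v j \<le> q j + 1" and i: "i < n" for v i
  proof -
    have vc: "\<forall>j<n. v j \<le> p" using v q by fastforce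
    have "\<bar>F (S q) i - F (S v) i\<bar> \<le> L * (\<Sum>j<n. \<bar>S q j - S v j\<bar>)"
      using lip[OF S_cube[OF qc] S_cube[OF vc] i] .
    also have "\<dots> \<le> L * (\<Sum>j<n. 1 / real p)"
    proof (intro mult_left_mono sum_mono \<open>0 \<le> L\<close>)
      fix j assume "j \<in> {..<n}"
      then have "q j \<le> v j" "v j \<le> q j + 1" using v by auto
      then have "\<bar>real (q j) - real (v j)\<bar> \<le> 1" by linarith
      then show "\<bar>S q j - S v j\<bar> \<le> 1 / real p"
        using p0 by (simp add: S_def diff_divide_distrib[symmetric] divide_right_mono)
    qed
    finally show ?thesis by simp
  qed
  have "\<bar>F (S q) i - S q i\<bar> \<le> e" if i: "i < n" for i
  proof -
    obtain r s where rs: "\<forall>j<n. q j \<le> r j \<and> r j \<le> q j + 1" "\<forall>j<n. q j \<le> s j \<and> s j \<le> q j + 1"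
      "label r i = 0" "label s i \<noteq> 0"
    proof -
      from qrs i obtain r s where *: "\<forall>j<n. q j \<le> r j \<and> r j \<le> q j + 1" "\<forall>j<n. q j \<le> s j \<and> s j \<le> q j + 1"
        "label r i \<noteq> label s i" by blast
      then have "label r i = 0 \<and> label s i \<noteq> 0 \<or> label s i = 0 \<and> label r i \<noteq> 0"
        by (auto simp: label_def split: if_splits)
      with * that show ?thesis by blast
    qed
    have rc: "\<forall>j<n. r j \<le> p" and sc: "\<forall>j<n. s j \<le> p" using rs q by fastforce+
    \<comment> \<open>On the faces with forced labels the two inequalities still hold, since F maps
      the cube into itself.\<close>
    have "S r i \<le> F (S r) i"
    proof (cases "r i = 0")
      case True then show ?thesis using cube[OF S_cube[OF rc] i] by (simp add: S_def[of r i])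
    next
      case False then show ?thesis using rs(3) by (auto simp: label_def split: if_splits)
    qed
    moreover have "F (S s) i \<le> S s i"
    proof (cases "s i < p")
      case True then show ?thesis using rs(4) by (auto simp: label_def split: if_splits)
    next
      case False
      then have "s i = p" using sc i by (simp add: dual_order.antisym)
      then show ?thesis using cube[OF S_cube[OF sc] i] p0 by (simp add: S_def[of s i])
    qed
    moreover have "S q i \<le> S r i" using rs(1) i p0 by (simp add: S_def divide_right_mono)
    moreover have "S s i \<le> S q i + 1 / p"
    proof -
      have "real (s i) \<le> real (q i) + 1" using rs(2) i by fastforce
      then show ?thesis using p0 by (simp add: S_def add_divide_distrib[symmetric] divide_right_mono)
    qed
    moreover have "(1 + L * n) / p = 1 / p + L * n / p" by (simp add: add_divide_distrib)
    moreover have "0 \<le> 1 / real p" by simp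
    ultimately show ?thesis
      using near[OF rs(1) i] near[OF rs(2) i] small unfolding abs_le_iff by linarith
  qed
  then show ?thesis using that[OF S_cube[OF qc]] by blast
qed

text \<open>The proof applies Brouwer's theorem to the partition of unity subordinate to the sets
  where \<open>d i\<close> is small.\<close>
lemma simplex_cover_selection:
  fixes d :: "nat \<Rightarrow> (nat \<Rightarrow> real) \<Rightarrow> real" and n :: nat
  defines "\<Delta> \<equiv> {c. (\<forall>i<n. 0 \<le> c i) \<and> (\<Sum>i<n. c i) = 1}"
  assumes n: "0 < n"
    and lip: "\<And>i c c'. i < n \<Longrightarrow> c \<in> \<Delta> \<Longrightarrow> c' \<in> \<Delta> \<Longrightarrow> \<bar>d i c - d i c'\<bar> \<le> L * (\<Sum>j<n. \<bar>c j - c' j\<bar>)"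
    and L: "0 \<le> L"
    and cover: "\<And>c. c \<in> \<Delta> \<Longrightarrow> \<exists>i<n. d i c \<le> \<eta>" and \<eta>: "0 < \<eta>"
  obtains c where "c \<in> \<Delta>" "\<forall>i<n. 0 < c i \<longrightarrow> d i c < 3 * \<eta>"
proof -
  \<comment> \<open>A Lipschitz retraction of the cube onto the simplex.\<close>
  define P where "P x i = (x i + max 0 (1 - (\<Sum>j<n. x j)) / n) / max 1 (\<Sum>j<n. x j)"
    for x :: "nat \<Rightarrow> real" and i
  \<comment> \<open>The threshold is 2 * \<eta> although the cover has radius \<eta>: some summand
    of \<open>S c\<close> is then at least \<eta>, which keeps the denominator of \<open>F\<close>
    away from 0 and makes \<open>F\<close> Lipschitz.\<close>
  define \<phi> where "\<phi> i c = max 0 (2 * \<eta> - d i c)" for i c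
  define S where "S c = (\<Sum>i<n. \<phi> i c)" for c
  define F where "F x i = \<phi> i (P x) / S (P x)" for x i
  define cube where "cube = {x::nat \<Rightarrow> real. \<forall>j<n. 0 \<le> x j \<and> x j \<le> 1}"
  have P_simplex: "P x \<in> \<Delta>" if "x \<in> cube" for x
  proof -
    have "(\<Sum>i<n. P x i) = ((\<Sum>i<n. x i) + max 0 (1 - (\<Sum>j<n. x j))) / max 1 (\<Sum>j<n. x j)"
      using n by (simp add: P_def sum_divide_distrib[symmetric] sum.distrib)
    also have "\<dots> = 1" by (auto simp: max_def)
    finally have "(\<Sum>i<n. P x i) = 1" .
    moreover have "\<forall>i<n. 0 \<le> P x i"
      using that by (auto simp: P_def cube_def intro!: divide_nonneg_nonneg add_nonneg_nonneg)
    ultimately show ?thesis by (simp add: \<Delta>_def)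
  qed
  have P_id: "P x i = x i" if "x \<in> \<Delta>" "i < n" for x i
    using that by (simp add: P_def \<Delta>_def)
  have P_lip: "\<bar>P x i - P y i\<bar> \<le> 4 * (\<Sum>j<n. \<bar>x j - y j\<bar>)"
    if x: "x \<in> cube" and y: "y \<in> cube" and i: "i < n" for x y i
  proof -
    define s where "s = (\<Sum>j<n. x j)"
    define s' where "s' = (\<Sum>j<n. y j)"
    define \<delta> where "\<delta> = (\<Sum>j<n. \<bar>x j - y j\<bar>)"
    define A where "A = x i + max 0 (1 - s) / n"
    define A' where "A' = y i + max 0 (1 - s') / n"
    define m where "m = max 1 s"
    define m' where "m' = max 1 s'"
    have ss: "\<bar>s - s'\<bar> \<le> \<delta>"
      unfolding s_def s'_def \<delta>_def sum_subtractf[symmetric] by (rule sum_abs)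
    have xi: "\<bar>x i - y i\<bar> \<le> \<delta>"
      unfolding \<delta>_def using i by (intro member_le_sum[of i _ "\<lambda>j. \<bar>x j - y j\<bar>"]) auto
    have s'0: "0 \<le> s'" using y by (auto simp: s'_def cube_def intro!: sum_nonneg)
    have "\<bar>max 0 (1 - s) / n - max 0 (1 - s') / n\<bar> \<le> \<delta>"
    proof -
      have "\<bar>max 0 (1 - s) / n - max 0 (1 - s') / n\<bar> = \<bar>max 0 (1 - s) - max 0 (1 - s')\<bar> / n"
        by (simp add: diff_divide_distrib[symmetric])
      also have "\<dots> \<le> \<bar>max 0 (1 - s) - max 0 (1 - s')\<bar> / 1"
        using n by (intro divide_left_mono) auto
      also have "\<dots> \<le> \<delta>" using ss by auto
      finally show ?thesis .
    qed
    then have AA: "\<bar>A - A'\<bar> \<le> 2 * \<delta>" using xi unfolding A_def A'_def by linarith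
    have mm: "\<bar>m - m'\<bar> \<le> \<delta>" using ss by (auto simp: m_def m'_def)
    have A'2: "0 \<le> A'" "A' \<le> 2"
    proof -
      show "0 \<le> A'" using y i by (auto simp: A'_def cube_def)
      have "max 0 (1 - s') / n \<le> 1" using n s'0 by (auto simp: field_simps)
      moreover have "y i \<le> 1" using y i by (auto simp: cube_def)
      ultimately show "A' \<le> 2" unfolding A'_def by linarith
    qed
    have m1: "1 \<le> m" "1 \<le> m'" by (auto simp: m_def m'_def)
    \<comment> \<open>The difference of the quotients is split so that all denominators are at least
      1. The constant 4 is 2 from the numerators plus 2 from \<open>A' \<le> 2\<close> times the
      change of the denominator.\<close>
    have "P x i - P y i = (A - A') / m + A' * (m' - m) / (m * m')"
      using m1 unfolding P_def s_def[symmetric] s'_def[symmetric] A_def[symmetric] A'_def[symmetric]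
        m_def[symmetric] m'_def[symmetric] by (simp add: field_simps)
    also have "\<bar>\<dots>\<bar> \<le> \<bar>A - A'\<bar> / m + A' * \<bar>m' - m\<bar> / (m * m')"
      using m1 A'2 by (intro order.trans[OF abs_triangle_ineq]) (simp add: abs_mult)
    also have "\<dots> \<le> \<bar>A - A'\<bar> / 1 + A' * \<bar>m' - m\<bar> / 1"
    proof -
      have "1 \<le> m * m'" using m1 mult_mono[of 1 m 1 m'] by simp
      then show ?thesis using m1 A'2 by (intro add_mono divide_left_mono) auto
    qed
    also have "\<dots> \<le> 2 * \<delta> + 2 * \<delta>"
      using AA mm mult_mono[of A' 2 "\<bar>m' - m\<bar>" \<delta>] A'2 by (simp add: abs_minus_commute)
    finally show ?thesis by (simp add: \<delta>_def)
  qed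
  have P_lip_sum: "(\<Sum>i<n. \<bar>P x i - P y i\<bar>) \<le> 4 * n * (\<Sum>j<n. \<bar>x j - y j\<bar>)"
    if "x \<in> cube" "y \<in> cube" for x y :: "nat \<Rightarrow> real"
    using sum_bounded_above[of "{..<n}" "\<lambda>i. \<bar>P x i - P y i\<bar>" "4 * (\<Sum>j<n. \<bar>x j - y j\<bar>)"] P_lip[OF that]
    by (simp add: mult_ac)
  have \<phi>0: "0 \<le> \<phi> i c" for i c by (simp add: \<phi>_def)
  have \<phi>S: "\<phi> i c \<le> S c" if "i < n" for i c
    unfolding S_def using that \<phi>0 by (intro member_le_sum) auto
  have S_ge: "\<eta> \<le> S c" if c: "c \<in> \<Delta>" for c
  proof -
    obtain i where "i < n" "d i c \<le> \<eta>" using cover[OF c] by blast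
    then show ?thesis using \<phi>S[of i c] by (simp add: \<phi>_def)
  qed
  have F_simplex: "F x \<in> \<Delta>" if "x \<in> cube" for x
    using S_ge[OF P_simplex[OF that]] \<eta> \<phi>0
    by (auto simp: \<Delta>_def F_def sum_divide_distrib[symmetric] S_def[symmetric])
  have F_cube: "F x \<in> cube" if "x \<in> cube" for x
    using S_ge[OF P_simplex[OF that]] \<eta> \<phi>0 \<phi>S by (auto simp: cube_def F_def)
  have \<phi>_lip: "\<bar>\<phi> i c - \<phi> i c'\<bar> \<le> L * (\<Sum>j<n. \<bar>c j - c' j\<bar>)"
    if "i < n" "c \<in> \<Delta>" "c' \<in> \<Delta>" for i c c'
    using lip[OF that] by (auto simp: \<phi>_def)
  have \<phi>S_lip: "\<bar>\<phi> i c / S c - \<phi> i c' / S c'\<bar> \<le> (1 + n) * L / \<eta> * (\<Sum>j<n. \<bar>c j - c' j\<bar>)"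
    if i: "i < n" and c: "c \<in> \<Delta>" and c': "c' \<in> \<Delta>" for i c c'
  proof -
    define \<delta> where "\<delta> = (\<Sum>j<n. \<bar>c j - c' j\<bar>)"
    note Sc = S_ge[OF c] S_ge[OF c']
    have "\<bar>S c - S c'\<bar> \<le> (\<Sum>i<n. \<bar>\<phi> i c - \<phi> i c'\<bar>)"
      unfolding S_def sum_subtractf[symmetric] by (rule sum_abs)
    also have "\<dots> \<le> n * (L * \<delta>)"
      using sum_bounded_above[of "{..<n}" "\<lambda>i. \<bar>\<phi> i c - \<phi> i c'\<bar>" "L * \<delta>"] \<phi>_lip[OF _ c c']
      by (simp add: \<delta>_def)
    finally have SS: "\<bar>S c' - S c\<bar> \<le> n * (L * \<delta>)" by (simp add: abs_minus_commute)
    have q1: "0 \<le> \<phi> i c' / S c'" "\<phi> i c' / S c' \<le> 1" using \<phi>0 \<phi>S[OF i] Sc \<eta> by auto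
    have "\<phi> i c / S c - \<phi> i c' / S c' = (\<phi> i c - \<phi> i c') / S c + \<phi> i c' / S c' * ((S c' - S c) / S c)"
      using Sc \<eta> by (simp add: field_simps)
    also have "\<bar>\<dots>\<bar> \<le> \<bar>\<phi> i c - \<phi> i c'\<bar> / S c + \<phi> i c' / S c' * (\<bar>S c' - S c\<bar> / S c)"
      using Sc \<eta> \<phi>0[of i c'] by (intro order.trans[OF abs_triangle_ineq]) (simp add: abs_mult)
    also have "\<dots> \<le> (L * \<delta>) / \<eta> + 1 * (n * (L * \<delta>) / \<eta>)"
      using Sc \<eta> q1 SS \<phi>_lip[OF i c c']
      by (intro add_mono mult_mono frac_le) (auto simp: \<delta>_def)
    also have "\<dots> = (1 + n) * L / \<eta> * \<delta>" by (simp add: algebra_simps add_divide_distrib)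
    finally show ?thesis by (simp add: \<delta>_def)
  qed
  have F_lip: "\<bar>F x i - F y i\<bar> \<le> ((1 + n) * L / \<eta> * (4 * n)) * (\<Sum>j<n. \<bar>x j - y j\<bar>)"
    if x: "x \<in> cube" and y: "y \<in> cube" and i: "i < n" for x y i
  proof -
    have "\<bar>F x i - F y i\<bar> \<le> (1 + n) * L / \<eta> * (\<Sum>j<n. \<bar>P x j - P y j\<bar>)"
      unfolding F_def by (rule \<phi>S_lip[OF i P_simplex[OF x] P_simplex[OF y]])
    also have "\<dots> \<le> (1 + n) * L / \<eta> * (4 * n * (\<Sum>j<n. \<bar>x j - y j\<bar>))"
      using P_lip_sum[OF x y] L \<eta> by (intro mult_left_mono) auto
    finally show ?thesis by (simp only: mult.assoc)
  qed
  \<comment> \<open>\<open>P\<close> fixes \<open>F x\<close>, so an error e per coordinate in the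
    fixed point equation separates \<open>F x\<close> from \<open>P x\<close> by at most 4 * n * n *
    e in the l1 norm; L times this is to be at most \<eta>.\<close>
  define e where "e = \<eta> / (L * (4 * n * n) + 1)"
  have e: "0 < e" using \<eta> L by (auto simp: e_def intro!: divide_pos_pos add_nonneg_pos)
  obtain x where x: "\<forall>j<n. 0 \<le> x j \<and> x j \<le> 1" and xF: "\<forall>i<n. \<bar>F x i - x i\<bar> \<le> e"
  proof (rule brouwer_cube_approx[of n F "(1 + n) * L / \<eta> * (4 * n)" e])
    show "0 \<le> F x i \<and> F x i \<le> 1" if "\<forall>j<n. 0 \<le> x j \<and> x j \<le> 1" "i < n" for x i
      using F_cube[of x] that by (simp add: cube_def)
    show "\<bar>F x i - F y i\<bar> \<le> (1 + n) * L / \<eta> * (4 * n) * (\<Sum>j<n. \<bar>x j - y j\<bar>)"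
      if "\<forall>j<n. 0 \<le> x j \<and> x j \<le> 1" "\<forall>j<n. 0 \<le> y j \<and> y j \<le> 1" "i < n" for x y i
      using F_lip[of x y i] that by (simp add: cube_def)
  qed (use L \<eta> e in auto)
  have xc: "x \<in> cube" using x by (simp add: cube_def)
  have PF: "P (F x) i = F x i" if "i < n" for i by (rule P_id[OF F_simplex[OF xc] that])
  have "(\<Sum>i<n. \<bar>F x i - P x i\<bar>) = (\<Sum>i<n. \<bar>P (F x) i - P x i\<bar>)"
    using PF by (intro sum.cong) auto
  also have "\<dots> \<le> 4 * n * (\<Sum>j<n. \<bar>F x j - x j\<bar>)"
    by (rule P_lip_sum[OF F_cube[OF xc] xc])
  also have "\<dots> \<le> 4 * n * (n * e)"
    using sum_bounded_above[of "{..<n}" "\<lambda>i. \<bar>F x i - x i\<bar>" e] xF by (intro mult_left_mono) auto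
  finally have close: "L * (\<Sum>i<n. \<bar>F x i - P x i\<bar>) \<le> L * (4 * n * (n * e))"
    using L by (rule mult_left_mono)
  have Le: "L * (4 * n * (n * e)) \<le> \<eta>"
  proof -
    have "L * (4 * n * (n * e)) = (L * (4 * n * n)) / (L * (4 * n * n) + 1) * \<eta>"
      by (simp add: e_def mult_ac)
    also have "\<dots> \<le> 1 * \<eta>" using L \<eta> by (intro mult_right_mono) (auto simp: divide_le_eq_1 add_nonneg_pos)
    finally show ?thesis by simp
  qed
  \<comment> \<open>The selected point is \<open>F x\<close>, not \<open>x\<close>: it lies in the
    simplex, and its weight i is positive exactly if \<open>d i (P x) < 2 * \<eta>\<close>. Passing
    from \<open>P x\<close> to \<open>F x\<close> costs the third \<eta>.\<close>
  have "\<forall>i<n. 0 < F x i \<longrightarrow> d i (F x) < 3 * \<eta>"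
  proof (intro allI impI)
    fix i assume i: "i < n" and "0 < F x i"
    then have "0 < \<phi> i (P x)"
      using S_ge[OF P_simplex[OF xc]] \<eta> by (auto simp: F_def zero_less_divide_iff)
    then have "d i (P x) < 2 * \<eta>" by (simp add: \<phi>_def max_def split: if_splits)
    moreover have "\<bar>d i (F x) - d i (P x)\<bar> \<le> \<eta>"
      using lip[OF i F_simplex[OF xc] P_simplex[OF xc]] close Le by linarith
    ultimately show "d i (F x) < 3 * \<eta>" by linarith
  qed
  then show ?thesis using that[OF F_simplex[OF xc]] by blast
qed

section \<open>Finite nets of Lipschitz functions and null level sets\<close>

text \<open>A function is coded by its values at the nodes, rounded down to multiples of
  \<epsilon>/3, and one member of \<open>E\<close> is kept for each of the finitely many codes.
  Equal codes mean a distance of at most \<epsilon>: one third for the rounding and one third for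
  each function's move from t to a node.\<close>

lemma finite_net_lipschitz:
  fixes E :: "(real \<Rightarrow> real) set"
  assumes bd: "\<And>e t. e \<in> E \<Longrightarrow> t \<in> {\<alpha>..\<beta>} \<Longrightarrow> 0 \<le> e t \<and> e t \<le> \<rho>"
    and lip: "\<And>e s t. e \<in> E \<Longrightarrow> s \<in> {\<alpha>..\<beta>} \<Longrightarrow> t \<in> {\<alpha>..\<beta>} \<Longrightarrow> \<bar>e s - e t\<bar> \<le> B * \<bar>s - t\<bar>"
    and B: "0 \<le> B" and \<epsilon>: "0 < \<epsilon>"
  obtains F where "finite F" "F \<subseteq> E" "\<And>e. e \<in> E \<Longrightarrow> \<exists>e'\<in>F. \<forall>t\<in>{\<alpha>..\<beta>}. \<bar>e t - e' t\<bar> \<le> \<epsilon>"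
proof -
  define h where "h = \<epsilon> / (3 * (B + 1))"
  have h: "0 < h" "B * h \<le> \<epsilon> / 3"
    using B \<epsilon> by (auto simp: h_def field_simps)
  define K where "K = nat \<lfloor>(\<beta> - \<alpha>) / h\<rfloor>"
  define nd where "nd k = \<alpha> + real k * h" for k
  have nd_near: "\<exists>k\<le>K. nd k \<in> {\<alpha>..\<beta>} \<and> \<bar>t - nd k\<bar> \<le> h" if t: "t \<in> {\<alpha>..\<beta>}" for t
  proof -
    define k where "k = nat \<lfloor>(t - \<alpha>) / h\<rfloor>"
    have k: "real k \<le> (t - \<alpha>) / h" "(t - \<alpha>) / h < real k + 1"
      using t h by (auto simp: k_def)
    then have "real k * h \<le> t - \<alpha>" "t - \<alpha> < (real k + 1) * h"
      using h by (auto simp: field_simps)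
    moreover have "k \<le> K" unfolding k_def K_def
      using t h by (intro nat_mono floor_mono divide_right_mono) auto
    ultimately show ?thesis using t h by (intro exI[of _ k]) (auto simp: nd_def algebra_simps)
  qed
  \<comment> \<open>The default 0 keeps the code bounded at a node outside the interval, where
    \<open>bd\<close> gives no information.\<close>
  define code where
    "code e = (\<lambda>k\<in>{..K}. if nd k \<in> {\<alpha>..\<beta>} then nat \<lfloor>3 * e (nd k) / \<epsilon>\<rfloor> else 0)" for e :: "real \<Rightarrow> real"
  have "code ` E \<subseteq> (\<Pi>\<^sub>E k\<in>{..K}. {..nat \<lfloor>3 * \<rho> / \<epsilon>\<rfloor>})"
  proof (rule image_subsetI)
    fix e assume e: "e \<in> E"
    show "code e \<in> (\<Pi>\<^sub>E k\<in>{..K}. {..nat \<lfloor>3 * \<rho> / \<epsilon>\<rfloor>})"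
      using bd[OF e] \<epsilon>
      by (auto simp: code_def PiE_iff intro!: nat_mono floor_mono divide_right_mono)
  qed
  then have fin: "finite (code ` E)"
    by (rule finite_subset) (auto intro: finite_PiE)
  define rep where "rep v = (SOME e. e \<in> E \<and> code e = v)" for v
  have rep: "rep (code e) \<in> E \<and> code (rep (code e)) = code e" if "e \<in> E" for e
    unfolding rep_def using that by (intro someI[where P="\<lambda>x. x \<in> E \<and> code x = code e"]) auto
  show ?thesis
  proof (rule that[of "rep ` code ` E"])
    show "finite (rep ` code ` E)" using fin by simp
    show "rep ` code ` E \<subseteq> E" using rep by auto
    fix e assume e: "e \<in> E"
    have "\<bar>e t - rep (code e) t\<bar> \<le> \<epsilon>" if t: "t \<in> {\<alpha>..\<beta>}" for t
    proof -
      let ?e' = "rep (code e)"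
      have e': "?e' \<in> E" "code ?e' = code e" using rep[OF e] by auto
      obtain k where k: "k \<le> K" "nd k \<in> {\<alpha>..\<beta>}" "\<bar>t - nd k\<bar> \<le> h" using nd_near[OF t] by blast
      have "nat \<lfloor>3 * ?e' (nd k) / \<epsilon>\<rfloor> = nat \<lfloor>3 * e (nd k) / \<epsilon>\<rfloor>"
        using fun_cong[OF e'(2), of k] k by (simp add: code_def)
      then have "\<lfloor>3 * ?e' (nd k) / \<epsilon>\<rfloor> = \<lfloor>3 * e (nd k) / \<epsilon>\<rfloor>"
        using bd[OF e k(2)] bd[OF e'(1) k(2)] \<epsilon> by (subst (asm) eq_nat_nat_iff) auto
      then have "\<bar>3 * ?e' (nd k) / \<epsilon> - 3 * e (nd k) / \<epsilon>\<bar> \<le> 1" by linarith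
      then have "\<bar>?e' (nd k) - e (nd k)\<bar> \<le> \<epsilon> / 3"
        using \<epsilon> unfolding abs_le_iff by (simp add: field_simps)
      moreover have "\<bar>e t - e (nd k)\<bar> \<le> \<epsilon> / 3" "\<bar>?e' t - ?e' (nd k)\<bar> \<le> \<epsilon> / 3"
        using lip[OF e t k(2)] lip[OF e'(1) t k(2)] mult_left_mono[OF k(3) B] h by linarith+
      ultimately show ?thesis unfolding abs_le_iff by linarith
    qed
    then show "\<exists>e'\<in>rep ` code ` E. \<forall>t\<in>{\<alpha>..\<beta>}. \<bar>e t - e' t\<bar> \<le> \<epsilon>" using e by blast
  qed
qed

text \<open>A level that is not null is an atom of the image of Lebesgue measure under g, and a
  finite measure has only countably many atoms.\<close>

lemma countable_nonnull_levels:
  fixes g :: "real \<Rightarrow> real"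
  assumes "continuous_on {a..b} g"
  shows "countable {\<theta>. \<not> (AE t in lebesgue. t \<in> {a..b} \<longrightarrow> g t \<noteq> \<theta>)}"
proof -
  let ?M = "lebesgue_on {a..b}"
  have g: "g \<in> borel_measurable ?M"
    using assms by (intro continuous_imp_measurable_on_sets_lebesgue) auto
  interpret M: finite_measure ?M by (rule finite_measure_lebesgue_on) auto
  interpret D: finite_measure "distr ?M borel g" by (rule M.finite_measure_distr[OF g])
  have "(AE t in lebesgue. t \<in> {a..b} \<longrightarrow> g t \<noteq> \<theta>)" if "measure (distr ?M borel g) {\<theta>} = 0" for \<theta>
  proof -
    have "emeasure ?M (g -` {\<theta>} \<inter> space ?M) = 0"
      using that g by (simp add: measure_distr M.emeasure_eq_measure)
    then have "AE t in ?M. t \<notin> g -` {\<theta>} \<inter> space ?M"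
      using measurable_sets[OF g, of "{\<theta>}"] by (intro AE_not_in) (auto simp: null_sets_def)
    then have "AE t in ?M. g t \<noteq> \<theta>" by (rule AE_mp) (auto intro!: AE_I2)
    then show ?thesis by (simp add: AE_restrict_space_iff)
  qed
  then have "{\<theta>. \<not> (AE t in lebesgue. t \<in> {a..b} \<longrightarrow> g t \<noteq> \<theta>)} \<subseteq> {\<theta>. measure (distr ?M borel g) {\<theta>} \<noteq> 0}"
    by blast
  then show ?thesis using D.countable_support countable_subset by blast
qed

section \<open>Second differences, tent functions and the Green kernel\<close>

text \<open>The second divided difference multiplied by (y - x) * (z - x) * (z - y). For x < y < z
  it vanishes on affine functions and is nonnegative on convex ones.\<close>

definition sdiff :: "(real \<Rightarrow> real) \<Rightarrow> real \<Rightarrow> real \<Rightarrow> real \<Rightarrow> real" where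
  "sdiff g x y z = (z - y) * g x - (z - x) * g y + (y - x) * g z"

text \<open>The Peano kernel of \<open>sdiff\<close>: by Taylor's formula g is affine plus an
  integral of ramps \<open>max 0 (t - s)\<close> weighted by g'', so \<open>sdiff g\<close> is the
  integral of \<open>tent\<close> times g''. As a function of s it is a hat over [x, z] with peak at
  y.\<close>

definition tent :: "real \<Rightarrow> real \<Rightarrow> real \<Rightarrow> real \<Rightarrow> real" where
  "tent x y z s = sdiff (\<lambda>t. max 0 (t - s)) x y z"

text \<open>The ramp form serves linearity under integrals; this form shows sign, support and the
  symmetry under reflection.\<close>

lemma tent_eq:
  assumes "x < y" "y < z"
  shows "tent x y z s = max 0 (min ((z - y) * (s - x)) ((y - x) * (z - s)))"
proof -
  have a: "(z - y) * (s - x) \<le> (y - x) * (z - s) \<longleftrightarrow> s \<le> y"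
  proof -
    have "(y - x) * (z - s) - (z - y) * (s - x) = (z - x) * (y - s)" by (simp add: algebra_simps)
    then show ?thesis using assms
      by (smt (verit, best) zero_le_mult_iff)
  qed
  consider "s \<le> x" | "x < s" "s \<le> y" | "y < s" "s \<le> z" | "z < s" by linarith
  then show ?thesis
  proof cases
    case 1
    then have "(z - y) * (s - x) \<le> 0" using assms by (auto simp: mult_le_0_iff)
    with 1 a assms show ?thesis by (simp add: tent_def sdiff_def max_def min_def algebra_simps)
  next
    case 2
    then have "0 \<le> (z - y) * (s - x)" using assms by auto
    with 2 a assms show ?thesis by (simp add: tent_def sdiff_def max_def min_def algebra_simps)
  next
    case 3
    then have "0 \<le> (y - x) * (z - s)" using assms by auto
    with 3 a assms show ?thesis by (simp add: tent_def sdiff_def max_def min_def algebra_simps)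
  next
    case 4
    then have "(y - x) * (z - s) \<le> 0" using assms by (auto simp: mult_le_0_iff)
    with 4 a assms show ?thesis by (simp add: tent_def sdiff_def max_def min_def algebra_simps)
  qed
qed

lemma tent_nonneg: "x < y \<Longrightarrow> y < z \<Longrightarrow> 0 \<le> tent x y z s"
  by (simp add: tent_eq)

lemma tent_pos: "x < s \<Longrightarrow> s < z \<Longrightarrow> x < y \<Longrightarrow> y < z \<Longrightarrow> 0 < tent x y z s"
  by (simp add: tent_eq less_max_iff_disj)

lemma tent_outside:
  assumes "x < y" "y < z" "s \<notin> {x..z}"
  shows "tent x y z s = 0"
proof -
  have "(z - y) * (s - x) \<le> 0 \<or> (y - x) * (z - s) \<le> 0"
    using assms by (auto simp: mult_le_0_iff)
  then show ?thesis using assms by (auto simp: tent_eq)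
qed

lemma continuous_on_tent [continuous_intros]: "continuous_on S (tent x y z)"
  unfolding tent_def sdiff_def by (intro continuous_intros)

lemma tent_translate: "tent (p + x) (p + y) (p + z) (p + s) = tent x y z s"
  by (simp add: tent_def sdiff_def)

lemma tent_reflect:
  assumes "x < y" "y < z"
  shows "tent (p - z) (p - y) (p - x) (p - s) = tent x y z s"
  using assms by (simp add: tent_eq min.commute algebra_simps)

text \<open>For fixed s the Green function is affine in t minus the ramp at s. Hence its second
  differences in t see only a tent, and its slopes in t are bounded by 1.\<close>

lemma kern_eq: "0 \<le> t \<Longrightarrow> kern t s = t * (1 - s) - max 0 (t - s)"
  by (auto simp: kern_def Green_def max_def algebra_simps)

lemma sdiff_kern:
  "0 \<le> x \<Longrightarrow> 0 \<le> y \<Longrightarrow> 0 \<le> z \<Longrightarrow> sdiff (\<lambda>t. kern t s) x y z = - tent x y z s"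
  unfolding tent_def sdiff_def by (simp add: kern_eq algebra_simps)

lemma kern_bounds:
  assumes "t \<le> 1" "0 \<le> s" "s \<le> 1"
  shows "0 \<le> kern t s" "kern t s \<le> 1"
proof -
  have "t * (1 - s) \<le> 1 * 1" if "0 \<le> t" using that assms by (intro mult_mono) auto
  moreover have "(1 - t) * s \<le> 1 * 1" if "0 \<le> t" using that assms by (intro mult_mono) auto
  ultimately show "0 \<le> kern t s" "kern t s \<le> 1" using assms by (auto simp: kern_def Green_def)
qed

lemma kern_lipschitz:
  assumes "t \<le> 1" "t' \<le> 1" "0 \<le> s" "s \<le> 1"
  shows "\<bar>kern t s - kern t' s\<bar> \<le> \<bar>t - t'\<bar>"
proof -
  have *: "\<bar>kern t s - kern t' s\<bar> \<le> t - t'" if "0 \<le> t'" "t' \<le> t" for t t'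
  proof -
    have "kern t s - kern t' s = (t - t') * (1 - s) - (max 0 (t - s) - max 0 (t' - s))"
      using that by (simp add: kern_eq algebra_simps)
    moreover have "0 \<le> (t - t') * (1 - s)" "(t - t') * (1 - s) \<le> t - t'"
      using that assms mult_left_mono[of "1 - s" 1 "t - t'"] by auto
    moreover have "0 \<le> max 0 (t - s) - max 0 (t' - s)" "max 0 (t - s) - max 0 (t' - s) \<le> t - t'"
      using that by auto
    ultimately show ?thesis by linarith
  qed
  have **: "\<bar>kern t s\<bar> \<le> t" if "0 \<le> t" for t
    using *[of 0 t] that assms by (simp add: kern_def Green_def)
  show ?thesis
  proof (cases "0 \<le> t"; cases "0 \<le> t'")
    assume "0 \<le> t" "0 \<le> t'"
    then show ?thesis using *[of t t'] *[of t' t] by (cases "t' \<le> t") auto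
  next
    assume "0 \<le> t" "\<not> 0 \<le> t'"
    then show ?thesis using **[of t] by (simp add: kern_def)
  next
    assume "\<not> 0 \<le> t" "0 \<le> t'"
    then show ?thesis using **[of t'] by (simp add: kern_def)
  qed (simp add: kern_def)
qed

text \<open>Both sides are compared with the diagonal value s * (1 - s): it bounds the kernel from
  above for every t', and a quarter of it bounds the kernel from below for t in the middle half.
  This puts the solution into the cone.\<close>

lemma kern_quarter:
  assumes "t \<in> {1/4..3/4}" "t' \<le> 1" "0 \<le> s" "s \<le> 1"
  shows "1 / 4 * kern t' s \<le> kern t s"
proof (cases "0 \<le> t'")
  case True
  have "kern t' s \<le> s * (1 - s)"
    using True assms by (auto simp: kern_def Green_def mult_right_mono mult_left_mono mult.commute)
  moreover have "1 / 4 * (s * (1 - s)) \<le> kern t s"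
  proof -
    have "1 / 4 * s \<le> t" "1 / 4 * (1 - s) \<le> 1 - t" using assms by auto
    then have "1 / 4 * s * (1 - s) \<le> t * (1 - s)" "1 / 4 * (1 - s) * s \<le> (1 - t) * s"
      using assms by (intro mult_right_mono; simp)+
    then show ?thesis using assms by (auto simp: kern_def Green_def mult_ac)
  qed
  ultimately show ?thesis by linarith
next
  case False
  then show ?thesis using assms kern_bounds(1)[of t s] by (simp add: kern_def)
qed

lemma continuous_on_kern: "continuous_on S (\<lambda>s. kern t s)"
proof (cases "0 \<le> t")
  case True
  have "kern t = (\<lambda>s. t * (1 - s) - max 0 (t - s))" using kern_eq[OF True] by blast
  then show ?thesis by (auto intro!: continuous_intros)
qed (simp add: kern_def)

section \<open>Integrals with ramp and tent weights, and second derivatives in weak form\<close>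

lemma integrable_continuous_mult:
  fixes \<phi> h :: "real \<Rightarrow> real"
  assumes h: "integrable (lebesgue_on {a..b}) h" and \<phi>: "continuous_on {a..b} \<phi>"
  shows "integrable (lebesgue_on {a..b}) (\<lambda>s. \<phi> s * h s)"
proof -
  have "bounded (\<phi> ` {a..b})" using \<phi> by (intro compact_imp_bounded compact_continuous_image) auto
  then obtain C where C: "\<forall>s\<in>{a..b}. \<bar>\<phi> s\<bar> \<le> C" by (auto simp: bounded_iff)
  show ?thesis
  proof (rule Bochner_Integration.integrable_bound)
    show "integrable (lebesgue_on {a..b}) (\<lambda>s. C * h s)" using h by simp
    show "(\<lambda>s. \<phi> s * h s) \<in> borel_measurable (lebesgue_on {a..b})"
      using continuous_imp_measurable_on_sets_lebesgue[OF \<phi>] h by (intro borel_measurable_times) auto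
    show "AE s in lebesgue_on {a..b}. norm (\<phi> s * h s) \<le> norm (C * h s)"
    proof (rule AE_I2)
      fix s assume "s \<in> space (lebesgue_on {a..b})"
      then have "s \<in> {a..b}" by simp
      then have "\<bar>\<phi> s\<bar> \<le> C" using C by blast
      then have "\<bar>\<phi> s\<bar> \<le> \<bar>C\<bar>" by linarith
      then show "norm (\<phi> s * h s) \<le> norm (C * h s)" by (simp add: abs_mult mult_right_mono)
    qed
  qed
qed

lemma integrable_kern_mult:
  "integrable (lebesgue_on {a..b}) h \<Longrightarrow> integrable (lebesgue_on {a..b}) (\<lambda>s. kern t s * h s)"
  by (intro integrable_continuous_mult continuous_on_kern)

lemma integral_lebesgue_on_subset:
  fixes h :: "real \<Rightarrow> real"
  assumes "{x..z} \<subseteq> {a..b}" "\<And>s. s \<notin> {x..z} \<Longrightarrow> h s = 0"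
  shows "integral\<^sup>L (lebesgue_on {a..b}) h = integral\<^sup>L (lebesgue_on {x..z}) h"
proof -
  have "(\<lambda>s. indicator {a..b} s *\<^sub>R h s) = (\<lambda>s. indicator {x..z} s *\<^sub>R h s)"
  proof
    fix s
    show "indicator {a..b} s *\<^sub>R h s = indicator {x..z} s *\<^sub>R h s"
      using assms by (cases "s \<in> {x..z}") auto
  qed
  then show ?thesis by (simp add: integral_restrict_space)
qed

lemma integral_lebesgue_on_split:
  fixes h :: "real \<Rightarrow> real"
  assumes "t \<in> {a..b}"
  shows "integral\<^sup>L (lebesgue_on {a..t}) h = integral\<^sup>L (lebesgue_on {a..b}) (\<lambda>s. indicator {a..t} s * h s)"
proof -
  have "integral\<^sup>L (lebesgue_on {a..b}) (\<lambda>s. indicator {a..t} s * h s)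
    = integral\<^sup>L lebesgue (\<lambda>s. indicator {a..b} s * (indicator {a..t} s * h s))"
    by (simp add: integral_restrict_space)
  also have "\<dots> = integral\<^sup>L lebesgue (\<lambda>s. indicator {a..t} s * h s)"
    using assms by (intro Bochner_Integration.integral_cong) (auto simp: indicator_def)
  finally show ?thesis by (simp add: integral_restrict_space)
qed

lemma integrable_lebesgue_on_indicator:
  fixes h :: "real \<Rightarrow> real"
  assumes "integrable (lebesgue_on {a..b}) h"
  shows "integrable (lebesgue_on {a..b}) (\<lambda>s. indicator {a..t} s * h s)"
proof -
  have "{a..b} \<inter> {a..t} \<in> sets (lebesgue_on {a..b})" by (auto simp: sets_restrict_space)
  then have "integrable (lebesgue_on {a..b}) (\<lambda>s. indicator ({a..b} \<inter> {a..t}) s *\<^sub>R h s)"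
    using assms by (rule integrable_mult_indicator)
  then show ?thesis
    by (rule Bochner_Integration.integrable_cong[THEN iffD1, rotated -1]) (auto simp: indicator_def)
qed

text \<open>The difference quotient of the ramp in t differs from the indicator of
  \<open>{a..t}\<close> only for s between t and x, and there by at most 1. The error is thus at
  most the increment of the integral of |g|, which is continuous; so the derivative exists at every
  t although g is only integrable.\<close>

lemma ramp_integral_has_derivative:
  fixes g :: "real \<Rightarrow> real"
  assumes g: "integrable (lebesgue_on {a..b}) g" and t: "t \<in> {a..b}"
  shows "((\<lambda>t. integral\<^sup>L (lebesgue_on {a..b}) (\<lambda>s. max 0 (t - s) * g s))
    has_real_derivative integral\<^sup>L (lebesgue_on {a..t}) g) (at t within {a..b})"
proof -
  let ?M = "lebesgue_on {a..b}"
  define \<Phi> where "\<Phi> t = integral\<^sup>L ?M (\<lambda>s. max 0 (t - s) * g s)" for t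
  define G where "G t = integral\<^sup>L (lebesgue_on {a..t}) g" for t
  define A where "A t = integral\<^sup>L (lebesgue_on {a..t}) (\<lambda>s. \<bar>g s\<bar>)" for t
  have ramp: "integrable ?M (\<lambda>s. max 0 (t - s) * g s)" for t
    by (intro integrable_continuous_mult[OF g] continuous_intros)
  have ga: "integrable ?M (\<lambda>s. \<bar>g s\<bar>)" using g by simp
  note ind = integrable_lebesgue_on_indicator[OF g] integrable_lebesgue_on_indicator[OF ga]
  have bound: "\<bar>\<Phi> x - \<Phi> t - (x - t) * G t\<bar> \<le> (x - t) * (A x - A t)" if x: "x \<in> {a..b}" for x
  proof -
    have "\<Phi> x - \<Phi> t - (x - t) * G t =
      integral\<^sup>L ?M (\<lambda>s. max 0 (x - s) * g s - max 0 (t - s) * g s - (x - t) * (indicator {a..t} s * g s))"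
      unfolding \<Phi>_def G_def integral_lebesgue_on_split[OF t]
      using ramp ind by simp
    moreover have "(x - t) * (A x - A t) =
      integral\<^sup>L ?M (\<lambda>s. (x - t) * (indicator {a..x} s * \<bar>g s\<bar> - indicator {a..t} s * \<bar>g s\<bar>))"
      unfolding A_def integral_lebesgue_on_split[OF t] integral_lebesgue_on_split[OF x]
      using ind by simp
    moreover have "norm (integral\<^sup>L ?M (\<lambda>s. max 0 (x - s) * g s - max 0 (t - s) * g s - (x - t) * (indicator {a..t} s * g s)))
      \<le> integral\<^sup>L ?M (\<lambda>s. (x - t) * (indicator {a..x} s * \<bar>g s\<bar> - indicator {a..t} s * \<bar>g s\<bar>))"
    proof (rule Bochner_Integration.integral_norm_bound_integral)
      show "integrable ?M (\<lambda>s. max 0 (x - s) * g s - max 0 (t - s) * g s - (x - t) * (indicator {a..t} s * g s))"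
        "integrable ?M (\<lambda>s. (x - t) * (indicator {a..x} s * \<bar>g s\<bar> - indicator {a..t} s * \<bar>g s\<bar>))"
        using ramp ind by auto
      fix s assume "s \<in> space ?M"
      then have s: "a \<le> s" by simp
      have "\<bar>max 0 (x - s) - max 0 (t - s) - (x - t) * indicator {a..t} s\<bar>
        \<le> (x - t) * (indicator {a..x} s - indicator {a..t} s)"
        using s by (auto simp: indicator_def max_def)
      then have "\<bar>max 0 (x - s) - max 0 (t - s) - (x - t) * indicator {a..t} s\<bar> * \<bar>g s\<bar>
        \<le> (x - t) * (indicator {a..x} s - indicator {a..t} s) * \<bar>g s\<bar>"
        by (intro mult_right_mono) auto
      moreover have "max 0 (x - s) * g s - max 0 (t - s) * g s - (x - t) * (indicator {a..t} s * g s)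
        = (max 0 (x - s) - max 0 (t - s) - (x - t) * indicator {a..t} s) * g s"
        by (simp only: left_diff_distrib mult.assoc)
      moreover have "(x - t) * (indicator {a..x} s * \<bar>g s\<bar> - indicator {a..t} s * \<bar>g s\<bar>)
        = (x - t) * (indicator {a..x} s - indicator {a..t} s) * \<bar>g s\<bar>"
        by (simp only: left_diff_distrib mult.assoc right_diff_distrib)
      ultimately show "norm (max 0 (x - s) * g s - max 0 (t - s) * g s - (x - t) * (indicator {a..t} s * g s))
        \<le> (x - t) * (indicator {a..x} s * \<bar>g s\<bar> - indicator {a..t} s * \<bar>g s\<bar>)"
        by (simp only: real_norm_def abs_mult)
    qed
    ultimately show ?thesis by (simp only: real_norm_def)
  qed
  have A0: "((\<lambda>x. A x - A t) \<longlongrightarrow> 0) (at t within {a..b})"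
  proof -
    have "continuous_on {a..b} A" unfolding A_def by (rule indefinite_integral_continuous_real[OF ga])
    then have "(A \<longlongrightarrow> A t) (at t within {a..b})" using t by (auto simp: continuous_on_def)
    then show ?thesis by (simp add: LIM_zero)
  qed
  have "((\<lambda>x. (\<Phi> x - \<Phi> t) / (x - t) - G t) \<longlongrightarrow> 0) (at t within {a..b})"
  proof (rule Lim_null_comparison[OF _ tendsto_rabs_zero[OF A0]])
    show "\<forall>\<^sub>F x in at t within {a..b}. norm ((\<Phi> x - \<Phi> t) / (x - t) - G t) \<le> \<bar>A x - A t\<bar>"
      unfolding eventually_at_filter
    proof (intro always_eventually allI impI)
      fix x assume x: "x \<noteq> t" "x \<in> {a..b}"
      have "(\<Phi> x - \<Phi> t) / (x - t) - G t = (\<Phi> x - \<Phi> t - (x - t) * G t) / (x - t)"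
        using x by (simp add: field_simps)
      then have "norm ((\<Phi> x - \<Phi> t) / (x - t) - G t) = \<bar>\<Phi> x - \<Phi> t - (x - t) * G t\<bar> / \<bar>x - t\<bar>"
        by simp
      also have "\<dots> \<le> (\<bar>x - t\<bar> * \<bar>A x - A t\<bar>) / \<bar>x - t\<bar>"
        using bound[OF x(2)] by (intro divide_right_mono) (auto simp flip: abs_mult)
      finally show "norm ((\<Phi> x - \<Phi> t) / (x - t) - G t) \<le> \<bar>A x - A t\<bar>" using x by simp
    qed
  qed
  then show ?thesis
    unfolding has_field_derivative_iff \<Phi>_def[symmetric] G_def[symmetric] by (rule LIM_zero_cancel)
qed

text \<open>By the preceding lemma the right side has derivative \<open>g1\<close>, so the two
  successive integrations in \<open>W21_with\<close> collapse into one integral with a ramp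
  kernel.\<close>

lemma W21_with_taylor:
  assumes W: "W21_with g g1 g2 a b" and t: "t \<in> {a..b}"
  shows "g t = g a + g1 a * (t - a) + integral\<^sup>L (lebesgue_on {a..b}) (\<lambda>s. max 0 (t - s) * g2 s)"
proof -
  define \<Phi> where "\<Phi> t = integral\<^sup>L (lebesgue_on {a..b}) (\<lambda>s. max 0 (t - s) * g2 s)" for t
  define G where "G t = integral\<^sup>L (lebesgue_on {a..t}) g2" for t
  have g2: "integrable (lebesgue_on {a..b}) g2" and ab: "a \<le> b" using W by (auto simp: W21_with_def)
  have g1: "g1 x = g1 a + G x" if "x \<in> {a..b}" for x using W that unfolding W21_with_def G_def by blast
  have Gc: "continuous_on {a..b} G" unfolding G_def by (rule indefinite_integral_continuous_real[OF g2])
  have "continuous_on {a..b} g1"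
    by (rule continuous_on_eq[of _ "\<lambda>x. g1 a + G x"]) (intro continuous_intros Gc, rule g1[symmetric])
  then have "continuous_on {a..t} g1" using t by (auto elim: continuous_on_subset)
  then have "integral\<^sup>L (lebesgue_on {a..t}) g1 = integral {a..t} g1"
    by (intro lebesgue_integral_eq_integral continuous_imp_integrable_real) auto
  moreover have "(g1 has_integral (g1 a * t + \<Phi> t) - (g1 a * a + \<Phi> a)) {a..t}"
  proof (rule fundamental_theorem_of_calculus)
    fix x assume x: "x \<in> {a..t}"
    then have x': "x \<in> {a..b}" using t by auto
    have "((\<lambda>x. g1 a * x + \<Phi> x) has_real_derivative g1 a * 1 + G x) (at x within {a..b})"
      using ramp_integral_has_derivative[OF g2 x'] unfolding \<Phi>_def G_def
      by (auto intro!: derivative_eq_intros)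
    then show "((\<lambda>x. g1 a * x + \<Phi> x) has_vector_derivative g1 x) (at x within {a..t})"
      unfolding has_real_derivative_iff_has_vector_derivative using g1[OF x'] t
      by (auto elim!: has_vector_derivative_within_subset)
  qed (use t in auto)
  moreover have "\<Phi> a = 0"
  proof -
    have "\<Phi> a = integral\<^sup>L (lebesgue_on {a..b}) (\<lambda>s. 0)"
      unfolding \<Phi>_def by (rule Bochner_Integration.integral_cong) auto
    then show ?thesis by simp
  qed
  moreover have "g t = g a + integral\<^sup>L (lebesgue_on {a..t}) g1" using W t unfolding W21_with_def by blast
  ultimately show ?thesis
    unfolding \<Phi>_def[symmetric] by (simp add: integral_unique algebra_simps)
qed

text \<open>The second derivative tested against tent functions: this form of \<open>g'' = g2\<close> restricts to
  subintervals, is stable under isometries of the line, and passes to uniform limits of \<open>g\<close>.\<close>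
definition weak_deriv2 :: "(real \<Rightarrow> real) \<Rightarrow> (real \<Rightarrow> real) \<Rightarrow> real \<Rightarrow> real \<Rightarrow> bool" where
  "weak_deriv2 g g2 a b \<longleftrightarrow> continuous_on {a..b} g \<and> integrable (lebesgue_on {a..b}) g2 \<and>
     (\<forall>x y z. a \<le> x \<longrightarrow> x < y \<longrightarrow> y < z \<longrightarrow> z \<le> b \<longrightarrow>
        sdiff g x y z = integral\<^sup>L (lebesgue_on {a..b}) (\<lambda>s. tent x y z s * g2 s))"

lemma weak_deriv2D:
  assumes "weak_deriv2 g g2 a b"
  shows "continuous_on {a..b} g" "integrable (lebesgue_on {a..b}) g2"
    and "a \<le> x \<Longrightarrow> x < y \<Longrightarrow> y < z \<Longrightarrow> z \<le> b \<Longrightarrow>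
      sdiff g x y z = integral\<^sup>L (lebesgue_on {a..b}) (\<lambda>s. tent x y z s * g2 s)"
  using assms unfolding weak_deriv2_def by blast+

text \<open>\<open>sdiff\<close> annihilates the affine part of Taylor's formula and turns the ramps
  into \<open>tent\<close>.\<close>

lemma W21_with_imp_weak_deriv2:
  assumes W: "W21_with g g1 g2 a b"
  shows "weak_deriv2 g g2 a b"
proof -
  define \<Phi> where "\<Phi> t = integral\<^sup>L (lebesgue_on {a..b}) (\<lambda>s. max 0 (t - s) * g2 s)" for t
  have g2: "integrable (lebesgue_on {a..b}) g2" using W by (auto simp: W21_with_def)
  have g: "g t = g a + g1 a * (t - a) + \<Phi> t" if "t \<in> {a..b}" for t
    using W21_with_taylor[OF W that] by (simp add: \<Phi>_def)
  have "continuous_on {a..b} \<Phi>"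
    unfolding \<Phi>_def using ramp_integral_has_derivative[OF g2] by (rule DERIV_continuous_on)
  then have "continuous_on {a..b} (\<lambda>t. g a + g1 a * (t - a) + \<Phi> t)"
    by (intro continuous_intros)
  then have "continuous_on {a..b} g"
    by (rule continuous_on_eq) (rule g[symmetric])
  moreover have "sdiff g x y z = integral\<^sup>L (lebesgue_on {a..b}) (\<lambda>s. tent x y z s * g2 s)"
    if "a \<le> x" "x < y" "y < z" "z \<le> b" for x y z
  proof -
    have i: "integrable (lebesgue_on {a..b}) (\<lambda>s. max 0 (t - s) * g2 s)" for t
      by (intro integrable_continuous_mult[OF g2] continuous_intros)
    have "sdiff g x y z = sdiff \<Phi> x y z"
    proof -
      have "x \<in> {a..b}" "y \<in> {a..b}" "z \<in> {a..b}" using that by auto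
      note * = g[OF this(1)] g[OF this(2)] g[OF this(3)]
      show ?thesis unfolding sdiff_def * by (simp add: algebra_simps)
    qed
    also have "\<dots> = integral\<^sup>L (lebesgue_on {a..b}) (\<lambda>s. (z - y) * (max 0 (x - s) * g2 s)
        - (z - x) * (max 0 (y - s) * g2 s) + (y - x) * (max 0 (z - s) * g2 s))"
      unfolding sdiff_def \<Phi>_def using i by simp
    finally show ?thesis by (simp add: tent_def sdiff_def algebra_simps)
  qed
  ultimately show ?thesis using g2 by (simp add: weak_deriv2_def)
qed

lemma weak_deriv2_subset:
  assumes "weak_deriv2 g g2 a b" "a \<le> a'" "b' \<le> b"
  shows "weak_deriv2 g g2 a' b'"
  unfolding weak_deriv2_def
proof (intro conjI allI impI)
  show "continuous_on {a'..b'} g"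
    using weak_deriv2D(1)[OF assms(1)] assms(2,3) by (auto elim: continuous_on_subset)
  show "integrable (lebesgue_on {a'..b'}) g2"
    using assms(2,3)
    by (intro Equivalence_Lebesgue_Henstock_Integration.integrable_subinterval[OF weak_deriv2D(2)[OF assms(1)]]) auto
  fix x y z assume *: "a' \<le> x" "x < y" "y < z" "z \<le> b'"
  have "sdiff g x y z = integral\<^sup>L (lebesgue_on {a..b}) (\<lambda>s. tent x y z s * g2 s)"
    using assms(2,3) * by (intro weak_deriv2D(3)[OF assms(1)]) auto
  also have "\<dots> = integral\<^sup>L (lebesgue_on {x..z}) (\<lambda>s. tent x y z s * g2 s)"
    using assms * by (intro integral_lebesgue_on_subset) (auto simp: tent_outside)
  also have "\<dots> = integral\<^sup>L (lebesgue_on {a'..b'}) (\<lambda>s. tent x y z s * g2 s)"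
    using assms * by (intro integral_lebesgue_on_subset[symmetric]) (auto simp: tent_outside)
  finally show "sdiff g x y z = integral\<^sup>L (lebesgue_on {a'..b'}) (\<lambda>s. tent x y z s * g2 s)" .
qed

lemma isometry_lebesgue_on:
  fixes h :: "real \<Rightarrow> real" and e p :: real
  assumes e: "\<bar>e\<bar> = 1" and img: "\<And>s. p + e * s \<in> {c..d} \<longleftrightarrow> s \<in> {a..b}"
  shows "integrable (lebesgue_on {a..b}) (\<lambda>s. h (p + e * s)) \<longleftrightarrow> integrable (lebesgue_on {c..d}) h"
    and "integral\<^sup>L (lebesgue_on {a..b}) (\<lambda>s. h (p + e * s)) = integral\<^sup>L (lebesgue_on {c..d}) h"
proof -
  have e0: "e \<noteq> 0" using e by auto
  have eq: "indicat_real {a..b} s = indicator {c..d} (p + e * s)" for s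
    using img[of s] by (simp add: indicator_def)
  have "integrable (lebesgue_on {a..b}) (\<lambda>s. h (p + e * s))
    \<longleftrightarrow> integrable lebesgue (\<lambda>s. indicator {c..d} (p + e * s) * h (p + e * s))"
    by (simp add: integrable_restrict_space eq)
  also have "\<dots> \<longleftrightarrow> integrable lebesgue (\<lambda>t. indicator {c..d} t * h t)"
    by (rule lebesgue_integrable_real_affine_iff[OF e0])
  finally show "integrable (lebesgue_on {a..b}) (\<lambda>s. h (p + e * s)) \<longleftrightarrow> integrable (lebesgue_on {c..d}) h"
    by (simp add: integrable_restrict_space)
  have "integral\<^sup>L (lebesgue_on {a..b}) (\<lambda>s. h (p + e * s))
    = integral\<^sup>L lebesgue (\<lambda>s. indicator {c..d} (p + e * s) * h (p + e * s))"
    by (simp add: integral_restrict_space eq)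
  also have "\<dots> = integral\<^sup>L lebesgue (\<lambda>t. indicator {c..d} t * h t)"
    using Equivalence_Lebesgue_Henstock_Integration.lebesgue_integral_real_affine
      [OF e0, of "\<lambda>t. indicator {c..d} t * h t" p] e by simp
  finally show "integral\<^sup>L (lebesgue_on {a..b}) (\<lambda>s. h (p + e * s)) = integral\<^sup>L (lebesgue_on {c..d}) h"
    by (simp add: integral_restrict_space)
qed

lemma AE_lebesgue_isometry:
  fixes e p :: real
  assumes "AE t in lebesgue. P t" "e \<noteq> 0"
  shows "AE s in lebesgue. P (p + e * s)"
proof -
  have m: "(\<lambda>s. p + e * s) \<in> lebesgue \<rightarrow>\<^sub>M lebesgue"
    using lebesgue_affine_measurable[of "\<lambda>_. e" p] assms(2) by simp
  have "AE t in density (distr lebesgue lebesgue (\<lambda>s. p + e * s)) (\<lambda>_. ennreal \<bar>e\<bar>). P t"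
    by (subst lebesgue_real_affine[OF assms(2), of p, symmetric]) (rule assms(1))
  then have "AE t in distr lebesgue lebesgue (\<lambda>s. p + e * s). P t"
    using assms(2) by (subst (asm) AE_density) auto
  then show ?thesis by (rule AE_distrD[OF m])
qed

text \<open>Since e * e = 1, the second derivative gets no factor; for e = -1 the three test points
  change order and the tent is reflected. The lemma moves a curve compared with u(\<sigma>(t)) to
  the variable s = \<sigma>(t), in which the forcing of u is known.\<close>

lemma weak_deriv2_isometry:
  fixes e p :: real
  assumes wd: "weak_deriv2 g g2 c d" and e: "e = 1 \<or> e = -1"
    and img: "\<And>s. p + e * s \<in> {c..d} \<longleftrightarrow> s \<in> {a..b}"
  shows "weak_deriv2 (\<lambda>s. g (p + e * s)) (\<lambda>s. g2 (p + e * s)) a b"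
  unfolding weak_deriv2_def
proof (intro conjI allI impI)
  have e': "\<bar>e\<bar> = 1" using e by auto
  show "continuous_on {a..b} (\<lambda>s. g (p + e * s))"
    using img by (intro continuous_on_compose2[OF weak_deriv2D(1)[OF wd]] continuous_intros) auto
  show "integrable (lebesgue_on {a..b}) (\<lambda>s. g2 (p + e * s))"
    using isometry_lebesgue_on(1)[OF e' img] weak_deriv2D(2)[OF wd] by simp
  fix x y z assume xyz: "a \<le> x" "x < y" "y < z" "z \<le> b"
  have in_cd: "p + e * s \<in> {c..d}" if "a \<le> s" "s \<le> b" for s using img that by simp
  from e show "sdiff (\<lambda>s. g (p + e * s)) x y z
    = integral\<^sup>L (lebesgue_on {a..b}) (\<lambda>s. tent x y z s * g2 (p + e * s))"
  proof
    assume e: "e = 1"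
    have "sdiff (\<lambda>s. g (p + e * s)) x y z = sdiff g (p + x) (p + y) (p + z)"
      by (simp add: e sdiff_def)
    also have "\<dots> = integral\<^sup>L (lebesgue_on {c..d}) (\<lambda>t. tent (p + x) (p + y) (p + z) t * g2 t)"
      using xyz in_cd[of x] in_cd[of z] by (intro weak_deriv2D(3)[OF wd]) (auto simp: e)
    also have "\<dots> = integral\<^sup>L (lebesgue_on {a..b}) (\<lambda>s. tent (p + x) (p + y) (p + z) (p + e * s) * g2 (p + e * s))"
      by (rule isometry_lebesgue_on(2)[OF e' img, symmetric])
    finally show ?thesis by (simp add: e tent_translate)
  next
    assume e: "e = - 1"
    have "sdiff (\<lambda>s. g (p + e * s)) x y z = sdiff g (p - z) (p - y) (p - x)"
      by (simp add: e sdiff_def)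
    also have "\<dots> = integral\<^sup>L (lebesgue_on {c..d}) (\<lambda>t. tent (p - z) (p - y) (p - x) t * g2 t)"
      using xyz in_cd[of x] in_cd[of z] by (intro weak_deriv2D(3)[OF wd]) (auto simp: e)
    also have "\<dots> = integral\<^sup>L (lebesgue_on {a..b}) (\<lambda>s. tent (p - z) (p - y) (p - x) (p + e * s) * g2 (p + e * s))"
      by (rule isometry_lebesgue_on(2)[OF e' img, symmetric])
    finally show ?thesis using xyz by (simp add: e tent_reflect)
  qed
qed

lemma infinite_real_three:
  fixes Z :: "real set"
  assumes "infinite Z"
  obtains x y z where "x \<in> Z" "y \<in> Z" "z \<in> Z" "x < y" "y < z"
proof -
  obtain T where T: "finite T" "card T = 3" "T \<subseteq> Z" using infinite_arbitrarily_large[OF assms] by blast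
  then obtain p q s where pqs: "T = {p, q, s}" "p \<noteq> q" "q \<noteq> s" "p \<noteq> s" by (auto simp: card_3_iff)
  then have "p \<in> Z" "q \<in> Z" "s \<in> Z" using T by auto
  with pqs that show ?thesis by (metis linorder_neqE_linordered_idom)
qed

lemma integral_tent_mult_pos:
  assumes xyz: "x < y" "y < z" and \<psi>: "integrable (lebesgue_on {x..z}) \<psi>"
    and pos: "AE t in lebesgue. t \<in> {x..z} \<longrightarrow> 0 < \<psi> t"
  shows "0 < integral\<^sup>L (lebesgue_on {x..z}) (\<lambda>s. tent x y z s * \<psi> s)"
proof -
  interpret finite_measure "lebesgue_on {x..z}" by (rule finite_measure_lebesgue_on) auto
  have "integral\<^sup>L (lebesgue_on {x..z}) (\<lambda>s. 0) < integral\<^sup>L (lebesgue_on {x..z}) (\<lambda>s. tent x y z s * \<psi> s)"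
  proof (rule integral_less_AE_space)
    show "integrable (lebesgue_on {x..z}) (\<lambda>s. tent x y z s * \<psi> s)"
      by (intro integrable_continuous_mult[OF \<psi>] continuous_intros)
    have "emeasure (lebesgue_on {x..z}) {x..z} = ennreal (z - x)"
      using xyz by (subst emeasure_restrict_space) auto
    then show "emeasure (lebesgue_on {x..z}) (space (lebesgue_on {x..z})) \<noteq> 0"
      using xyz by (simp add: ennreal_eq_0_iff)
    \<comment> \<open>The tent vanishes at its end points, so strict positivity needs them
      removed.\<close>
    have "AE t in lebesgue. t \<noteq> x" "AE t in lebesgue. t \<noteq> z"
      using AE_not_in[of "{x}" lebesgue] AE_not_in[of "{z}" lebesgue]
      by (auto simp: null_sets_completionI)
    with pos have "AE t in lebesgue. t \<in> {x..z} \<longrightarrow> 0 < tent x y z t * \<psi> t"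
    proof eventually_elim
      case (elim t)
      then show ?case using xyz tent_pos[of x t z y] by auto
    qed
    then show "AE t in lebesgue_on {x..z}. 0 < tent x y z t * \<psi> t"
      by (simp add: AE_restrict_space_iff)
  qed simp
  then show ?thesis by simp
qed

section \<open>The integral operator, and crossings of its limits with a curve\<close>

text \<open>The solution operator of -v'' = h with v(0) = v(1) = 0, continued by 0 to negative
  times.\<close>

definition Kop :: "(real \<Rightarrow> real) \<Rightarrow> real \<Rightarrow> real" where
  "Kop h t = integral\<^sup>L (lebesgue_on {0..1}) (\<lambda>s. kern t s * h s)"

text \<open>The weak form of (Kop h)'' = -h: under the integral, the second difference of the kernel
  in t is minus a tent.\<close>

lemma sdiff_Kop:
  assumes h: "integrable (lebesgue_on {0..1}) h" and xyz: "0 \<le> x" "x < y" "y < z" "z \<le> 1"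
  shows "sdiff (Kop h) x y z = - integral\<^sup>L (lebesgue_on {x..z}) (\<lambda>s. tent x y z s * h s)"
proof -
  note i = integrable_kern_mult[OF h]
  have "sdiff (Kop h) x y z = integral\<^sup>L (lebesgue_on {0..1})
    (\<lambda>s. (z - y) * (kern x s * h s) - (z - x) * (kern y s * h s) + (y - x) * (kern z s * h s))"
    unfolding sdiff_def Kop_def using i by simp
  also have "\<dots> = integral\<^sup>L (lebesgue_on {0..1}) (\<lambda>s. sdiff (\<lambda>t. kern t s) x y z * h s)"
    by (rule Bochner_Integration.integral_cong) (simp_all add: sdiff_def algebra_simps)
  also have "\<dots> = integral\<^sup>L (lebesgue_on {0..1}) (\<lambda>s. - (tent x y z s * h s))"
    using xyz by (simp add: sdiff_kern)
  also have "\<dots> = - integral\<^sup>L (lebesgue_on {0..1}) (\<lambda>s. tent x y z s * h s)"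
    by simp
  also have "integral\<^sup>L (lebesgue_on {0..1}) (\<lambda>s. tent x y z s * h s)
    = integral\<^sup>L (lebesgue_on {x..z}) (\<lambda>s. tent x y z s * h s)"
    using xyz by (intro integral_lebesgue_on_subset) (auto simp: tent_outside)
  finally show ?thesis .
qed

text \<open>Near the curve, \<open>u - \<gamma>\<close> is strictly concave (\<open>sg = 1\<close>) or strictly convex (\<open>sg = -1\<close>),
  so its zeros cannot accumulate.\<close>
lemma finite_curve_crossings:
  fixes u \<gamma> g2 \<psi> :: "real \<Rightarrow> real" and h :: "nat \<Rightarrow> real \<Rightarrow> real" and lam :: "nat \<Rightarrow> real"
  assumes ab: "0 \<le> a" "b \<le> 1"
    and wd: "weak_deriv2 \<gamma> g2 a b"
    and \<psi>: "integrable (lebesgue_on {a..b}) \<psi>"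
    and \<psi>_pos: "AE t in lebesgue. t \<in> {a..b} \<longrightarrow> 0 < \<psi> t"
    and sg: "sg = 1 \<or> sg = (-1 :: real)"
    and u_cont: "continuous_on {a..b} u"
    and lam: "lam \<longlonglongrightarrow> l" "0 < l" "\<And>m. 0 < lam m"
    and h: "\<And>m. integrable (lebesgue_on {0..1}) (h m)"
    and conv: "\<And>t. t \<in> {0..1} \<Longrightarrow> (\<lambda>m. A * t + B + lam m * Kop (h m) t) \<longlonglongrightarrow> u t"
    and \<epsilon>: "0 < \<epsilon>"
    and ineq: "\<forall>\<^sub>F m in sequentially. AE t in lebesgue.
        t \<in> {a..b} \<and> \<bar>u t - \<gamma> t\<bar> < \<epsilon> \<longrightarrow> \<psi> t \<le> sg * (l * h m t + g2 t)"
  shows "finite {t \<in> {a..b}. u t = \<gamma> t}"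
proof (rule ccontr)
  let ?Z = "{t \<in> {a..b}. u t = \<gamma> t}"
  assume inf: "infinite ?Z"
  have v_cont: "continuous_on {a..b} (\<lambda>t. u t - \<gamma> t)"
    by (intro continuous_intros u_cont weak_deriv2D(1)[OF wd])
  obtain t0 where t0: "t0 \<in> {a..b}" "t0 islimpt ?Z"
    using Heine_Borel_imp_Bolzano_Weierstrass[OF compact_Icc inf] by blast
  have "closed ?Z"
  proof -
    have "closed ({a..b} \<inter> (\<lambda>t. u t - \<gamma> t) -` {0})"
      by (intro continuous_closed_preimage v_cont) auto
    moreover have "{a..b} \<inter> (\<lambda>t. u t - \<gamma> t) -` {0} = ?Z" by auto
    ultimately show ?thesis by simp
  qed
  then have "t0 \<in> ?Z" using t0(2) unfolding closed_limpt by blast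
  then have zero: "u t0 - \<gamma> t0 = 0" by simp
  obtain \<delta> where "0 < \<delta>" "\<forall>t\<in>{a..b}. dist t t0 < \<delta> \<longrightarrow> dist (u t - \<gamma> t) (u t0 - \<gamma> t0) < \<epsilon>"
    using v_cont t0(1) \<epsilon> unfolding continuous_on_iff by blast
  then have \<delta>: "0 < \<delta>" "\<And>t. t \<in> {a..b} \<Longrightarrow> dist t t0 < \<delta> \<Longrightarrow> \<bar>u t - \<gamma> t\<bar> < \<epsilon>"
    unfolding zero by (auto simp: dist_real_def)
  \<comment> \<open>Three zeros are taken so close together that the whole interval spanned by them
    lies in the zone where \<open>ineq\<close> speaks.\<close>
  have "infinite (?Z \<inter> ball t0 \<delta>)" using t0(2) \<delta>(1) islimpt_eq_infinite_ball by blast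
  then obtain x y z where xyz: "x < y" "y < z" and Z: "x \<in> ?Z \<inter> ball t0 \<delta>" "y \<in> ?Z \<inter> ball t0 \<delta>" "z \<in> ?Z \<inter> ball t0 \<delta>"
    by (rule infinite_real_three)
  have in_ab: "{x..z} \<subseteq> {a..b}" using Z by auto
  have near: "\<bar>u t - \<gamma> t\<bar> < \<epsilon>" if "t \<in> {x..z}" for t
    using \<delta>(2)[of t] in_ab that Z by (auto simp: dist_real_def)
  let ?N = "lebesgue_on {x..z}"
  define U where "U m t = A * t + B + lam m * Kop (h m) t" for m t
  define G where "G = integral\<^sup>L ?N (\<lambda>s. tent x y z s * g2 s)"
  define P where "P = integral\<^sup>L ?N (\<lambda>s. tent x y z s * \<psi> s)"
  note sub = Equivalence_Lebesgue_Henstock_Integration.integrable_subinterval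
  have g2i: "integrable ?N (\<lambda>s. tent x y z s * g2 s)"
    by (intro integrable_continuous_mult sub[OF weak_deriv2D(2)[OF wd] in_ab] continuous_intros)
  have \<psi>x: "integrable ?N \<psi>" by (rule sub[OF \<psi> in_ab])
  have \<psi>i: "integrable ?N (\<lambda>s. tent x y z s * \<psi> s)"
    by (intro integrable_continuous_mult \<psi>x continuous_intros)
  have hi: "integrable ?N (\<lambda>s. tent x y z s * h m s)" for m
    using in_ab ab by (intro integrable_continuous_mult sub[OF h] continuous_intros) auto
  have P: "0 < P" unfolding P_def
    using \<psi>_pos in_ab by (intro integral_tent_mult_pos xyz \<psi>x) (auto elim!: eventually_mono)
  \<comment> \<open>At three common zeros the second differences of u and \<gamma> coincide,
    although the forcing of u is unknown.\<close>
  have "sdiff u x y z = sdiff \<gamma> x y z" using Z by (simp add: sdiff_def)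
  also have "\<dots> = G"
    using weak_deriv2D(3)[OF weak_deriv2_subset[OF wd], of x z x y z] in_ab xyz by (simp add: G_def)
  finally have uG: "sdiff u x y z = G" .
  have "(\<lambda>m. sdiff (U m) x y z) \<longlonglongrightarrow> sdiff u x y z"
    unfolding sdiff_def U_def using in_ab xyz ab by (intro tendsto_intros conv) auto
  then have U_lim: "(\<lambda>m. sdiff (U m) x y z) \<longlonglongrightarrow> G" by (simp add: uG)
  have U_eq: "sdiff (U m) x y z = - (lam m * integral\<^sup>L ?N (\<lambda>s. tent x y z s * h m s))" for m
  proof -
    have "sdiff (U m) x y z = lam m * sdiff (Kop (h m)) x y z"
      by (simp add: sdiff_def U_def algebra_simps)
    also have "sdiff (Kop (h m)) x y z = - integral\<^sup>L ?N (\<lambda>s. tent x y z s * h m s)"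
      using in_ab xyz ab by (intro sdiff_Kop h) auto
    finally show ?thesis by simp
  qed
  \<comment> \<open>Convergence of \<open>h m\<close> is not known. Multiplying by
    \<open>lam m\<close> turns its tent integral into minus a second difference of
    \<open>U m\<close>, which converges to \<open>G\<close>. In the limit the right side is 0, while
    the left side is l * P > 0.\<close>
  have "\<forall>\<^sub>F m in sequentially. lam m * P \<le> sg * (l * (- sdiff (U m) x y z) + lam m * G)"
    using ineq
  proof eventually_elim
    case (elim m)
    have "P \<le> integral\<^sup>L ?N (\<lambda>s. sg * (l * (tent x y z s * h m s) + tent x y z s * g2 s))"
      unfolding P_def
    proof (rule integral_mono_AE)
      have "AE t in lebesgue. t \<in> {x..z} \<longrightarrow>
        tent x y z t * \<psi> t \<le> sg * (l * (tent x y z t * h m t) + tent x y z t * g2 t)"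
        using elim
      proof eventually_elim
        case (elim t)
        show ?case
        proof
          assume t: "t \<in> {x..z}"
          then have "\<psi> t \<le> sg * (l * h m t + g2 t)" using elim near in_ab by blast
          then have "tent x y z t * \<psi> t \<le> tent x y z t * (sg * (l * h m t + g2 t))"
            using tent_nonneg[OF xyz] by (rule mult_left_mono)
          then show "tent x y z t * \<psi> t \<le> sg * (l * (tent x y z t * h m t) + tent x y z t * g2 t)"
            by (simp add: algebra_simps)
        qed
      qed
      then show "AE t in ?N. tent x y z t * \<psi> t \<le> sg * (l * (tent x y z t * h m t) + tent x y z t * g2 t)"
        by (simp add: AE_restrict_space_iff)
    qed (use \<psi>i g2i hi in auto)
    also have "\<dots> = sg * (l * integral\<^sup>L ?N (\<lambda>s. tent x y z s * h m s) + G)"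
      using g2i hi by (simp add: G_def)
    finally have "lam m * P \<le> lam m * (sg * (l * integral\<^sup>L ?N (\<lambda>s. tent x y z s * h m s) + G))"
      using lam(3)[of m] by (intro mult_left_mono) auto
    then show ?case by (simp add: U_eq algebra_simps)
  qed
  moreover have "(\<lambda>m. sg * (l * (- sdiff (U m) x y z) + lam m * G)) \<longlonglongrightarrow> sg * (l * (- G) + l * G)"
    by (intro tendsto_intros U_lim lam)
  moreover have "(\<lambda>m. lam m * P) \<longlonglongrightarrow> l * P"
    by (intro tendsto_intros lam)
  ultimately have "l * P \<le> sg * (l * (- G) + l * G)"
    by (intro tendsto_le[of sequentially]) auto
  then have "l * P \<le> 0" by simp
  moreover have "0 < l * P" using lam(2) P by simp
  ultimately show False by linarith
qed

section \<open>Sup norms, bounds for \<open>yfun\<close> and uniform estimates for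
  \<open>Kop\<close>\<close>

lemma supnorm_upper:
  assumes "continuous_on {a..b} u" "t \<in> {a..b}"
  shows "\<bar>u t\<bar> \<le> supnorm a b u"
  unfolding supnorm_def
proof (rule cSUP_upper)
  have "compact ((\<lambda>t. \<bar>u t\<bar>) ` {a..b})"
    using assms(1) by (intro compact_continuous_image continuous_intros) auto
  then show "bdd_above ((\<lambda>t. \<bar>u t\<bar>) ` {a..b})"
    by (intro bounded_imp_bdd_above compact_imp_bounded)
qed (rule assms)

lemma supnorm_least:
  assumes "a \<le> b" "\<And>t. t \<in> {a..b} \<Longrightarrow> \<bar>u t\<bar> \<le> C"
  shows "supnorm a b u \<le> C"
  unfolding supnorm_def using assms by (intro cSUP_least) auto

lemma supnorm_diff_le:
  assumes "a \<le> b" and u: "continuous_on {a..b} u" and v: "continuous_on {a..b} v"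
    and le: "\<And>t. t \<in> {a..b} \<Longrightarrow> \<bar>u t - v t\<bar> \<le> C"
  shows "\<bar>supnorm a b u - supnorm a b v\<bar> \<le> C"
proof -
  have "supnorm a b u \<le> supnorm a b v + C"
    using le supnorm_upper[OF v] by (intro supnorm_least[OF \<open>a \<le> b\<close>]) fastforce
  moreover have "supnorm a b v \<le> supnorm a b u + C"
    using le supnorm_upper[OF u] by (intro supnorm_least[OF \<open>a \<le> b\<close>]) fastforce
  ultimately show ?thesis by linarith
qed

lemma supnorm_cmult:
  assumes "a \<le> b" "continuous_on {a..b} u" "0 \<le> k"
  shows "supnorm a b (\<lambda>t. k * u t) = k * supnorm a b u"
proof (cases "k = 0")
  case True
  then show ?thesis using assms by (simp add: supnorm_def)
next
  case False
  then have k: "0 < k" using assms by simp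
  have "supnorm a b (\<lambda>t. k * u t) \<le> k * supnorm a b u"
    using assms supnorm_upper[OF assms(2)] by (intro supnorm_least) (auto simp: abs_mult mult_left_mono)
  moreover have "supnorm a b u \<le> supnorm a b (\<lambda>t. k * u t) / k"
  proof (rule supnorm_least[OF assms(1)])
    fix t assume t: "t \<in> {a..b}"
    have "\<bar>k * u t\<bar> \<le> supnorm a b (\<lambda>t. k * u t)"
      using assms by (intro supnorm_upper[OF _ t] continuous_intros)
    then show "\<bar>u t\<bar> \<le> supnorm a b (\<lambda>t. k * u t) / k" using k by (simp add: abs_mult field_simps)
  qed
  ultimately show ?thesis using k by (simp add: field_simps)
qed

lemma continuous_on_yfun:
  assumes "continuous_on {-r..0} \<omega>" "0 \<le> r"
  shows "continuous_on {-r..1} (yfun \<omega>)"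
  unfolding yfun_def
proof (rule continuous_on_cases_le)
  show "continuous_on {t \<in> {-r..1}. t \<le> 0} \<omega>" using assms by (auto elim: continuous_on_subset)
qed (auto intro!: continuous_intros)

lemma yfun_bounds:
  assumes "continuous_on {-r..0} \<omega>" "\<forall>t\<in>{-r..0}. 0 \<le> \<omega> t" "0 \<le> r" "t \<in> {-r..1}"
  shows "0 \<le> yfun \<omega> t" "yfun \<omega> t \<le> supnorm (-r) 0 \<omega>"
proof -
  have w: "0 \<le> \<omega> s \<and> \<omega> s \<le> supnorm (-r) 0 \<omega>" if "s \<in> {-r..0}" for s
    using supnorm_upper[OF assms(1) that] assms(2) that by auto
  have "0 \<le> \<omega> 0" "\<omega> 0 \<le> supnorm (-r) 0 \<omega>" using w[of 0] assms by auto
  moreover have "(1 - t) * \<omega> 0 \<le> 1 * \<omega> 0" if "0 < t"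
    using that \<open>0 \<le> \<omega> 0\<close> by (intro mult_right_mono) auto
  ultimately show "0 \<le> yfun \<omega> t" "yfun \<omega> t \<le> supnorm (-r) 0 \<omega>"
    using w[of t] assms by (auto simp: yfun_def)
qed

text \<open>The band prescribed by (H2) and (H3). It is convex, so mixtures of superpositions stay
  in it, and the bounds on \<open>Kop h\<close> are uniform over it.\<close>

definition forcings :: "(real \<Rightarrow> real) \<Rightarrow> (real \<Rightarrow> real) \<Rightarrow> (real \<Rightarrow> real) set" where
  "forcings M \<delta> = {h. h \<in> borel_measurable (lebesgue_on {0..1}) \<and>
     (AE t in lebesgue. t \<in> {0..1} \<longrightarrow> 0 \<le> h t \<and> h t \<le> M t) \<and>
     (AE t in lebesgue. t \<in> {1/4..3/4} \<longrightarrow> \<delta> t \<le> h t)}"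

lemma forcings_AE:
  assumes "h \<in> forcings M \<delta>"
  shows "AE s in lebesgue_on {0..1}. 0 \<le> h s \<and> h s \<le> M s"
proof -
  have "(AE s in lebesgue_on {0..1}. P s) \<longleftrightarrow> (AE s in lebesgue. s \<in> {0..1} \<longrightarrow> P s)" for P :: "real \<Rightarrow> bool"
    by (rule AE_restrict_space_iff) simp
  then show ?thesis using assms by (simp only: forcings_def mem_Collect_eq)
qed

context
  fixes M \<delta> :: "real \<Rightarrow> real"
  assumes M: "integrable (lebesgue_on {0..1}) M"
begin

lemma forcings_integrable:
  assumes "h \<in> forcings M \<delta>"
  shows "integrable (lebesgue_on {0..1}) h"
proof (rule Bochner_Integration.integrable_bound[OF M])
  show "h \<in> borel_measurable (lebesgue_on {0..1})" using assms by (simp add: forcings_def)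
  have "AE t in lebesgue_on {0..1}. 0 \<le> h t \<and> h t \<le> M t"
    by (rule forcings_AE[OF assms])
  then show "AE t in lebesgue_on {0..1}. norm (h t) \<le> norm (M t)"
    by eventually_elim auto
qed

lemma Kop_bounds:
  assumes h: "h \<in> forcings M \<delta>" and t: "t \<le> 1"
  shows "0 \<le> Kop h t" "Kop h t \<le> integral\<^sup>L (lebesgue_on {0..1}) M"
proof -
  let ?M = "lebesgue_on {0..1::real}"
  note ae = forcings_AE[OF h]
  have sp: "AE s in ?M. 0 \<le> s \<and> s \<le> 1" by (rule AE_I2) auto
  show "0 \<le> Kop h t" unfolding Kop_def
  proof (rule integral_nonneg_AE)
    show "AE s in ?M. 0 \<le> kern t s * h s"
      using ae sp by eventually_elim (use t kern_bounds(1)[of t] in auto)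
  qed
  show "Kop h t \<le> integral\<^sup>L ?M M" unfolding Kop_def
  proof (rule integral_mono_AE[OF integrable_kern_mult[OF forcings_integrable[OF h]] M])
    show "AE s in ?M. kern t s * h s \<le> M s" using ae sp
    proof eventually_elim
      case (elim s)
      then have "kern t s * h s \<le> 1 * h s" using t kern_bounds[of t s] by (intro mult_right_mono) auto
      then show ?case using elim by simp
    qed
  qed
qed

lemma Kop_lipschitz:
  assumes h: "h \<in> forcings M \<delta>" and t: "t \<le> 1" "t' \<le> 1"
  shows "\<bar>Kop h t - Kop h t'\<bar> \<le> integral\<^sup>L (lebesgue_on {0..1}) M * \<bar>t - t'\<bar>"
proof -
  let ?M = "lebesgue_on {0..1::real}"
  note hi = forcings_integrable[OF h]
  note i = integrable_kern_mult[OF hi]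
  note ae = forcings_AE[OF h]
  have sp: "AE s in ?M. 0 \<le> s \<and> s \<le> 1" by (rule AE_I2) auto
  have "\<bar>Kop h t - Kop h t'\<bar> = norm (integral\<^sup>L ?M (\<lambda>s. kern t s * h s - kern t' s * h s))"
    unfolding Kop_def using i by simp
  also have "\<dots> \<le> integral\<^sup>L ?M (\<lambda>s. norm (kern t s * h s - kern t' s * h s))"
    by (rule integral_norm_bound)
  also have "\<dots> \<le> integral\<^sup>L ?M (\<lambda>s. \<bar>t - t'\<bar> * M s)"
  proof (rule integral_mono_AE)
    show "AE s in ?M. norm (kern t s * h s - kern t' s * h s) \<le> \<bar>t - t'\<bar> * M s" using ae sp
    proof eventually_elim
      case (elim s)
      have "norm (kern t s * h s - kern t' s * h s) = \<bar>kern t s - kern t' s\<bar> * h s"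
        using elim by (simp add: left_diff_distrib[symmetric] abs_mult)
      also have "\<dots> \<le> \<bar>t - t'\<bar> * M s"
        using elim kern_lipschitz[OF t, of s] by (intro mult_mono) auto
      finally show ?case .
    qed
  qed (use i M in auto)
  finally show ?thesis by (simp add: mult.commute)
qed

lemma continuous_on_Kop:
  assumes h: "h \<in> forcings M \<delta>" and "S \<subseteq> {..1}"
  shows "continuous_on S (Kop h)"
proof -
  have L: "0 \<le> integral\<^sup>L (lebesgue_on {0..1}) M"
    using Kop_bounds[OF h, of 0] by simp
  have "(integral\<^sup>L (lebesgue_on {0..1}) M)-lipschitz_on S (Kop h)"
    by (rule lipschitz_onI) (use assms Kop_lipschitz[OF h] L in \<open>auto simp: dist_real_def\<close>)
  then show ?thesis by (rule lipschitz_on_continuous_on)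
qed

text \<open>\<delta> may change sign, but the kernel and h are nonnegative: h dominates \<delta> on
  the middle half, and the rest of the integral can only add. This gives the upper bound \<rho> /
  \<open>deltabar \<delta>\<close> for \<lambda>.\<close>

lemma deltabar_le_supnorm_Kop:
  assumes h: "h \<in> forcings M \<delta>" and \<delta>: "integrable (lebesgue_on {1/4..3/4}) \<delta>"
  shows "deltabar \<delta> \<le> supnorm 0 1 (Kop h)"
  unfolding deltabar_def
proof (rule cSUP_least)
  fix t :: real assume t: "t \<in> {1/4..3/4}"
  let ?N = "lebesgue_on {1/4..3/4::real}"
  note hi = forcings_integrable[OF h]
  have hN: "integrable ?N h"
    by (rule Equivalence_Lebesgue_Henstock_Integration.integrable_subinterval[OF hi]) auto
  have "integral\<^sup>L ?N (\<lambda>s. kern t s * \<delta> s) \<le> integral\<^sup>L ?N (\<lambda>s. kern t s * h s)"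
  proof (rule integral_mono_AE[OF integrable_kern_mult[OF \<delta>] integrable_kern_mult[OF hN]])
    have ae: "AE s in ?N. \<delta> s \<le> h s"
      using h by (simp add: forcings_def AE_restrict_space_iff)
    have sp: "AE s in ?N. 1/4 \<le> s \<and> s \<le> 3/4" by (rule AE_I2) auto
    show "AE s in ?N. kern t s * \<delta> s \<le> kern t s * h s" using ae sp
    proof eventually_elim
      case (elim s)
      then show ?case using t kern_bounds[of t s] by (intro mult_left_mono) auto
    qed
  qed
  also have "\<dots> \<le> Kop h t"
  proof -
    have "integral\<^sup>L ?N (\<lambda>s. kern t s * h s)
      = integral\<^sup>L (lebesgue_on {0..1}) (\<lambda>s. indicator {1/4..3/4} s * (kern t s * h s))"
    proof -
      have "(\<lambda>s::real. indicator {1/4..3/4} s *\<^sub>R (kern t s * h s))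
        = (\<lambda>s. indicator {0..1} s *\<^sub>R (indicator {1/4..3/4} s * (kern t s * h s)))"
        by (auto simp: fun_eq_iff indicator_def)
      then have "integral\<^sup>L lebesgue (\<lambda>s::real. indicator {1/4..3/4} s *\<^sub>R (kern t s * h s))
        = integral\<^sup>L lebesgue (\<lambda>s. indicator {0..1} s *\<^sub>R (indicator {1/4..3/4} s * (kern t s * h s)))"
        by (rule arg_cong)
      then show ?thesis
        by (subst (1 2) integral_restrict_space) auto
    qed
    also have "\<dots> \<le> Kop h t" unfolding Kop_def
    proof (rule integral_mono_AE')
      note ae = forcings_AE[OF h]
      have sp: "AE s in lebesgue_on {0..1::real}. 0 \<le> s \<and> s \<le> 1" by (rule AE_I2) auto
      show "AE s in lebesgue_on {0..1}. indicator {1/4..3/4} s * (kern t s * h s) \<le> kern t s * h s"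
        using ae sp by eventually_elim (use t kern_bounds(1)[of t] in \<open>auto simp: indicator_def\<close>)
      show "AE s in lebesgue_on {0..1}. 0 \<le> kern t s * h s"
        using ae sp by eventually_elim (use t kern_bounds(1)[of t] in auto)
    qed (rule integrable_kern_mult[OF hi])
    finally show ?thesis .
  qed
  also have "\<dots> \<le> supnorm 0 1 (Kop h)"
    using supnorm_upper[OF continuous_on_Kop[OF h], of 0 1 t] t by auto
  finally show "integral\<^sup>L ?N (\<lambda>s. kern t s * \<delta> s) \<le> supnorm 0 1 (Kop h)" .
qed auto

lemma forcings_convex_sum:
  fixes c :: "nat \<Rightarrow> real" and hs :: "nat \<Rightarrow> real \<Rightarrow> real"
  assumes hs: "\<And>i. i < n \<Longrightarrow> hs i \<in> forcings M \<delta>"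
    and c: "\<forall>i<n. 0 \<le> c i" "(\<Sum>i<n. c i) = 1"
  shows "(\<lambda>s. \<Sum>i<n. c i * hs i s) \<in> forcings M \<delta>"
proof -
  have le: "(\<Sum>i<n. c i * X) = X" for X using c(2) by (simp add: sum_distrib_right[symmetric])
  have 1: "AE t in lebesgue. \<forall>i\<in>{..<n}. t \<in> {0..1} \<longrightarrow> 0 \<le> hs i t \<and> hs i t \<le> M t"
    using hs by (intro AE_finite_allI) (auto simp: forcings_def)
  have 2: "AE t in lebesgue. \<forall>i\<in>{..<n}. t \<in> {1/4..3/4} \<longrightarrow> \<delta> t \<le> hs i t"
    using hs by (intro AE_finite_allI) (auto simp: forcings_def)
  have "AE t in lebesgue. t \<in> {0..1} \<longrightarrow> 0 \<le> (\<Sum>i<n. c i * hs i t) \<and> (\<Sum>i<n. c i * hs i t) \<le> M t"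
    using 1
  proof eventually_elim
    case (elim t)
    show ?case
    proof (intro impI conjI)
      assume t: "t \<in> {0..1}"
      show "0 \<le> (\<Sum>i<n. c i * hs i t)" using elim t c by (intro sum_nonneg) auto
      have "(\<Sum>i<n. c i * hs i t) \<le> (\<Sum>i<n. c i * M t)" using elim t c by (intro sum_mono mult_left_mono) auto
      then show "(\<Sum>i<n. c i * hs i t) \<le> M t" by (simp only: le)
    qed
  qed
  moreover have "AE t in lebesgue. t \<in> {1/4..3/4} \<longrightarrow> \<delta> t \<le> (\<Sum>i<n. c i * hs i t)"
    using 2
  proof eventually_elim
    case (elim t)
    show ?case
    proof
      assume t: "t \<in> {1/4..3/4}"
      have "(\<Sum>i<n. c i * \<delta> t) \<le> (\<Sum>i<n. c i * hs i t)" using elim t c by (intro sum_mono mult_left_mono) auto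
      then show "\<delta> t \<le> (\<Sum>i<n. c i * hs i t)" by (simp only: le)
    qed
  qed
  moreover have "(\<lambda>s. \<Sum>i<n. c i * hs i s) \<in> borel_measurable (lebesgue_on {0..1})"
    using hs by (intro borel_measurable_sum borel_measurable_times) (auto simp: forcings_def)
  ultimately show ?thesis by (simp add: forcings_def)
qed

lemma Kop_sum:
  fixes c :: "nat \<Rightarrow> real" and hs :: "nat \<Rightarrow> real \<Rightarrow> real"
  assumes hs: "\<And>i. i < n \<Longrightarrow> hs i \<in> forcings M \<delta>"
  shows "Kop (\<lambda>s. \<Sum>i<n. c i * hs i s) t = (\<Sum>i<n. c i * Kop (hs i) t)"
proof -
  have i: "integrable (lebesgue_on {0..1}) (\<lambda>s. kern t s * hs i s)" if "i < n" for i
    by (rule integrable_kern_mult[OF forcings_integrable[OF hs[OF that]]])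
  have "Kop (\<lambda>s. \<Sum>i<n. c i * hs i s) t = integral\<^sup>L (lebesgue_on {0..1}) (\<lambda>s. \<Sum>i<n. c i * (kern t s * hs i s))"
    unfolding Kop_def by (rule Bochner_Integration.integral_cong) (simp_all add: sum_distrib_left mult_ac)
  also have "\<dots> = (\<Sum>i<n. integral\<^sup>L (lebesgue_on {0..1}) (\<lambda>s. c i * (kern t s * hs i s)))"
    using i by (intro Bochner_Integration.integral_sum integrable_mult_right) auto
  finally show ?thesis by (simp add: Kop_def)
qed

end

lemma Kop_nonpos: "t \<le> 0 \<Longrightarrow> Kop h t = 0"
proof -
  assume t: "t \<le> 0"
  have "Kop h t = integral\<^sup>L (lebesgue_on {0..1::real}) (\<lambda>s. 0)"
    unfolding Kop_def
    by (rule Bochner_Integration.integral_cong) (use t in \<open>auto simp: kern_def Green_def\<close>)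
  then show ?thesis by simp
qed

section \<open>Approximate solutions and their limit\<close>

text \<open>Adding a constant could leave [0, R], so \<open>x0\<close> is mixed with a constant
  \<theta> from (0, R) in the ratio 1 - \<kappa> to \<kappa>. Contact with a curve at t then means
  that a rescaled difference, \<open>g n\<close> or \<open>g' j\<close>, takes the value \<theta> at
  t; outside a countable set one \<theta> serves all curves, for x and for x after \<sigma>.\<close>

lemma generic_perturbation:
  fixes \<gamma> \<Gamma> :: "nat \<Rightarrow> real \<Rightarrow> real" and a b c d :: "nat \<Rightarrow> real"
  assumes x0: "continuous_on {-r..1} x0" "\<And>t. t \<in> {-r..1} \<Longrightarrow> 0 \<le> x0 t \<and> x0 t \<le> R"
    and r: "0 \<le> r" and R: "0 < R" and \<eta>: "0 < \<eta>"
    and \<sigma>: "continuous_on {0..1} \<sigma>" "\<sigma> ` {0..1} \<subseteq> {-r..1}"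
    and \<gamma>: "\<And>n. continuous_on {a n..b n} (\<gamma> n)"
    and \<Gamma>: "\<And>j. continuous_on {c j..d j} (\<Gamma> j)"
  obtains x where "continuous_on {-r..1} x" "\<And>t. t \<in> {-r..1} \<Longrightarrow> 0 \<le> x t \<and> x t \<le> R"
    "\<And>t. t \<in> {-r..1} \<Longrightarrow> \<bar>x t - x0 t\<bar> \<le> \<eta>"
    "AE t in lebesgue. t \<in> {0..1} \<longrightarrow> x t \<notin> {\<gamma> n t |n. t \<in> {a n..b n}} \<and> x (\<sigma> t) \<notin> {\<Gamma> j t |j. t \<in> {c j..d j}}"
proof -
  define \<kappa> where "\<kappa> = min 1 (\<eta> / R)"
  have \<kappa>: "0 < \<kappa>" "\<kappa> \<le> 1" "\<kappa> * R \<le> \<eta>"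
    using R \<eta> by (auto simp: \<kappa>_def min_def field_simps)
  define g where "g n t = (\<gamma> n t - (1 - \<kappa>) * x0 t) / \<kappa>" for n t
  define g' where "g' j t = (\<Gamma> j t - (1 - \<kappa>) * x0 (\<sigma> t)) / \<kappa>" for j t
  define I where "I n = {max 0 (a n)..min 1 (b n)}" for n
  define J where "J j = {max 0 (c j)..min 1 (d j)}" for j
  define bad where "bad = (\<Union>n. {\<theta>. \<not> (AE t in lebesgue. t \<in> I n \<longrightarrow> g n t \<noteq> \<theta>)})
    \<union> (\<Union>j. {\<theta>. \<not> (AE t in lebesgue. t \<in> J j \<longrightarrow> g' j t \<noteq> \<theta>)})"
  have "countable bad" unfolding bad_def I_def J_def
  proof (intro countable_Un countable_UN countable_nonnull_levels)
    fix n j :: nat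
    have "continuous_on {max 0 (a n)..min 1 (b n)} x0" "continuous_on {max 0 (a n)..min 1 (b n)} (\<gamma> n)"
      using r by (auto intro: continuous_on_subset[OF x0(1)] continuous_on_subset[OF \<gamma>[of n]])
    then show "continuous_on {max 0 (a n)..min 1 (b n)} (g n)"
      unfolding g_def using \<kappa> by (intro continuous_intros) auto
    have "continuous_on {0..1} (\<lambda>t. x0 (\<sigma> t))"
      using \<sigma>(2) by (intro continuous_on_compose2[OF x0(1) \<sigma>(1)])
    then have "continuous_on {max 0 (c j)..min 1 (d j)} (\<lambda>t. x0 (\<sigma> t))"
      by (rule continuous_on_subset) auto
    moreover have "continuous_on {max 0 (c j)..min 1 (d j)} (\<Gamma> j)"
      by (auto intro: continuous_on_subset[OF \<Gamma>[of j]])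
    ultimately show "continuous_on {max 0 (c j)..min 1 (d j)} (g' j)"
      unfolding g'_def using \<kappa> by (intro continuous_intros) auto
  qed auto
  moreover have "uncountable {0<..<R}" using R by (simp add: uncountable_open_interval)
  ultimately have "\<not> {0<..<R} \<subseteq> bad" using countable_subset by blast
  then obtain \<theta> where \<theta>: "0 < \<theta>" "\<theta> < R" "\<theta> \<notin> bad" by (metis greaterThanLessThan_iff subsetI)
  define x where "x t = (1 - \<kappa>) * x0 t + \<kappa> * \<theta>" for t
  show ?thesis
  proof (rule that[of x])
    show "continuous_on {-r..1} x" unfolding x_def by (intro continuous_intros x0)
    fix t assume t: "t \<in> {-r..1}"
    note x0t = x0(2)[OF t]
    have "(1 - \<kappa>) * x0 t + \<kappa> * \<theta> \<le> (1 - \<kappa>) * R + \<kappa> * R"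
      using x0t \<theta> \<kappa> by (intro add_mono mult_left_mono) auto
    moreover have "(1 - \<kappa>) * R + \<kappa> * R = R" by (simp add: algebra_simps)
    moreover have "0 \<le> (1 - \<kappa>) * x0 t" "0 \<le> \<kappa> * \<theta>" using x0t \<theta> \<kappa> by auto
    ultimately show "0 \<le> x t \<and> x t \<le> R" unfolding x_def by linarith
    have "x t - x0 t = \<kappa> * (\<theta> - x0 t)" by (simp add: x_def algebra_simps)
    also have "\<bar>\<dots>\<bar> \<le> \<kappa> * R" using x0t \<theta> \<kappa> by (auto simp: abs_mult intro!: mult_left_mono)
    finally show "\<bar>x t - x0 t\<bar> \<le> \<eta>" using \<kappa> by linarith
  next
    have "AE t in lebesgue. \<forall>n. t \<in> I n \<longrightarrow> g n t \<noteq> \<theta>"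
      using \<theta>(3) by (simp add: bad_def AE_all_countable)
    moreover have "AE t in lebesgue. \<forall>j. t \<in> J j \<longrightarrow> g' j t \<noteq> \<theta>"
      using \<theta>(3) by (simp add: bad_def AE_all_countable)
    ultimately show "AE t in lebesgue. t \<in> {0..1} \<longrightarrow>
      x t \<notin> {\<gamma> n t |n. t \<in> {a n..b n}} \<and> x (\<sigma> t) \<notin> {\<Gamma> j t |j. t \<in> {c j..d j}}"
    proof eventually_elim
      case (elim t)
      show ?case
      proof (intro impI conjI)
        assume t: "t \<in> {0..1}"
        have "g n t = \<theta>" if "x t = \<gamma> n t" for n
          using that \<kappa> by (simp add: g_def x_def field_simps)
        then show "x t \<notin> {\<gamma> n t |n. t \<in> {a n..b n}}" using elim t by (auto simp: I_def)
        have "g' j t = \<theta>" if "x (\<sigma> t) = \<Gamma> j t" for j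
          using that \<kappa> by (simp add: g'_def x_def field_simps)
        then show "x (\<sigma> t) \<notin> {\<Gamma> j t |j. t \<in> {c j..d j}}" using elim t by (auto simp: J_def)
      qed
    qed
  qed
qed

text \<open>Hypotheses free of \<lambda>, with continuity as the only property of the curves.
  Admissibility, and continuity of f off the curves, enter later, once the limit of the factors
  \<lambda> is at hand.\<close>

locale delay_bvp =
  fixes r \<rho> :: real and \<omega> \<sigma> M \<delta> :: "real \<Rightarrow> real"
    and f :: "real \<Rightarrow> real \<Rightarrow> real \<Rightarrow> real"
    and \<gamma> \<Gamma> :: "nat \<Rightarrow> real \<Rightarrow> real"
    and a b c d :: "nat \<Rightarrow> real"
  assumes r: "0 \<le> r"
    and \<omega>_cont: "continuous_on {-r..0} \<omega>"
    and \<omega>_nonneg: "\<forall>t\<in>{-r..0}. 0 \<le> \<omega> t"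
    and \<sigma>_cont: "continuous_on {0..1} \<sigma>"
    and \<sigma>_range: "\<sigma> ` {0..1} \<subseteq> {-r..1}"
    and f_nonneg: "\<forall>t\<in>{0..1}. \<forall>u\<ge>0. \<forall>v\<ge>0. 0 \<le> f t u v"
    and \<rho>: "0 < \<rho>"
    and H1: "\<forall>u v. continuous_on {0..1} u \<and> (\<forall>t\<in>{0..1}. 0 \<le> u t)
                 \<and> continuous_on {0..1} v \<and> (\<forall>t\<in>{0..1}. 0 \<le> v t)
              \<longrightarrow> (\<lambda>t. f t (u t) (v t)) \<in> borel_measurable (lebesgue_on {0..1})"
    and M: "integrable (lebesgue_on {0..1}) M"
    and M_bound: "AE t in lebesgue. t \<in> {0..1} \<longrightarrow>
                 (\<forall>u v. 0 \<le> u \<and> u \<le> \<rho> + supnorm (-r) 0 \<omega> \<and> 0 \<le> v \<and> v \<le> \<rho> + supnorm (-r) 0 \<omega>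
                        \<longrightarrow> f t u v \<le> M t)"
    and \<delta>: "integrable (lebesgue_on {1/4..3/4}) \<delta>"
    and \<delta>_bound: "AE t in lebesgue. t \<in> {1/4..3/4} \<longrightarrow>
                 (\<forall>u v. 0 \<le> u \<and> u \<le> \<rho> + supnorm (-r) 0 \<omega> \<and> 0 \<le> v \<and> v \<le> \<rho> + supnorm (-r) 0 \<omega>
                        \<longrightarrow> \<delta> t \<le> f t u v)"
    and \<delta>_pos: "0 < deltabar \<delta>"
    and \<gamma>_cont: "\<And>n. continuous_on {a n..b n} (\<gamma> n)"
    and \<Gamma>_cont: "\<And>j. continuous_on {c j..d j} (\<Gamma> j)"
begin

text \<open>For 0 \<le> w \<le> \<rho> all values of y + w lie in [0, R], the range in which (H2)
  and (H3) control f.\<close>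

definition R where "R = \<rho> + supnorm (-r) 0 \<omega>"
definition L where "L = integral\<^sup>L (lebesgue_on {0..1}) M"
definition free1 where "free1 t = {0..} - {\<gamma> n t |n. t \<in> {a n..b n}}"
definition free2 where "free2 t = {0..} - {\<Gamma> j t |j. t \<in> {c j..d j}}"

text \<open>Only curve-free points enter: countably many curves may accumulate at a point off all of
  them, so \<open>f\<close> is controlled near a continuity point only along curve-free points.\<close>
definition hull_at where
  "hull_at \<epsilon> u t = convex hull
     {f t x z |x z. x \<in> free1 t \<and> z \<in> free2 t \<and> \<bar>x - u t\<bar> < \<epsilon> \<and> \<bar>z - u (\<sigma> t)\<bar> < \<epsilon>}"

lemma R_pos: "0 < R"
  using supnorm_upper[OF \<omega>_cont, of 0] r \<rho> by (auto simp: R_def)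

lemma superposition_in_forcings:
  assumes x: "continuous_on {-r..1} x" "\<And>t. t \<in> {-r..1} \<Longrightarrow> 0 \<le> x t \<and> x t \<le> R"
  shows "(\<lambda>s. f s (x s) (x (\<sigma> s))) \<in> forcings M \<delta>"
proof -
  have x1: "continuous_on {0..1} x" using r by (auto intro: continuous_on_subset[OF x(1)])
  have x2: "continuous_on {0..1} (\<lambda>t. x (\<sigma> t))"
    using \<sigma>_range by (intro continuous_on_compose2[OF x(1) \<sigma>_cont])
  have b1: "0 \<le> x t \<and> x t \<le> R" if "t \<in> {0..1}" for t using x(2)[of t] that r by auto
  have b2: "0 \<le> x (\<sigma> t) \<and> x (\<sigma> t) \<le> R" if "t \<in> {0..1}" for t using x(2)[of "\<sigma> t"] that \<sigma>_range by blast
  have "(\<lambda>s. f s (x s) (x (\<sigma> s))) \<in> borel_measurable (lebesgue_on {0..1})"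
    using H1[rule_format, of x "\<lambda>t. x (\<sigma> t)"] x1 x2 b1 b2 by blast
  moreover have "AE t in lebesgue. t \<in> {0..1} \<longrightarrow> 0 \<le> f t (x t) (x (\<sigma> t)) \<and> f t (x t) (x (\<sigma> t)) \<le> M t"
    using M_bound
  proof eventually_elim
    case (elim t)
    then show ?case using f_nonneg b1[of t] b2[of t] by (auto simp: R_def)
  qed
  moreover have "AE t in lebesgue. t \<in> {1/4..3/4} \<longrightarrow> \<delta> t \<le> f t (x t) (x (\<sigma> t))"
    using \<delta>_bound
  proof eventually_elim
    case (elim t)
    show ?case
    proof
      assume t: "t \<in> {1/4..3/4}"
      then have t1: "t \<in> {0..1}" by auto
      show "\<delta> t \<le> f t (x t) (x (\<sigma> t))" using elim t b1[OF t1] b2[OF t1] by (auto simp: R_def)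
    qed
  qed
  ultimately show ?thesis unfolding forcings_def by blast
qed

text \<open>The unknown is the weight vector c. It determines the forcing \<open>hc c\<close> and
  the normalised potential \<open>w c\<close>, and \<open>D i c\<close> is the distance of
  \<open>xs i\<close> from y + \<open>w c\<close>. These distances are Lipschitz in c, and every
  \<open>w c\<close> lies in the family \<open>EE\<close> covered by the net, so some distance is
  always at most \<eta>: the situation of \<open>simplex_cover_selection\<close>.\<close>

lemma approx_solution:
  assumes \<epsilon>: "0 < \<epsilon>"
  obtains h l where "h \<in> forcings M \<delta>" "\<rho> / L \<le> l" "l \<le> \<rho> / deltabar \<delta>"
    "supnorm 0 1 (\<lambda>t. l * Kop h t) = \<rho>"
    "AE t in lebesgue. t \<in> {0..1} \<longrightarrow> h t \<in> hull_at \<epsilon> (\<lambda>t. yfun \<omega> t + l * Kop h t) t"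
proof -
  let ?y = "yfun \<omega>"
  \<comment> \<open>A Lipschitz constant for every l * \<open>Kop h\<close> with 0 \<le> l \<le>
    \<rho> / \<open>deltabar \<delta>\<close>.\<close>
  define B where "B = \<rho> / deltabar \<delta> * L"
  define EE where "EE = {e::real \<Rightarrow> real. (\<forall>t\<in>{-r..1}. 0 \<le> e t \<and> e t \<le> \<rho>) \<and>
    (\<forall>s\<in>{-r..1}. \<forall>t\<in>{-r..1}. \<bar>e s - e t\<bar> \<le> B * \<bar>s - t\<bar>)}"
  define x0 where "x0 = (\<lambda>t::real. R)"
  have Kb: "0 \<le> Kop h t" "Kop h t \<le> L" if "h \<in> forcings M \<delta>" "t \<le> 1" for h t
    using Kop_bounds[OF M that] by (auto simp: L_def)
  have Kl: "\<bar>Kop h t - Kop h t'\<bar> \<le> L * \<bar>t - t'\<bar>" if "h \<in> forcings M \<delta>" "t \<le> 1" "t' \<le> 1" for h t t'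
    using Kop_lipschitz[OF M that] by (auto simp: L_def)
  have Kc: "continuous_on {\<alpha>..1} (Kop h)" if "h \<in> forcings M \<delta>" for h \<alpha>
    by (rule continuous_on_Kop[OF M that]) auto
  have K\<delta>: "deltabar \<delta> \<le> supnorm 0 1 (Kop h)" if "h \<in> forcings M \<delta>" for h
    by (rule deltabar_le_supnorm_Kop[OF M that \<delta>])
  have KL: "supnorm 0 1 (Kop h) \<le> L" if "h \<in> forcings M \<delta>" for h
    using Kb[OF that] by (intro supnorm_least) auto
  \<comment> \<open>The constant function R shows that \<open>forcings\<close> is not empty, so
    \<open>deltabar \<delta>\<close> is at most \<open>L\<close>, and \<open>L\<close> is
    positive.\<close>
  have "(\<lambda>s. f s (x0 s) (x0 (\<sigma> s))) \<in> forcings M \<delta>"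
    by (rule superposition_in_forcings) (use R_pos in \<open>auto simp: x0_def\<close>)
  from K\<delta>[OF this] KL[OF this] have L_pos: "0 < L" using \<delta>_pos by linarith
  have B0: "0 \<le> B" using \<rho> \<delta>_pos L_pos by (simp add: B_def)
  have yc: "continuous_on {-r..1} ?y" by (rule continuous_on_yfun[OF \<omega>_cont r])
  have yb: "0 \<le> ?y t" "?y t \<le> supnorm (-r) 0 \<omega>" if "t \<in> {-r..1}" for t
    using yfun_bounds[OF \<omega>_cont \<omega>_nonneg r that] .
  \<comment> \<open>Net and perturbation contribute \<eta>/2 each, so the cover has radius \<eta>;
    the selection gives 3 * \<eta> < \<epsilon>.\<close>
  define \<eta> where "\<eta> = \<epsilon> / 4"
  have \<eta>: "0 < \<eta>" using \<epsilon> by (simp add: \<eta>_def)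
  obtain N where N: "finite N" "N \<subseteq> EE" and
    net: "\<And>e. e \<in> EE \<Longrightarrow> \<exists>e'\<in>N. \<forall>t\<in>{-r..1}. \<bar>e t - e' t\<bar> \<le> \<eta> / 2"
    by (rule finite_net_lipschitz[of EE "-r" 1 \<rho> B "\<eta> / 2"]) (use B0 \<eta> in \<open>auto simp: EE_def\<close>)
  have "(\<lambda>t. 0) \<in> EE" using \<rho> B0 by (auto simp: EE_def)
  then have "N \<noteq> {}" using net by blast
  then have n0: "0 < card N" using N by (simp add: card_gt_0_iff)
  define n where "n = card N"
  obtain en where en: "bij_betw en {..<n} N"
    using ex_bij_betw_nat_finite[OF N(1)] by (auto simp: n_def atLeast0LessThan)
  have enE: "en i \<in> EE" if "i < n" for i using bij_betwE[OF en] that N(2) by blast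
  define good where "good i x \<longleftrightarrow> continuous_on {-r..1} x \<and> (\<forall>t\<in>{-r..1}. 0 \<le> x t \<and> x t \<le> R) \<and>
    (\<forall>t\<in>{-r..1}. \<bar>x t - (?y t + en i t)\<bar> \<le> \<eta> / 2) \<and>
    (AE t in lebesgue. t \<in> {0..1} \<longrightarrow> x t \<notin> {\<gamma> n t |n. t \<in> {a n..b n}} \<and> x (\<sigma> t) \<notin> {\<Gamma> j t |j. t \<in> {c j..d j}})"
    for i x
  have "\<exists>x. good i x" if i: "i < n" for i
  proof -
    have e: "0 \<le> en i t \<and> en i t \<le> \<rho>" if "t \<in> {-r..1}" for t using enE[OF i] that by (auto simp: EE_def)
    have "B-lipschitz_on {-r..1} (en i)"
      using enE[OF i] B0 by (intro lipschitz_onI) (auto simp: EE_def dist_real_def)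
    then have "continuous_on {-r..1} (\<lambda>t. ?y t + en i t)"
      by (intro continuous_intros yc lipschitz_on_continuous_on)
    moreover have "0 \<le> ?y t + en i t \<and> ?y t + en i t \<le> R" if "t \<in> {-r..1}" for t
      using e[OF that] yb[OF that] by (auto simp: R_def)
    ultimately show ?thesis
      by (rule generic_perturbation[where \<eta> = "\<eta> / 2" and \<sigma> = \<sigma> and \<gamma> = \<gamma> and \<Gamma> = \<Gamma> and a = a and b = b and c = c and d = d])
        (use r R_pos \<eta> \<sigma>_cont \<sigma>_range \<gamma>_cont \<Gamma>_cont in \<open>auto simp: good_def\<close>)
  qed
  then obtain xs where xs: "\<And>i. i < n \<Longrightarrow> good i (xs i)" by metis
  define hs where "hs i s = f s (xs i s) (xs i (\<sigma> s))" for i s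
  have hs: "hs i \<in> forcings M \<delta>" if "i < n" for i
    unfolding hs_def using xs[OF that] by (intro superposition_in_forcings) (auto simp: good_def)
  define \<Delta> where "\<Delta> = {c::nat \<Rightarrow> real. (\<forall>i<n. 0 \<le> c i) \<and> (\<Sum>i<n. c i) = 1}"
  define hc where "hc c s = (\<Sum>i<n. c i * hs i s)" for c s
  define \<nu> where "\<nu> c = supnorm 0 1 (Kop (hc c))" for c
  define w where "w c t = \<rho> / \<nu> c * Kop (hc c) t" for c t
  define D where "D i c = supnorm (-r) 1 (\<lambda>t. xs i t - (?y t + w c t))" for i c
  have hcF: "hc c \<in> forcings M \<delta>" if "c \<in> \<Delta>" for c
    unfolding hc_def using that by (intro forcings_convex_sum[OF M] hs) (auto simp: \<Delta>_def)
  have \<nu>: "deltabar \<delta> \<le> \<nu> c" "\<nu> c \<le> L" "0 < \<nu> c" if "c \<in> \<Delta>" for c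
    using K\<delta>[OF hcF[OF that]] KL[OF hcF[OF that]] \<delta>_pos by (auto simp: \<nu>_def)
  have K\<nu>: "Kop (hc c) t \<le> \<nu> c" if "c \<in> \<Delta>" "t \<in> {-r..1}" for c t
  proof (cases "t \<le> 0")
    case True then show ?thesis using \<nu>[OF that(1)] by (simp add: Kop_nonpos)
  next
    case False
    then show ?thesis unfolding \<nu>_def
      using supnorm_upper[OF Kc[OF hcF[OF that(1)]], of t 0] that by auto
  qed
  have wE: "w c \<in> EE" if c: "c \<in> \<Delta>" for c
    unfolding EE_def
  proof (intro CollectI conjI ballI)
    fix t assume t: "t \<in> {-r..1}"
    show "0 \<le> w c t" using Kb(1)[OF hcF[OF c], of t] t \<rho> \<nu>[OF c] by (auto simp: w_def)
    have "\<rho> * Kop (hc c) t \<le> \<rho> * \<nu> c" using K\<nu>[OF c t] \<rho> by (intro mult_left_mono) auto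
    then show "w c t \<le> \<rho>" using \<nu>[OF c] by (simp add: w_def field_simps)
    fix s assume s: "s \<in> {-r..1}"
    have "\<bar>w c t - w c s\<bar> = \<rho> / \<nu> c * \<bar>Kop (hc c) t - Kop (hc c) s\<bar>"
      unfolding w_def right_diff_distrib[symmetric] abs_mult using \<rho> \<nu>[OF c] by simp
    also have "\<dots> \<le> \<rho> / deltabar \<delta> * (L * \<bar>t - s\<bar>)"
      using \<rho> \<nu>[OF c] \<delta>_pos Kl[OF hcF[OF c], of t s] s t
      by (intro mult_mono divide_left_mono) auto
    finally show "\<bar>w c t - w c s\<bar> \<le> B * \<bar>t - s\<bar>" by (simp add: B_def mult_ac)
  qed
  have wc: "continuous_on {-r..1} (w c)" if "c \<in> \<Delta>" for c
    unfolding w_def by (intro continuous_intros Kc hcF that)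
  have D_cont: "continuous_on {-r..1} (\<lambda>t. xs i t - (?y t + w c t))" if "i < n" "c \<in> \<Delta>" for i c
    using xs[OF that(1)] by (intro continuous_intros yc wc that) (auto simp: good_def)
  have K_lip: "\<bar>Kop (hc c) t - Kop (hc c') t\<bar> \<le> L * (\<Sum>j<n. \<bar>c j - c' j\<bar>)"
    if t: "t \<le> 1" for c c' t
  proof -
    have "Kop (hc c) t - Kop (hc c') t = (\<Sum>j<n. (c j - c' j) * Kop (hs j) t)"
      unfolding hc_def by (simp add: Kop_sum[OF M hs] sum_subtractf[symmetric] left_diff_distrib)
    also have "\<bar>\<dots>\<bar> \<le> (\<Sum>j<n. \<bar>(c j - c' j) * Kop (hs j) t\<bar>)" by (rule sum_abs)
    also have "\<dots> \<le> (\<Sum>j<n. L * \<bar>c j - c' j\<bar>)"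
    proof (rule sum_mono)
      fix j assume "j \<in> {..<n}"
      then have "hs j \<in> forcings M \<delta>" using hs by simp
      then have "\<bar>c j - c' j\<bar> * \<bar>Kop (hs j) t\<bar> \<le> \<bar>c j - c' j\<bar> * L"
        using Kb[of "hs j" t] t by (intro mult_left_mono) auto
      then show "\<bar>(c j - c' j) * Kop (hs j) t\<bar> \<le> L * \<bar>c j - c' j\<bar>" by (simp add: abs_mult mult_ac)
    qed
    finally show ?thesis by (simp add: sum_distrib_left)
  qed
  have w_lip: "\<bar>w c t - w c' t\<bar> \<le> (2 * \<rho> * L / deltabar \<delta>) * (\<Sum>j<n. \<bar>c j - c' j\<bar>)"
    if c: "c \<in> \<Delta>" and c': "c' \<in> \<Delta>" and t: "t \<in> {-r..1}" for c c' t
  proof -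
    define \<tau> where "\<tau> = (\<Sum>j<n. \<bar>c j - c' j\<bar>)"
    have K1: "\<bar>Kop (hc c) t - Kop (hc c') t\<bar> \<le> L * \<tau>" using K_lip[of t c c'] t by (simp add: \<tau>_def)
    have N1: "\<bar>\<nu> c - \<nu> c'\<bar> \<le> L * \<tau>" unfolding \<nu>_def
      using K_lip[of _ c c'] by (intro supnorm_diff_le Kc hcF c c') (auto simp: \<tau>_def)
    define q where "q = Kop (hc c') t / \<nu> c'"
    have q: "0 \<le> q" "q \<le> 1"
      using Kb(1)[OF hcF[OF c'], of t] K\<nu>[OF c' t] \<nu>[OF c'] t by (auto simp: q_def)
    \<comment> \<open>As q is at most 1, the change of the normalising factor costs no more than the
      change of the potential; hence the factor 2 in the Lipschitz constant.\<close>
    have "w c t - w c' t = \<rho> / \<nu> c * ((Kop (hc c) t - Kop (hc c') t) - q * (\<nu> c - \<nu> c'))"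
      using \<nu>[OF c] \<nu>[OF c'] by (simp add: w_def q_def field_simps)
    also have "\<bar>\<dots>\<bar> = \<rho> / \<nu> c * \<bar>(Kop (hc c) t - Kop (hc c') t) - q * (\<nu> c - \<nu> c')\<bar>"
      using \<rho> \<nu>[OF c] by (simp add: abs_mult)
    also have "\<dots> \<le> \<rho> / deltabar \<delta> * (L * \<tau> + L * \<tau>)"
    proof (rule mult_mono)
      show "\<rho> / \<nu> c \<le> \<rho> / deltabar \<delta>" using \<rho> \<nu>[OF c] \<delta>_pos by (intro divide_left_mono) auto
      have "\<bar>q * (\<nu> c - \<nu> c')\<bar> \<le> 1 * (L * \<tau>)" unfolding abs_mult using q N1 by (intro mult_mono) auto
      then show "\<bar>(Kop (hc c) t - Kop (hc c') t) - q * (\<nu> c - \<nu> c')\<bar> \<le> L * \<tau> + L * \<tau>"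
        using K1 by linarith
    qed (use \<rho> \<delta>_pos in auto)
    finally show ?thesis by (simp add: \<tau>_def mult_ac)
  qed
  obtain cc where cc: "cc \<in> \<Delta>" "\<forall>i<n. 0 < cc i \<longrightarrow> D i cc < 3 * \<eta>"
  proof (rule simplex_cover_selection[of n D "2 * \<rho> * L / deltabar \<delta>" \<eta>], unfold \<Delta>_def[symmetric])
    show "0 < n" using n0 by (simp add: n_def)
    show "0 \<le> 2 * \<rho> * L / deltabar \<delta>" using \<rho> L_pos \<delta>_pos by simp
    show "0 < \<eta>" by (rule \<eta>)
    fix c assume c: "c \<in> \<Delta>"
    show "\<bar>D i c - D i c'\<bar> \<le> 2 * \<rho> * L / deltabar \<delta> * (\<Sum>j<n. \<bar>c j - c' j\<bar>)"
      if "i < n" "c' \<in> \<Delta>" for i c'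
      unfolding D_def
    proof (rule supnorm_diff_le)
      fix t assume t: "t \<in> {-r..1}"
      have "xs i t - (?y t + w c t) - (xs i t - (?y t + w c' t)) = - (w c t - w c' t)" by simp
      then show "\<bar>xs i t - (?y t + w c t) - (xs i t - (?y t + w c' t))\<bar>
        \<le> 2 * \<rho> * L / deltabar \<delta> * (\<Sum>j<n. \<bar>c j - c' j\<bar>)"
        using w_lip[OF c that(2) t] by (simp only: abs_minus_cancel)
    qed (use r D_cont that c in auto)
    obtain e' where e': "e' \<in> N" "\<forall>t\<in>{-r..1}. \<bar>w c t - e' t\<bar> \<le> \<eta> / 2" using net[OF wE[OF c]] by blast
    then obtain i where i: "i < n" "en i = e'" using en by (auto simp: bij_betw_def)
    have "D i c \<le> \<eta>" unfolding D_def
    proof (rule supnorm_least)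
      fix t assume t: "t \<in> {-r..1}"
      have "\<bar>xs i t - (?y t + en i t)\<bar> \<le> \<eta> / 2" using xs[OF i(1)] t by (auto simp: good_def)
      moreover have "\<bar>w c t - en i t\<bar> \<le> \<eta> / 2" using e'(2) t i by auto
      ultimately show "\<bar>xs i t - (?y t + w c t)\<bar> \<le> \<eta>" by linarith
    qed (use r in auto)
    then show "\<exists>i<n. D i c \<le> \<eta>" using i by blast
  qed
  define l where "l = \<rho> / \<nu> cc"
  have wl: "w cc = (\<lambda>t. l * Kop (hc cc) t)" by (simp add: w_def l_def fun_eq_iff)
  note \<nu>c = \<nu>[OF cc(1)]
  show ?thesis
  proof (rule that[of "hc cc" l])
    show "hc cc \<in> forcings M \<delta>" by (rule hcF[OF cc(1)])
    show "\<rho> / L \<le> l" "l \<le> \<rho> / deltabar \<delta>"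
      unfolding l_def using \<nu>c \<rho> \<delta>_pos L_pos by (auto intro!: divide_left_mono)
    have "0 \<le> l" using \<rho> \<nu>c by (simp add: l_def)
    then have "supnorm 0 1 (\<lambda>t. l * Kop (hc cc) t) = l * \<nu> cc"
      unfolding \<nu>_def by (intro supnorm_cmult Kc hcF cc(1)) auto
    then show "supnorm 0 1 (\<lambda>t. l * Kop (hc cc) t) = \<rho>" using \<nu>c by (simp add: l_def)
    have "AE t in lebesgue. \<forall>i\<in>{..<n}. t \<in> {0..1} \<longrightarrow>
      xs i t \<notin> {\<gamma> n t |n. t \<in> {a n..b n}} \<and> xs i (\<sigma> t) \<notin> {\<Gamma> j t |j. t \<in> {c j..d j}}"
      using xs by (intro AE_finite_allI) (auto simp: good_def)
    then show "AE t in lebesgue. t \<in> {0..1} \<longrightarrow> hc cc t \<in> hull_at \<epsilon> (\<lambda>t. ?y t + l * Kop (hc cc) t) t"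
    proof eventually_elim
      case (elim t)
      show ?case
      proof
        assume t: "t \<in> {0..1}"
        \<comment> \<open>Net functions of weight 0 may be far from y + w. They are dropped before
          the sum is read as a convex combination of nearby values.\<close>
        define I where "I = {i\<in>{..<n}. 0 < cc i}"
        have near: "\<bar>xs i s - (?y s + l * Kop (hc cc) s)\<bar> < \<epsilon>" if "i \<in> I" "s \<in> {-r..1}" for i s
        proof -
          have "\<bar>xs i s - (?y s + w cc s)\<bar> \<le> D i cc" unfolding D_def
            using that cc(1) by (intro supnorm_upper[OF D_cont]) (auto simp: I_def)
          then show ?thesis using cc(2) that \<eta> by (auto simp: I_def wl \<eta>_def)
        qed
        have "t \<in> {-r..1}" using t r by auto
        moreover have "\<sigma> t \<in> {-r..1}" using t \<sigma>_range by blast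
        ultimately have t1: "t \<in> {-r..1}" "\<sigma> t \<in> {-r..1}" .
        have mem: "hs i t \<in> hull_at \<epsilon> (\<lambda>t. ?y t + l * Kop (hc cc) t) t" if i: "i \<in> I" for i
          unfolding hull_at_def
        proof (rule hull_inc, rule CollectI, intro exI conjI)
          show "hs i t = f t (xs i t) (xs i (\<sigma> t))" by (simp add: hs_def)
          have "good i (xs i)" using i xs by (auto simp: I_def)
          then have "0 \<le> xs i t" "0 \<le> xs i (\<sigma> t)" using t1 by (auto simp: good_def)
          then show "xs i t \<in> free1 t" "xs i (\<sigma> t) \<in> free2 t"
            using elim i t unfolding free1_def free2_def by (auto simp: I_def)
          show "\<bar>xs i t - (?y t + l * Kop (hc cc) t)\<bar> < \<epsilon>"
            "\<bar>xs i (\<sigma> t) - (?y (\<sigma> t) + l * Kop (hc cc) (\<sigma> t))\<bar> < \<epsilon>"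
            using near[OF i] t1 by auto
        qed
        have z: "cc i = 0" if "i \<in> {..<n} - I" for i
          using that cc(1) by (auto simp: I_def \<Delta>_def not_less intro: order.antisym)
        have "hc cc t = (\<Sum>i\<in>I. cc i * hs i t)" unfolding hc_def
          by (rule sum.mono_neutral_right) (use z in \<open>auto simp: I_def\<close>)
        moreover have "(\<Sum>i\<in>I. cc i) = 1"
        proof -
          have "(\<Sum>i\<in>I. cc i) = (\<Sum>i<n. cc i)"
            by (rule sum.mono_neutral_left) (use z in \<open>auto simp: I_def\<close>)
          then show ?thesis using cc(1) by (simp add: \<Delta>_def)
        qed
        moreover have "(\<Sum>i\<in>I. cc i *\<^sub>R hs i t) \<in> hull_at \<epsilon> (\<lambda>t. ?y t + l * Kop (hc cc) t) t"
        proof (rule convex_sum)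
          show "finite I" by (simp add: I_def)
          show "convex (hull_at \<epsilon> (\<lambda>t. ?y t + l * Kop (hc cc) t) t)"
            unfolding hull_at_def by (rule convex_convex_hull)
          show "0 \<le> cc i" if "i \<in> I" for i using that by (simp add: I_def)
        qed (use mem \<open>(\<Sum>i\<in>I. cc i) = 1\<close> in auto)
        ultimately show "hc cc t \<in> hull_at \<epsilon> (\<lambda>t. ?y t + l * Kop (hc cc) t) t" by simp
      qed
    qed
  qed
qed

lemma hull_at_mono:
  assumes "\<And>s. s \<in> {-r..1} \<Longrightarrow> \<bar>u s - u' s\<bar> \<le> \<epsilon>' - \<epsilon>" "t \<in> {0..1}"
  shows "hull_at \<epsilon> u t \<subseteq> hull_at \<epsilon>' u' t"
  unfolding hull_at_def
proof (rule hull_mono, clarify)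
  fix x z assume *: "x \<in> free1 t" "z \<in> free2 t" "\<bar>x - u t\<bar> < \<epsilon>" "\<bar>z - u (\<sigma> t)\<bar> < \<epsilon>"
  have "t \<in> {-r..1}" using assms(2) r by auto
  moreover have "\<sigma> t \<in> {-r..1}" using assms(2) \<sigma>_range by blast
  ultimately have "\<bar>u t - u' t\<bar> \<le> \<epsilon>' - \<epsilon>" "\<bar>u (\<sigma> t) - u' (\<sigma> t)\<bar> \<le> \<epsilon>' - \<epsilon>" using assms(1) by blast+
  then have "\<bar>x - u' t\<bar> < \<epsilon>'" "\<bar>z - u' (\<sigma> t)\<bar> < \<epsilon>'" using * by linarith+
  then show "\<exists>xa za. f t x z = f t xa za \<and> xa \<in> free1 t \<and> za \<in> free2 t \<and> \<bar>xa - u' t\<bar> < \<epsilon>' \<and> \<bar>za - u' (\<sigma> t)\<bar> < \<epsilon>'"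
    using * by blast
qed

text \<open>Compactness acts on \<lambda>, which stays in a compact interval, and on the potentials,
  which are equi-Lipschitz. The forcings need not converge; what survives is the hull condition
  around the limit, with e/2 spent on the uniform distance to it and e/2 on the radius 1 / (m +
  1).\<close>

lemma limit_of_approx_solutions:
  obtains h :: "nat \<Rightarrow> real \<Rightarrow> real" and lam :: "nat \<Rightarrow> real" and l w
  where "\<And>m. h m \<in> forcings M \<delta>" "\<And>m. 0 < lam m" "lam \<longlonglongrightarrow> l" "0 < l" "l \<le> \<rho> / deltabar \<delta>"
    "continuous_on {-r..1} w" "\<And>t. t \<in> {-r..1} \<Longrightarrow> (\<lambda>m. lam m * Kop (h m) t) \<longlonglongrightarrow> w t"
    "supnorm 0 1 w = \<rho>"
    "\<And>e. 0 < e \<Longrightarrow> \<forall>\<^sub>F m in sequentially. AE t in lebesgue.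
        t \<in> {0..1} \<longrightarrow> h m t \<in> hull_at e (\<lambda>t. yfun \<omega> t + w t) t"
proof -
  define Q where "Q m h l \<longleftrightarrow> h \<in> forcings M \<delta> \<and> \<rho> / L \<le> l \<and> l \<le> \<rho> / deltabar \<delta> \<and>
    supnorm 0 1 (\<lambda>t. l * Kop h t) = \<rho> \<and>
    (AE t in lebesgue. t \<in> {0..1} \<longrightarrow> h t \<in> hull_at (1 / Suc m) (\<lambda>t. yfun \<omega> t + l * Kop h t) t)"
    for m :: nat and h l
  have "\<exists>h l. Q m h l" for m
  proof -
    have "0 < 1 / real (Suc m)" by simp
    then obtain h l where "h \<in> forcings M \<delta>" "\<rho> / L \<le> l" "l \<le> \<rho> / deltabar \<delta>"
      "supnorm 0 1 (\<lambda>t. l * Kop h t) = \<rho>"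
      "AE t in lebesgue. t \<in> {0..1} \<longrightarrow> h t \<in> hull_at (1 / Suc m) (\<lambda>t. yfun \<omega> t + l * Kop h t) t"
      by (rule approx_solution)
    then show ?thesis unfolding Q_def by blast
  qed
  then obtain h0 lam0 where Q: "\<And>m. Q m (h0 m) (lam0 m)" by metis
  then have h0: "\<And>m. h0 m \<in> forcings M \<delta>"
    and lam0: "\<And>m. \<rho> / L \<le> lam0 m" "\<And>m. lam0 m \<le> \<rho> / deltabar \<delta>"
    and norm0: "\<And>m. supnorm 0 1 (\<lambda>t. lam0 m * Kop (h0 m) t) = \<rho>"
    and hull0: "\<And>m. AE t in lebesgue. t \<in> {0..1} \<longrightarrow>
      h0 m t \<in> hull_at (1 / Suc m) (\<lambda>t. yfun \<omega> t + lam0 m * Kop (h0 m) t) t"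
    unfolding Q_def by blast+
  have L_pos: "0 < L"
  proof -
    have "deltabar \<delta> \<le> supnorm 0 1 (Kop (h0 0))" by (rule deltabar_le_supnorm_Kop[OF M h0 \<delta>])
    also have "\<dots> \<le> L" unfolding L_def using Kop_bounds[OF M h0] by (intro supnorm_least) auto
    finally show ?thesis using \<delta>_pos by linarith
  qed
  have lam0_pos: "0 < lam0 m" for m using lam0(1)[of m] \<rho> L_pos by (auto intro: less_le_trans[rotated])
  obtain l k1 where l: "l \<in> {\<rho> / L..\<rho> / deltabar \<delta>}" and k1: "strict_mono k1" "(lam0 \<circ> k1) \<longlonglongrightarrow> l"
    using compact_imp_seq_compact[OF compact_Icc, of "\<rho> / L" "\<rho> / deltabar \<delta>"] lam0
    unfolding seq_compact_def by (metis atLeastAtMost_iff)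
  have l_pos: "0 < l" using l \<rho> L_pos by (auto intro: less_le_trans[rotated])
  define W where "W m t = lam0 (k1 m) * Kop (h0 (k1 m)) t" for m t
  have Wc: "continuous_on {\<alpha>..1} (W m)" for m \<alpha>
    unfolding W_def by (intro continuous_intros continuous_on_Kop[OF M h0]) auto
  have W_lip: "\<bar>W m t - W m s\<bar> \<le> \<rho> / deltabar \<delta> * L * \<bar>t - s\<bar>" if "t \<le> 1" "s \<le> 1" for m t s
  proof -
    have "\<bar>W m t - W m s\<bar> = lam0 (k1 m) * \<bar>Kop (h0 (k1 m)) t - Kop (h0 (k1 m)) s\<bar>"
      unfolding W_def right_diff_distrib[symmetric] abs_mult using lam0_pos[of "k1 m"] by simp
    also have "\<dots> \<le> \<rho> / deltabar \<delta> * (L * \<bar>t - s\<bar>)"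
      using lam0(2) Kop_lipschitz[OF M h0 that] \<rho> \<delta>_pos unfolding L_def by (intro mult_mono) auto
    finally show ?thesis by (simp add: mult_ac)
  qed
  have W_bd: "norm (W m t) \<le> \<rho>" if "t \<in> {-r..1}" for m t
  proof (cases "t \<le> 0")
    case True then show ?thesis using \<rho> by (simp add: W_def Kop_nonpos)
  next
    case False
    then show ?thesis
      using supnorm_upper[OF Wc, of t 0 m] that norm0[of "k1 m"] by (simp add: W_def[abs_def])
  qed
  obtain w k2 where w: "continuous_on {-r..1} w" and k2: "strict_mono (k2 :: nat \<Rightarrow> nat)"
    and unif: "\<And>e. 0 < e \<Longrightarrow> \<exists>N. \<forall>n x. n \<ge> N \<and> x \<in> {-r..1} \<longrightarrow> norm (W (k2 n) x - w x) < e"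
  proof (rule Arzela_Ascoli[of "{-r..1}" W \<rho>])
    fix x e :: real assume x: "x \<in> {-r..1}" and e: "0 < e"
    define B where "B = \<rho> / deltabar \<delta> * L"
    have B: "0 < B" using \<rho> \<delta>_pos L_pos by (simp add: B_def)
    have "norm (W n x - W n y) < e" if "y \<in> {-r..1}" "norm (x - y) < e / B" for n y
    proof -
      have "\<bar>W n x - W n y\<bar> \<le> B * \<bar>x - y\<bar>" using W_lip[of x y n] that x by (simp add: B_def)
      also have "\<dots> < B * (e / B)" using that B by (intro mult_strict_left_mono) auto
      finally show ?thesis using B by simp
    qed
    then show "\<exists>d>0. \<forall>n y. y \<in> {-r..1} \<and> norm (x - y) < d \<longrightarrow> norm (W n x - W n y) < e"
      using e B by (intro exI[of _ "e / B"]) auto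
  qed (use W_bd in auto)
  define k where "k = k1 \<circ> k2"
  have k: "strict_mono k" unfolding k_def using k1(1) k2 by (rule strict_mono_o)
  show ?thesis
  proof (rule that[of "\<lambda>m. h0 (k m)" "\<lambda>m. lam0 (k m)" l w])
    show "h0 (k m) \<in> forcings M \<delta>" "0 < lam0 (k m)" for m by (rule h0, rule lam0_pos)
    show "(\<lambda>m. lam0 (k m)) \<longlonglongrightarrow> l"
      using LIMSEQ_subseq_LIMSEQ[OF k1(2) k2] by (simp add: k_def o_def)
    show "0 < l" "l \<le> \<rho> / deltabar \<delta>" using l_pos l by auto
    show "continuous_on {-r..1} w" by (rule w)
    show "(\<lambda>m. lam0 (k m) * Kop (h0 (k m)) t) \<longlonglongrightarrow> w t" if "t \<in> {-r..1}" for t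
    proof (rule LIMSEQ_I)
      fix e :: real assume "0 < e"
      from unif[OF this] obtain N where "\<forall>n x. n \<ge> N \<and> x \<in> {-r..1} \<longrightarrow> norm (W (k2 n) x - w x) < e"
        by blast
      then have "\<forall>n\<ge>N. norm (lam0 (k n) * Kop (h0 (k n)) t - w t) < e"
        using that by (simp add: W_def k_def)
      then show "\<exists>N. \<forall>n\<ge>N. norm (lam0 (k n) * Kop (h0 (k n)) t - w t) < e" by blast
    qed
    have w01: "continuous_on {0..1} w" using r by (auto intro: continuous_on_subset[OF w])
    have close: "\<bar>\<rho> - supnorm 0 1 w\<bar> \<le> e" if e: "0 < e" for e
    proof -
      obtain n where "\<forall>x\<in>{-r..1}. \<bar>W (k2 n) x - w x\<bar> < e" using unif[OF e] by fastforce
      then have "\<bar>supnorm 0 1 (W (k2 n)) - supnorm 0 1 w\<bar> \<le> e"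
        using r by (intro supnorm_diff_le Wc w01) (auto intro: less_imp_le)
      then show ?thesis using norm0[of "k1 (k2 n)"] by (simp add: W_def[abs_def])
    qed
    show "supnorm 0 1 w = \<rho>"
    proof (rule ccontr)
      assume "supnorm 0 1 w \<noteq> \<rho>"
      then have pos: "0 < \<bar>\<rho> - supnorm 0 1 w\<bar> / 2" by simp
      have "\<bar>\<rho> - supnorm 0 1 w\<bar> \<le> 0" using close[OF pos] by (simp add: field_simps)
      with pos show False by simp
    qed
    fix e :: real assume e: "0 < e"
    obtain N1 where N1: "\<And>n x. N1 \<le> n \<Longrightarrow> x \<in> {-r..1} \<Longrightarrow> \<bar>W (k2 n) x - w x\<bar> < e / 2"
      using unif[of "e / 2"] e by fastforce
    obtain N2 :: nat where N2: "2 / e < N2" using reals_Archimedean2 by blast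
    have "AE t in lebesgue. t \<in> {0..1} \<longrightarrow> h0 (k m) t \<in> hull_at e (\<lambda>t. yfun \<omega> t + w t) t"
      if m: "max N1 N2 \<le> m" for m
      using hull0[of "k m"]
    proof eventually_elim
      case (elim t)
      have "real N2 \<le> real (Suc (k m))" using m seq_suble[OF k, of m] by simp
      then have "2 / e < real (Suc (k m))" using N2 by linarith
      then have "1 / Suc (k m) < e / 2" using e by (simp add: field_simps)
      then have close: "\<bar>yfun \<omega> s + lam0 (k m) * Kop (h0 (k m)) s - (yfun \<omega> s + w s)\<bar> \<le> e - 1 / Suc (k m)"
        if "s \<in> {-r..1}" for s
        using N1[OF _ that, of m] m by (simp add: W_def k_def)
      show ?case
      proof
        assume t: "t \<in> {0..1}"
        have "hull_at (1 / Suc (k m)) (\<lambda>t. yfun \<omega> t + lam0 (k m) * Kop (h0 (k m)) t) t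
          \<subseteq> hull_at e (\<lambda>t. yfun \<omega> t + w t) t"
          by (rule hull_at_mono[OF _ t]) (rule close)
        then show "h0 (k m) t \<in> hull_at e (\<lambda>t. yfun \<omega> t + w t) t" using elim t by blast
      qed
    qed
    then show "\<forall>\<^sub>F m in sequentially. AE t in lebesgue.
        t \<in> {0..1} \<longrightarrow> h0 (k m) t \<in> hull_at e (\<lambda>t. yfun \<omega> t + w t) t"
      unfolding eventually_sequentially by blast
  qed
qed

end

section \<open>The limit function: avoidance of the curves and the integral equation\<close>

lemma AE_finite_avoid:
  fixes S :: "real set"
  assumes "finite S"
  shows "AE t in lebesgue. t \<notin> S"
  using assms by (intro AE_not_in) (simp add: negligible_iff_null_sets[symmetric] negligible_finite)

context delay_bvp
begin

context
  fixes h :: "nat \<Rightarrow> real \<Rightarrow> real" and lam :: "nat \<Rightarrow> real" and l :: real and w u :: "real \<Rightarrow> real"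
  assumes h: "\<And>m. h m \<in> forcings M \<delta>"
    and lam: "\<And>m. 0 < lam m" "lam \<longlonglongrightarrow> l" "0 < l"
    and w_cont: "continuous_on {-r..1} w"
    and w_lim: "\<And>t. t \<in> {-r..1} \<Longrightarrow> (\<lambda>m. lam m * Kop (h m) t) \<longlonglongrightarrow> w t"
    and hull: "\<And>e. 0 < e \<Longrightarrow> \<forall>\<^sub>F m in sequentially. AE t in lebesgue.
        t \<in> {0..1} \<longrightarrow> h m t \<in> hull_at e u t"
    and u: "u = (\<lambda>t. yfun \<omega> t + w t)"
begin

lemma u_cont: "continuous_on {-r..1} u"
  unfolding u by (intro continuous_intros continuous_on_yfun \<omega>_cont r w_cont)

lemma w_nonpos: "t \<in> {-r..0} \<Longrightarrow> w t = 0"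
  using w_lim[of t] by (auto simp: Kop_nonpos LIMSEQ_const_iff)

lemma w_nonneg:
  assumes t: "t \<in> {-r..1}"
  shows "0 \<le> w t"
proof (rule tendsto_lowerbound[OF w_lim[OF t]])
  have "0 \<le> lam m * Kop (h m) t" for m
    using Kop_bounds(1)[OF M h, of t m] lam(1)[of m] t by auto
  then show "\<forall>\<^sub>F m in sequentially. 0 \<le> lam m * Kop (h m) t" by simp
qed simp

lemma limit_nonneg: "t \<in> {-r..1} \<Longrightarrow> 0 \<le> u t"
  using w_nonneg[of t] yfun_bounds(1)[OF \<omega>_cont \<omega>_nonneg r, of t] by (simp add: u)

text \<open>For fixed t the admissibility inequality says that the value of f lies in a half-line.
  This is a convex condition, so it passes from curve-free points near the curve to
  \<open>hull_at\<close> and thus to \<open>h m t\<close>. The radius splits as \<epsilon>/2 from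
  curve to u and \<epsilon>/2 from u to the sample point; the delayed argument z is unrestricted
  because the inequality holds for all z \<ge> 0.\<close>

lemma limit_curve_crossings:
  assumes ab: "0 \<le> a'" "b' \<le> 1"
    and wd: "weak_deriv2 g g2 a' b'"
    and \<psi>: "integrable (lebesgue_on {a'..b'}) \<psi>"
    and \<psi>_pos: "AE t in lebesgue. t \<in> {a'..b'} \<longrightarrow> 0 < \<psi> t"
    and sg: "sg = 1 \<or> sg = (-1 :: real)"
    and \<epsilon>: "0 < \<epsilon>"
    and adm: "AE t in lebesgue. t \<in> {a'..b'} \<longrightarrow>
      (\<forall>y\<in>{g t - \<epsilon>..g t + \<epsilon>}. 0 \<le> y \<longrightarrow> (\<forall>z\<ge>0. \<psi> t \<le> sg * (l * f t y z + g2 t)))"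
  shows "finite {t \<in> {a'..b'}. u t = g t}"
proof (rule finite_curve_crossings[OF ab wd \<psi> \<psi>_pos sg])
  show "continuous_on {a'..b'} u" using ab r by (auto intro: continuous_on_subset[OF u_cont])
  show "lam \<longlonglongrightarrow> l" "0 < l" "\<And>m. 0 < lam m" by (rule lam)+
  show "integrable (lebesgue_on {0..1}) (h m)" for m by (rule forcings_integrable[OF M h])
  \<comment> \<open>On [0, 1] the function y is affine, so it is invisible to second
    differences.\<close>
  show "(\<lambda>m. (- \<omega> 0) * t + \<omega> 0 + lam m * Kop (h m) t) \<longlonglongrightarrow> u t" if t: "t \<in> {0..1}" for t
  proof -
    have "yfun \<omega> t = (- \<omega> 0) * t + \<omega> 0" using t by (auto simp: yfun_def algebra_simps)
    moreover have "t \<in> {-r..1}" using t r by auto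
    ultimately show ?thesis unfolding u using w_lim[of t] by (auto intro!: tendsto_intros)
  qed
  show "0 < \<epsilon> / 2" using \<epsilon> by simp
  have "0 < \<epsilon> / 2" using \<epsilon> by simp
  from hull[OF this]
  show "\<forall>\<^sub>F m in sequentially. AE t in lebesgue.
      t \<in> {a'..b'} \<and> \<bar>u t - g t\<bar> < \<epsilon> / 2 \<longrightarrow> \<psi> t \<le> sg * (l * h m t + g2 t)"
  proof eventually_elim
    case (elim m)
    from elim adm show ?case
    proof eventually_elim
      case (elim t)
      show ?case
      proof
        assume t: "t \<in> {a'..b'} \<and> \<bar>u t - g t\<bar> < \<epsilon> / 2"
        have t01: "t \<in> {0..1}" using t ab by auto
        let ?H = "{v. (sg * l) \<bullet> v \<ge> \<psi> t - sg * g2 t}"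
        have "hull_at (\<epsilon> / 2) u t \<subseteq> ?H"
          unfolding hull_at_def
        proof (rule hull_minimal)
          show "convex ?H" by (rule convex_halfspace_ge)
          show "{f t x z |x z. x \<in> free1 t \<and> z \<in> free2 t \<and> \<bar>x - u t\<bar> < \<epsilon> / 2 \<and> \<bar>z - u (\<sigma> t)\<bar> < \<epsilon> / 2} \<subseteq> ?H"
          proof clarify
            fix x z assume x: "x \<in> free1 t" "z \<in> free2 t" "\<bar>x - u t\<bar> < \<epsilon> / 2" "\<bar>z - u (\<sigma> t)\<bar> < \<epsilon> / 2"
            have "x - u t < \<epsilon> / 2" "- (x - u t) < \<epsilon> / 2" "u t - g t < \<epsilon> / 2" "- (u t - g t) < \<epsilon> / 2"
              using x(3) t unfolding abs_less_iff by blast+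
            then have "x \<in> {g t - \<epsilon>..g t + \<epsilon>}" by auto
            moreover have "0 \<le> x" "0 \<le> z" using x by (auto simp: free1_def free2_def)
            ultimately have "\<psi> t \<le> sg * (l * f t x z + g2 t)" using elim t by blast
            then show "\<psi> t - sg * g2 t \<le> (sg * l) \<bullet> f t x z" by (simp add: algebra_simps)
          qed
        qed
        then have "h m t \<in> ?H" using elim t01 by blast
        then show "\<psi> t \<le> sg * (l * h m t + g2 t)" by (simp add: algebra_simps)
      qed
    qed
  qed
qed

lemma avoids_adm_curve:
  assumes "adm_curve l f g a' b'"
  shows "AE t in lebesgue. t \<in> {a'..b'} \<longrightarrow> u t \<noteq> g t"
proof -
  obtain g1 g2 \<epsilon> \<psi> where ab: "0 \<le> a'" "b' \<le> 1" and W: "W21_with g g1 g2 a' b'" and \<epsilon>: "0 < \<epsilon>"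
    and \<psi>: "integrable (lebesgue_on {a'..b'}) \<psi>" "AE t in lebesgue. t \<in> {a'..b'} \<longrightarrow> 0 < \<psi> t"
    and adm: "(AE t in lebesgue. t \<in> {a'..b'} \<longrightarrow>
              (\<forall>y\<in>{g t - \<epsilon>..g t + \<epsilon>}. 0 \<le> y \<longrightarrow> (\<forall>z\<ge>0. - g2 t + \<psi> t < l * f t y z)))
           \<or> (AE t in lebesgue. t \<in> {a'..b'} \<longrightarrow>
              (\<forall>y\<in>{g t - \<epsilon>..g t + \<epsilon>}. 0 \<le> y \<longrightarrow> (\<forall>z\<ge>0. - g2 t - \<psi> t > l * f t y z)))"
    using assms unfolding adm_curve_def by blast
  note fin = limit_curve_crossings[OF ab W21_with_imp_weak_deriv2[OF W] \<psi> _ \<epsilon>]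
  from adm have "finite {t \<in> {a'..b'}. u t = g t}"
  proof
    assume "AE t in lebesgue. t \<in> {a'..b'} \<longrightarrow>
      (\<forall>y\<in>{g t - \<epsilon>..g t + \<epsilon>}. 0 \<le> y \<longrightarrow> (\<forall>z\<ge>0. - g2 t + \<psi> t < l * f t y z))"
    then show ?thesis by (intro fin[of 1]) (auto elim!: eventually_mono simp: algebra_simps less_imp_le)
  next
    assume "AE t in lebesgue. t \<in> {a'..b'} \<longrightarrow>
      (\<forall>y\<in>{g t - \<epsilon>..g t + \<epsilon>}. 0 \<le> y \<longrightarrow> (\<forall>z\<ge>0. - g2 t - \<psi> t > l * f t y z))"
    then show ?thesis by (intro fin[of "-1"]) (auto elim!: eventually_mono simp: algebra_simps less_imp_le)
  qed
  from AE_finite_avoid[OF this] show ?thesis by (auto elim!: eventually_mono)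
qed

text \<open>Where \<sigma>(t) \<le> 0, u(\<sigma>(t)) is \<omega>(\<sigma>(t)), and condition (a)
  excludes contact. Where \<sigma>(t) \<ge> 0, condition (b) in the variable s = \<sigma>(t) is the
  inequality required by \<open>limit_curve_crossings\<close> for the transported curve, so contacts
  are finite in number.\<close>

lemma avoids_adm_curve_sigma:
  fixes e p :: real
  assumes adm: "adm_curve_sigma l r \<omega> \<sigma> f g c' d'"
    and e: "e = 1 \<or> e = -1" and \<sigma>: "\<And>t. t \<in> {0..1} \<Longrightarrow> \<sigma> t = p + e * t"
  shows "AE t in lebesgue. t \<in> {c'..d'} \<and> t \<in> {0..1} \<longrightarrow> u (\<sigma> t) \<noteq> g t"
proof -
  obtain g1 g2 \<epsilon> \<psi> where W: "W21_with g g1 g2 c' d'" and \<epsilon>: "0 < \<epsilon>"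
    and past: "AE t in lebesgue. t \<in> {c'..d'} \<and> t \<in> {0..1} \<and> \<sigma> t \<in> {-r..0} \<longrightarrow> g t \<noteq> \<omega> (\<sigma> t)"
    and \<psi>: "integrable (lebesgue_on {c'..d'}) \<psi>"
    and \<psi>_pos: "AE t in lebesgue. t \<in> {c'..d'} \<and> t \<in> {0..1} \<and> \<sigma> t \<in> {0..1} \<longrightarrow> 0 < \<psi> t"
    and adm': "(AE t in lebesgue. t \<in> {c'..d'} \<and> t \<in> {0..1} \<and> \<sigma> t \<in> {0..1} \<longrightarrow>
              (\<forall>y\<in>{g t - \<epsilon>..g t + \<epsilon>}. 0 \<le> y \<longrightarrow> (\<forall>z\<ge>0. - g2 t + \<psi> t < l * f (\<sigma> t) y z)))
           \<or> (AE t in lebesgue. t \<in> {c'..d'} \<and> t \<in> {0..1} \<and> \<sigma> t \<in> {0..1} \<longrightarrow>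
              (\<forall>y\<in>{g t - \<epsilon>..g t + \<epsilon>}. 0 \<le> y \<longrightarrow> (\<forall>z\<ge>0. - g2 t - \<psi> t > l * f (\<sigma> t) y z)))"
    using adm unfolding adm_curve_sigma_def by blast
  have ee: "e * e = 1" "\<bar>e\<bar> = 1" "e \<noteq> 0" using e by auto
  \<comment> \<open>\<open>s \<mapsto> q + e s\<close> inverts \<open>\<sigma>\<close>; the curve is transported to the time scale of \<open>\<sigma>(t)\<close>.\<close>
  define q where "q = - e * p"
  have inv1: "q + e * (p + e * t) = t" for t
    using ee(1) by (simp add: q_def algebra_simps mult.assoc[symmetric])
  have inv2: "p + e * (q + e * s) = s" for s
    using ee(1) by (simp add: q_def algebra_simps mult.assoc[symmetric])
  \<comment> \<open>As \<sigma> is affine, the times of the curve at which \<sigma>(t) is in [0, 1]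
    form an interval, possibly empty; \<open>{a'..b'}\<close> below is its image under
    \<sigma>.\<close>
  obtain c2 d2 where T: "\<And>t. t \<in> {c2..d2} \<longleftrightarrow> t \<in> {c'..d'} \<and> t \<in> {0..1} \<and> p + e * t \<in> {0..1}"
  proof -
    from e show ?thesis
    proof
      assume "e = 1"
      then show ?thesis by (intro that[of "max (max c' 0) (- p)" "min (min d' 1) (1 - p)"]) auto
    next
      assume "e = -1"
      then show ?thesis by (intro that[of "max (max c' 0) (p - 1)" "min (min d' 1) p"]) auto
    qed
  qed
  obtain a' b' where S: "\<And>s. q + e * s \<in> {c2..d2} \<longleftrightarrow> s \<in> {a'..b'}"
  proof -
    from e show ?thesis
    proof
      assume "e = 1"
      then show ?thesis by (intro that[of "c2 - q" "d2 - q"]) auto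
    next
      assume "e = -1"
      then show ?thesis by (intro that[of "q - d2" "q - c2"]) auto
    qed
  qed
  have S01: "s \<in> {0..1}" "q + e * s \<in> {c'..d'}" "q + e * s \<in> {0..1}" "\<sigma> (q + e * s) = s"
    if "s \<in> {a'..b'}" for s
  proof -
    have "q + e * s \<in> {c2..d2}" using S that by blast
    then have "q + e * s \<in> {c'..d'} \<and> q + e * s \<in> {0..1} \<and> p + e * (q + e * s) \<in> {0..1}" using T by blast
    then show "s \<in> {0..1}" "q + e * s \<in> {c'..d'}" "q + e * s \<in> {0..1}" "\<sigma> (q + e * s) = s"
      using \<sigma>[of "q + e * s"] by (simp_all only: inv2)
  qed
  have fin: "finite {s \<in> {a'..b'}. u s = g (q + e * s)}"
  proof (cases "a' \<le> b'")
    case False then show ?thesis by simp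
  next
    case True
    then have ab: "0 \<le> a'" "b' \<le> 1" using S01(1)[of a'] S01(1)[of b'] by auto
    have cd2: "c' \<le> c2" "d2 \<le> d'"
    proof -
      have "q + e * a' \<in> {c2..d2}" using S True by auto
      then have "c2 \<le> d2" by simp
      then show "c' \<le> c2" "d2 \<le> d'" using T[of c2] T[of d2] by auto
    qed
    have wd: "weak_deriv2 (\<lambda>s. g (q + e * s)) (\<lambda>s. g2 (q + e * s)) a' b'"
      by (rule weak_deriv2_isometry[OF weak_deriv2_subset[OF W21_with_imp_weak_deriv2[OF W] cd2] e S])
    have "integrable (lebesgue_on {c2..d2}) \<psi>"
      using cd2 by (intro Equivalence_Lebesgue_Henstock_Integration.integrable_subinterval[OF \<psi>]) auto
    then have \<psi>i: "integrable (lebesgue_on {a'..b'}) (\<lambda>s. \<psi> (q + e * s))"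
      using isometry_lebesgue_on(1)[OF ee(2) S] by blast
    have \<psi>p: "AE s in lebesgue. s \<in> {a'..b'} \<longrightarrow> 0 < \<psi> (q + e * s)"
      using AE_lebesgue_isometry[OF \<psi>_pos ee(3), of q]
    proof eventually_elim
      case (elim s)
      then show ?case using S01[of s] by metis
    qed
    note fin = limit_curve_crossings[OF ab wd \<psi>i \<psi>p _ \<epsilon>]
    from adm' show ?thesis
    proof
      assume "AE t in lebesgue. t \<in> {c'..d'} \<and> t \<in> {0..1} \<and> \<sigma> t \<in> {0..1} \<longrightarrow>
        (\<forall>y\<in>{g t - \<epsilon>..g t + \<epsilon>}. 0 \<le> y \<longrightarrow> (\<forall>z\<ge>0. - g2 t + \<psi> t < l * f (\<sigma> t) y z))"
      from AE_lebesgue_isometry[OF this ee(3), of q]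
      have "AE s in lebesgue. s \<in> {a'..b'} \<longrightarrow> (\<forall>y\<in>{g (q + e * s) - \<epsilon>..g (q + e * s) + \<epsilon>}. 0 \<le> y \<longrightarrow>
        (\<forall>z\<ge>0. \<psi> (q + e * s) \<le> 1 * (l * f s y z + g2 (q + e * s))))"
      proof eventually_elim
        case (elim s)
        show ?case
        proof (intro impI ballI allI)
          fix y z assume *: "s \<in> {a'..b'}" "y \<in> {g (q + e * s) - \<epsilon>..g (q + e * s) + \<epsilon>}" "0 \<le> y" "0 \<le> (z::real)"
          then have "- g2 (q + e * s) + \<psi> (q + e * s) < l * f s y z" using elim S01[OF *(1)] by metis
          then show "\<psi> (q + e * s) \<le> 1 * (l * f s y z + g2 (q + e * s))" by simp
        qed
      qed
      then show ?thesis by (intro fin[of 1]) auto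
    next
      assume "AE t in lebesgue. t \<in> {c'..d'} \<and> t \<in> {0..1} \<and> \<sigma> t \<in> {0..1} \<longrightarrow>
        (\<forall>y\<in>{g t - \<epsilon>..g t + \<epsilon>}. 0 \<le> y \<longrightarrow> (\<forall>z\<ge>0. - g2 t - \<psi> t > l * f (\<sigma> t) y z))"
      from AE_lebesgue_isometry[OF this ee(3), of q]
      have "AE s in lebesgue. s \<in> {a'..b'} \<longrightarrow> (\<forall>y\<in>{g (q + e * s) - \<epsilon>..g (q + e * s) + \<epsilon>}. 0 \<le> y \<longrightarrow>
        (\<forall>z\<ge>0. \<psi> (q + e * s) \<le> (-1) * (l * f s y z + g2 (q + e * s))))"
      proof eventually_elim
        case (elim s)
        show ?case
        proof (intro impI ballI allI)
          fix y z assume *: "s \<in> {a'..b'}" "y \<in> {g (q + e * s) - \<epsilon>..g (q + e * s) + \<epsilon>}" "0 \<le> y" "0 \<le> (z::real)"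
          then have "- g2 (q + e * s) - \<psi> (q + e * s) > l * f s y z" using elim S01[OF *(1)] by metis
          then show "\<psi> (q + e * s) \<le> (-1) * (l * f s y z + g2 (q + e * s))" by simp
        qed
      qed
      then show ?thesis by (intro fin[of "-1"]) auto
    qed
  qed
  have "finite ((\<lambda>s. q + e * s) ` {s \<in> {a'..b'}. u s = g (q + e * s)})" using fin by simp
  from AE_finite_avoid[OF this] past show ?thesis
  proof eventually_elim
    case (elim t)
    show ?case
    proof (intro impI notI)
      assume t: "t \<in> {c'..d'} \<and> t \<in> {0..1}" and eq: "u (\<sigma> t) = g t"
      have \<sigma>t: "\<sigma> t = p + e * t" using \<sigma> t by blast
      have "\<sigma> t \<in> {-r..1}" using t \<sigma>_range by blast
      then consider "\<sigma> t \<in> {-r..0}" | "\<sigma> t \<in> {0..1}" by fastforce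
      then show False
      proof cases
        case 1
        then have "u (\<sigma> t) = \<omega> (\<sigma> t)" using w_nonpos[of "\<sigma> t"] by (simp add: u yfun_def)
        then show False using elim 1 t eq by auto
      next
        case 2
        then have "t \<in> {c2..d2}" using T t \<sigma>t by simp
        then have "\<sigma> t \<in> {a'..b'}" using S[of "\<sigma> t"] inv1 \<sigma>t by simp
        moreover have "t = q + e * \<sigma> t" using inv1 \<sigma>t by simp
        ultimately have "t \<in> (\<lambda>s. q + e * s) ` {s \<in> {a'..b'}. u s = g (q + e * s)}" using eq by auto
        then show False using elim by blast
      qed
    qed
  qed
qed

text \<open>At a curve-free pair (u(t), u(\<sigma>(t))), continuity relative to the curve-free
  points puts the sampled values of f into a small ball around the limit value. A ball is convex, so
  it contains the hull and with it \<open>h m t\<close>.\<close>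

lemma limit_forcing:
  assumes cont: "AE t in lebesgue. t \<in> {0..1} \<longrightarrow> continuous_on (free1 t \<times> free2 t) (\<lambda>p. f t (fst p) (snd p))"
    and avoid: "AE t in lebesgue. t \<in> {0..1} \<longrightarrow> u t \<in> free1 t \<and> u (\<sigma> t) \<in> free2 t"
  shows "AE t in lebesgue. t \<in> {0..1} \<longrightarrow> (\<lambda>m. h m t) \<longlonglongrightarrow> f t (u t) (u (\<sigma> t))"
proof -
  \<comment> \<open>The thresholds are fixed before t. The exceptional null sets are then indexed by
    k and m, hence countably many, and off their union all hull conditions hold at once.\<close>
  have "\<exists>N. \<forall>m\<ge>N. AE t in lebesgue. t \<in> {0..1} \<longrightarrow> h m t \<in> hull_at (1 / Suc k) u t" for k
    using hull[of "1 / Suc k"] unfolding eventually_sequentially by simp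
  then obtain N where N: "\<And>k m. m \<ge> N k \<Longrightarrow> AE t in lebesgue. t \<in> {0..1} \<longrightarrow> h m t \<in> hull_at (1 / Suc k) u t"
    by metis
  have "AE t in lebesgue. \<forall>k m. m \<ge> N k \<longrightarrow> t \<in> {0..1} \<longrightarrow> h m t \<in> hull_at (1 / Suc k) u t"
    unfolding AE_all_countable using N by auto
  then show ?thesis using cont avoid
  proof eventually_elim
    case (elim t)
    show ?case
    proof (intro impI LIMSEQ_I)
      fix e :: real assume t: "t \<in> {0..1}" and e: "0 < e"
      let ?P = "(u t, u (\<sigma> t))"
      let ?v = "f t (u t) (u (\<sigma> t))"
      have "?P \<in> free1 t \<times> free2 t" using elim t by auto
      then obtain \<delta>' where \<delta>': "0 < \<delta>'" "\<forall>P'\<in>free1 t \<times> free2 t. dist P' ?P < \<delta>' \<longrightarrow>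
        dist (f t (fst P') (snd P')) ?v < e / 2"
        using elim(2) t e unfolding continuous_on_iff by (metis fst_conv half_gt_zero snd_conv)
      obtain k :: nat where k: "2 / \<delta>' < k" using reals_Archimedean2 by blast
      have k': "1 / Suc k < \<delta>' / 2"
      proof -
        have "2 / \<delta>' < real (Suc k)" using k by simp
        then show ?thesis using \<delta>'(1) by (simp add: field_simps)
      qed
      have "hull_at (1 / Suc k) u t \<subseteq> cball ?v (e / 2)"
        unfolding hull_at_def
      proof (rule hull_minimal)
        show "{f t x z |x z. x \<in> free1 t \<and> z \<in> free2 t \<and> \<bar>x - u t\<bar> < 1 / Suc k \<and> \<bar>z - u (\<sigma> t)\<bar> < 1 / Suc k}
          \<subseteq> cball ?v (e / 2)"
        proof clarify
          fix x z assume x: "x \<in> free1 t" "z \<in> free2 t" "\<bar>x - u t\<bar> < 1 / Suc k" "\<bar>z - u (\<sigma> t)\<bar> < 1 / Suc k"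
          have "dist (x, z) ?P \<le> \<bar>x - u t\<bar> + \<bar>z - u (\<sigma> t)\<bar>"
            unfolding dist_Pair_Pair dist_real_def by (rule order.trans[OF sqrt_sum_squares_le_sum_abs]) simp
          also have "\<dots> < \<delta>'" using x k' by linarith
          finally have "dist (f t x z) ?v < e / 2" using \<delta>'(2) x by force
          then show "f t x z \<in> cball ?v (e / 2)" by (simp add: dist_commute)
        qed
      qed (rule convex_cball)
      then have "h m t \<in> cball ?v (e / 2)" if "N k \<le> m" for m using elim(1) t that by blast
      then have "norm (h m t - ?v) < e" if "N k \<le> m" for m
        using that e by (fastforce simp: dist_real_def abs_minus_commute)
      then show "\<exists>no. \<forall>m\<ge>no. norm (h m t - ?v) < e" by blast
    qed
  qed
qed

text \<open>The kernel is at most 1, so \<open>M\<close> dominates the integrands and w = l *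
  \<open>Kop F\<close>. The cone inequality is \<open>kern_quarter\<close> integrated against the
  nonnegative \<open>F\<close>.\<close>

lemma limit_equation:
  assumes norm: "supnorm 0 1 w = \<rho>"
    and conv: "AE t in lebesgue. t \<in> {0..1} \<longrightarrow> (\<lambda>m. h m t) \<longlonglongrightarrow> f t (u t) (u (\<sigma> t))"
  shows "u \<in> bdryK r \<omega> \<rho>" "\<And>t. t \<in> {-r..1} \<Longrightarrow> u t = yfun \<omega> t + l * Kop (\<lambda>s. f s (u s) (u (\<sigma> s))) t"
proof -
  define F where "F s = f s (u s) (u (\<sigma> s))" for s
  note w0 = w_nonneg
  have w01: "continuous_on {0..1} w" using r by (auto intro: continuous_on_subset[OF w_cont])
  have w\<rho>: "w t \<le> \<rho>" if t: "t \<in> {-r..1}" for t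
  proof (cases "t \<le> 0")
    case True then show ?thesis using w_nonpos[of t] t \<rho> by auto
  next
    case False then show ?thesis using supnorm_upper[OF w01, of t] t norm by auto
  qed
  have uR: "0 \<le> u t \<and> u t \<le> R" if t: "t \<in> {-r..1}" for t
    using w0[OF t] w\<rho>[OF t] yfun_bounds[OF \<omega>_cont \<omega>_nonneg r t] by (auto simp: u R_def)
  have F: "F \<in> forcings M \<delta>" unfolding F_def by (rule superposition_in_forcings[OF u_cont uR])
  have lim: "(\<lambda>m. Kop (h m) t) \<longlonglongrightarrow> Kop F t" if t: "t \<le> 1" for t
    unfolding Kop_def
  proof (rule integral_dominated_convergence[where w = M])
    note i = integrable_kern_mult[OF forcings_integrable[OF M]]
    show "(\<lambda>s. kern t s * F s) \<in> borel_measurable (lebesgue_on {0..1})"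
      "(\<lambda>s. kern t s * h m s) \<in> borel_measurable (lebesgue_on {0..1})" for m
      using i[OF F] i[OF h] by auto
    show "integrable (lebesgue_on {0..1}) M" by (rule M)
    have sp: "AE s in lebesgue_on {0..1::real}. 0 \<le> s \<and> s \<le> 1" by (rule AE_I2) auto
    have "AE s in lebesgue_on {0..1}. (\<lambda>m. h m s) \<longlonglongrightarrow> F s"
      using conv by (simp add: AE_restrict_space_iff F_def)
    then show "AE s in lebesgue_on {0..1}. (\<lambda>m. kern t s * h m s) \<longlonglongrightarrow> kern t s * F s"
      by eventually_elim (intro tendsto_intros)
    show "AE s in lebesgue_on {0..1}. norm (kern t s * h m s) \<le> M s" for m
      using forcings_AE[OF h[of m]] sp
    proof eventually_elim
      case (elim s)
      have "kern t s * h m s \<le> 1 * h m s" using elim t kern_bounds[of t s] by (intro mult_right_mono) auto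
      moreover have "0 \<le> kern t s * h m s" using elim t kern_bounds[of t s] by auto
      ultimately show ?case using elim by simp
    qed
  qed
  have wF: "w t = l * Kop F t" if t: "t \<in> {-r..1}" for t
    using LIMSEQ_unique[OF w_lim[OF t] tendsto_mult[OF lam(2) lim]] t by auto
  show "u t = yfun \<omega> t + l * Kop (\<lambda>s. f s (u s) (u (\<sigma> s))) t" if "t \<in> {-r..1}" for t
  proof -
    have "F = (\<lambda>s. f s (u s) (u (\<sigma> s)))" by (simp add: F_def fun_eq_iff)
    moreover have "u t = yfun \<omega> t + w t" by (simp add: u)
    ultimately show ?thesis using wF[OF that] by (simp only:)
  qed
  have "w \<in> Kcone r"
    unfolding Kcone_def
  proof (intro CollectI conjI ballI)
    show "continuous_on {-r..1} w" by (rule w_cont)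
    show "0 \<le> w t" if "t \<in> {-r..1}" for t by (rule w0[OF that])
    show "w t = 0" if "t \<in> {-r..0}" for t by (rule w_nonpos[OF that])
    show "1 / 4 * supnorm 0 1 w \<le> (INF t\<in>{1/4..3/4}. w t)"
    proof (rule cINF_greatest)
      fix t :: real assume t: "t \<in> {1/4..3/4}"
      have tr: "t \<in> {-r..1}" using t r by auto
      have "supnorm 0 1 w \<le> 4 * w t"
      proof (rule supnorm_least)
        fix t' :: real assume t': "t' \<in> {0..1}"
        have t'r: "t' \<in> {-r..1}" using t' r by auto
        have "Kop F t' \<le> integral\<^sup>L (lebesgue_on {0..1}) (\<lambda>s. 4 * (kern t s * F s))"
          unfolding Kop_def
        proof (rule integral_mono_AE)
          have sp: "AE s in lebesgue_on {0..1::real}. 0 \<le> s \<and> s \<le> 1" by (rule AE_I2) auto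
          show "AE s in lebesgue_on {0..1}. kern t' s * F s \<le> 4 * (kern t s * F s)"
            using forcings_AE[OF F] sp
          proof eventually_elim
            case (elim s)
            then have "1 / 4 * kern t' s \<le> kern t s" using t t' by (intro kern_quarter) auto
            then have "kern t' s * F s \<le> (4 * kern t s) * F s" using elim by (intro mult_right_mono) auto
            then show ?case by (simp add: mult_ac)
          qed
        qed (use integrable_kern_mult[OF forcings_integrable[OF M F]] in auto)
        also have "\<dots> = 4 * Kop F t" by (simp add: Kop_def)
        finally have "l * Kop F t' \<le> l * (4 * Kop F t)" using lam(3) by (intro mult_left_mono) auto
        then show "\<bar>w t'\<bar> \<le> 4 * w t" using w0[OF t'r] wF[OF t'r] wF[OF tr] by simp
      qed simp
      then show "1 / 4 * supnorm 0 1 w \<le> w t" by simp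
    qed simp
  qed
  then show "u \<in> bdryK r \<omega> \<rho>" unfolding bdryK_def using norm by (auto simp: u intro!: bexI[of _ w])
qed

end

end

section \<open>Affine delays and existence of the solution\<close>

lemma constant_slope_affine:
  fixes \<sigma> :: "real \<Rightarrow> real"
  assumes "\<forall>t\<in>{0..1}. (\<sigma> has_real_derivative e) (at t within {0..1})" "t \<in> {0..1}"
  shows "\<sigma> t = \<sigma> 0 + e * t"
proof -
  have "((\<lambda>t. \<sigma> t - e * t) has_real_derivative 0) (at s within {0..1})" if "s \<in> {0..1}" for s
    using assms(1) that by (auto intro!: derivative_eq_intros)
  then obtain k where k: "\<forall>s\<in>{0..1}. \<sigma> s - e * s = k"
    using has_field_derivative_zero_constant[of "{0..1::real}" "\<lambda>t. \<sigma> t - e * t"] by auto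
  have "\<sigma> t - e * t = k" "\<sigma> 0 - e * 0 = k" using k assms(2) by (blast, force)
  then show ?thesis by simp
qed

theorem theorem3p8:
  fixes r \<rho> lbar :: real
    and \<omega> \<sigma> \<delta> :: "real \<Rightarrow> real"
    and f :: "real \<Rightarrow> real \<Rightarrow> real \<Rightarrow> real"
    and \<gamma> \<Gamma> :: "nat \<Rightarrow> real \<Rightarrow> real"
    and a b c d :: "nat \<Rightarrow> real"
  assumes r: "0 \<le> r"
    and \<omega>_cont: "continuous_on {-r..0} \<omega>"
    and \<omega>_nonneg: "\<forall>t\<in>{-r..0}. 0 \<le> \<omega> t"
    and \<sigma>_range: "\<sigma> ` {0..1} \<subseteq> {-r..1}"
    and \<sigma>_deriv: "(\<forall>t\<in>{0..1}. (\<sigma> has_real_derivative 1) (at t within {0..1}))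
                 \<or> (\<forall>t\<in>{0..1}. (\<sigma> has_real_derivative -1) (at t within {0..1}))"
    and f_nonneg: "\<forall>t\<in>{0..1}. \<forall>u\<ge>0. \<forall>v\<ge>0. 0 \<le> f t u v"
    and \<rho>: "0 < \<rho>"
    and H1: "\<forall>u v. continuous_on {0..1} u \<and> (\<forall>t\<in>{0..1}. 0 \<le> u t)
                 \<and> continuous_on {0..1} v \<and> (\<forall>t\<in>{0..1}. 0 \<le> v t)
              \<longrightarrow> (\<lambda>t. f t (u t) (v t)) \<in> borel_measurable (lebesgue_on {0..1})"
    and H2: "\<exists>M. integrable (lebesgue_on {0..1}) M \<and>
              (AE t in lebesgue. t \<in> {0..1} \<longrightarrow>
                 (\<forall>u v. 0 \<le> u \<and> u \<le> \<rho> + supnorm (-r) 0 \<omega> \<and> 0 \<le> v \<and> v \<le> \<rho> + supnorm (-r) 0 \<omega>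
                        \<longrightarrow> f t u v \<le> M t))"
    and H3_int: "integrable (lebesgue_on {1/4..3/4}) \<delta>"
    and H3_bound: "AE t in lebesgue. t \<in> {1/4..3/4} \<longrightarrow>
                 (\<forall>u v. 0 \<le> u \<and> u \<le> \<rho> + supnorm (-r) 0 \<omega> \<and> 0 \<le> v \<and> v \<le> \<rho> + supnorm (-r) 0 \<omega>
                        \<longrightarrow> \<delta> t \<le> f t u v)"
    and H3_pos: "0 < deltabar \<delta>"
    and D_cont: "AE t in lebesgue. t \<in> {0..1} \<longrightarrow>
                 continuous_on
                   (({0..} - {\<gamma> n t |n. t \<in> {a n..b n}}) \<times> ({0..} - {\<Gamma> j t |j. t \<in> {c j..d j}}))
                   (\<lambda>p. f t (fst p) (snd p))"
    and D_lambda: "\<rho> / deltabar \<delta> < lbar"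
    and D_curves: "\<forall>lam\<in>{0<..lbar}.
                 (\<forall>n. adm_curve lam f (\<gamma> n) (a n) (b n))
               \<and> (\<forall>j. adm_curve_sigma lam r \<omega> \<sigma> f (\<Gamma> j) (c j) (d j))"
  shows "\<exists>lrho\<in>{0<..<lbar}. \<exists>u\<in>bdryK r \<omega> \<rho>.
           \<forall>t\<in>{-r..1}. u t = yfun \<omega> t
              + lrho * integral\<^sup>L (lebesgue_on {0..1}) (\<lambda>s. kern t s * f s (u s) (u (\<sigma> s)))"
proof -
  obtain e :: real where e: "e = 1 \<or> e = -1"
    and e_deriv: "\<forall>t\<in>{0..1}. (\<sigma> has_real_derivative e) (at t within {0..1})"
    using \<sigma>_deriv by blast
  have aff: "\<sigma> t = \<sigma> 0 + e * t" if "t \<in> {0..1}" for t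
    by (rule constant_slope_affine[OF e_deriv that])
  have \<sigma>_cont: "continuous_on {0..1} \<sigma>"
    using e_deriv by (intro DERIV_continuous_on) auto
  have lbar: "0 < lbar"
  proof -
    have "0 < \<rho> / deltabar \<delta>" using \<rho> H3_pos by simp
    then show ?thesis using D_lambda by linarith
  qed
  \<comment> \<open>Continuity of the curves does not depend on \<lambda>, so it can be read off at
    \<open>lbar\<close>.\<close>
  then have adm: "adm_curve lbar f (\<gamma> n) (a n) (b n)" "adm_curve_sigma lbar r \<omega> \<sigma> f (\<Gamma> n) (c n) (d n)" for n
    using D_curves by auto
  have \<gamma>_cont: "continuous_on {a n..b n} (\<gamma> n)" for n
    using adm(1)[of n] unfolding adm_curve_def by (blast intro: weak_deriv2D(1) W21_with_imp_weak_deriv2)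
  have \<Gamma>_cont: "continuous_on {c n..d n} (\<Gamma> n)" for n
    using adm(2)[of n] unfolding adm_curve_sigma_def by (blast intro: weak_deriv2D(1) W21_with_imp_weak_deriv2)
  obtain M where M: "integrable (lebesgue_on {0..1}) M"
    "AE t in lebesgue. t \<in> {0..1} \<longrightarrow>
       (\<forall>u v. 0 \<le> u \<and> u \<le> \<rho> + supnorm (-r) 0 \<omega> \<and> 0 \<le> v \<and> v \<le> \<rho> + supnorm (-r) 0 \<omega> \<longrightarrow> f t u v \<le> M t)"
    using H2 by blast
  interpret P: delay_bvp r \<rho> \<omega> \<sigma> M \<delta> f \<gamma> \<Gamma> a b c d
    by (rule delay_bvp.intro) (fact r \<omega>_cont \<omega>_nonneg \<sigma>_cont \<sigma>_range f_nonneg \<rho> H1 M H3_int H3_bound H3_pos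
      \<gamma>_cont \<Gamma>_cont)+
  obtain h lam l w where h: "\<And>m. h m \<in> forcings M \<delta>"
    and lam: "\<And>m::nat. 0 < lam m" "lam \<longlonglongrightarrow> l" "0 < l" "l \<le> \<rho> / deltabar \<delta>"
    and w: "continuous_on {-r..1} w" "\<And>t. t \<in> {-r..1} \<Longrightarrow> (\<lambda>m. lam m * Kop (h m) t) \<longlonglongrightarrow> w t"
    and norm: "supnorm 0 1 w = \<rho>"
    and hull: "\<And>e. 0 < e \<Longrightarrow> \<forall>\<^sub>F m in sequentially. AE t in lebesgue.
        t \<in> {0..1} \<longrightarrow> h m t \<in> P.hull_at e (\<lambda>t. yfun \<omega> t + w t) t"
    by (rule P.limit_of_approx_solutions) blast
  define u where "u = (\<lambda>t. yfun \<omega> t + w t)"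
  note hull' = hull[folded u_def]
  note lim = h lam(1-3) w hull' u_def
  \<comment> \<open>The strict inequality between \<rho> / \<open>deltabar \<delta>\<close> and
    \<open>lbar\<close> places the limit inside the open interval, although limits preserve only
    weak bounds.\<close>
  have l: "l < lbar" using lam(4) D_lambda by linarith
  have adm_l: "adm_curve l f (\<gamma> n) (a n) (b n)" "adm_curve_sigma l r \<omega> \<sigma> f (\<Gamma> n) (c n) (d n)" for n
    using D_curves lam(3) l by auto
  have "AE t in lebesgue. \<forall>n. t \<in> {a n..b n} \<longrightarrow> u t \<noteq> \<gamma> n t"
    unfolding AE_all_countable using P.avoids_adm_curve[OF lim adm_l(1)] by blast
  moreover have "AE t in lebesgue. \<forall>j. t \<in> {c j..d j} \<and> t \<in> {0..1} \<longrightarrow> u (\<sigma> t) \<noteq> \<Gamma> j t"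
    unfolding AE_all_countable using P.avoids_adm_curve_sigma[OF lim adm_l(2) e aff] by blast
  ultimately have "AE t in lebesgue. t \<in> {0..1} \<longrightarrow> u t \<in> P.free1 t \<and> u (\<sigma> t) \<in> P.free2 t"
  proof eventually_elim
    case (elim t)
    show ?case
    proof
      assume t: "t \<in> {0..1}"
      have "0 \<le> u s" if "s \<in> {-r..1}" for s
        by (rule P.limit_nonneg[OF lim that])
      moreover have "t \<in> {-r..1}" using t r by auto
      moreover have "\<sigma> t \<in> {-r..1}" using t \<sigma>_range by blast
      ultimately show "u t \<in> P.free1 t \<and> u (\<sigma> t) \<in> P.free2 t"
        using elim t unfolding P.free1_def P.free2_def by auto
    qed
  qed
  with D_cont have conv: "AE t in lebesgue. t \<in> {0..1} \<longrightarrow> (\<lambda>m. h m t) \<longlonglongrightarrow> f t (u t) (u (\<sigma> t))"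
    by (intro P.limit_forcing[OF lim]) (simp_all only: P.free1_def P.free2_def)
  show ?thesis
  proof (intro bexI[of _ l] bexI[of _ u] ballI)
    show "u t = yfun \<omega> t + l * integral\<^sup>L (lebesgue_on {0..1}) (\<lambda>s. kern t s * f s (u s) (u (\<sigma> s)))"
      if "t \<in> {-r..1}" for t
      unfolding Kop_def[symmetric] by (rule P.limit_equation(2)[OF lim norm conv that])
    show "u \<in> bdryK r \<omega> \<rho>" by (rule P.limit_equation(1)[OF lim norm conv])
  qed (use lam(3) l in auto)
qed

end
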